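(* Let $n\ge2$ and $s\in(\frac12,1]$. The set $\mathcal N^{1+s}:=\{\gamma\in H^{1+s}(\mathbb R/\mathbb Z,\mathbb R^n):|\gamma'|=1\text{ on }\mathbb R/\mathbb Z\}$ of arclength parametrized curves is a smooth submanifold of the open subset $H^{1+s}_{\mathrm r}(\mathbb R/\mathbb Z,\mathbb R^n)$ of $H^{1+s}(\mathbb R/\mathbb Z,\mathbb R^n)$, and the set $\mathcal A^{1+s}:=\{\gamma\in\mathcal N^{1+s}:\gamma|_{[0,1)}\text{ injective}\}$ of arclength parametrized knots is a smooth submanifold of the open subset $H^{1+s}_{\mathrm{ir}}(\mathbb R/\mathbb Z,\mathbb R^n)$ of $H^{1+s}(\mathbb R/\mathbb Z,\mathbb R^n)$.
   Context: $\mathbb R/\mathbb Z$ is the circle of length $1$. $H^{1+s}(\mathbb R/\mathbb Z,\mathbb R^n)=W^{1+s,2}(\mathbb R/\mathbb Z,\mathbb R^n)$ is the (for $s<1$ fractional) Sobolev Hilbert space of $1$-periodic functions, which for $s>\frac12$ embeds compactly into $C^1(\mathbb R/\mathbb Z,\mathbb R^n)$. $H^{1+s}_{\mathrm r}$ is the open subset of regular curves ($|\gamma'|>0$ everywhere), and $H^{1+s}_{\mathrm{ir}}$ is the open subset of regular curves that are injective on $[0,1)$. *)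

theory Defs
  imports "HOL-Analysis.Analysis"
begin

section \<open>Smooth maps between normed spaces given by a carrier and a norm\<close>

text \<open>
  The Sobolev space \<open>H\<^sup>1\<^sup>+\<^sup>s\<close> depends on the real number \<open>s\<close> and is therefore not a type.  A normed
  space is given here by a linear subspace \<open>E\<close> of a real vector space together with a norm
  \<open>nE\<close> on \<open>E\<close>.
\<close>

definition norm_topology :: "'a::real_vector set \<Rightarrow> ('a \<Rightarrow> real) \<Rightarrow> 'a topology" where
  "norm_topology E nE = Metric_space.mtopology E (\<lambda>x y. nE (x - y))"

text \<open>A \<open>k\<close>-linear map takes the list of its \<open>k\<close> arguments.\<close>

definition bounded_multilinear_on ::
  "'a::real_vector set \<Rightarrow> ('a \<Rightarrow> real) \<Rightarrow> 'b::real_vector set \<Rightarrow> ('b \<Rightarrow> real) \<Rightarrow> nat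
    \<Rightarrow> ('a list \<Rightarrow> 'b) \<Rightarrow> bool" where
  "bounded_multilinear_on E nE F nF k L \<longleftrightarrow>
     (\<forall>vs. length vs = k \<and> set vs \<subseteq> E \<longrightarrow> L vs \<in> F) \<and>
     (\<forall>vs i v w c. length vs = k \<and> set vs \<subseteq> E \<and> i < k \<and> v \<in> E \<and> w \<in> E \<longrightarrow>
        L (vs[i := c *\<^sub>R v + w]) = c *\<^sub>R L (vs[i := v]) + L (vs[i := w])) \<and>
     (\<exists>B. \<forall>vs. length vs = k \<and> set vs \<subseteq> E \<longrightarrow> nF (L vs) \<le> B * prod_list (map nE vs))"

text \<open>
  Frechet differentiability at \<open>x\<close>, relative to the open set \<open>U\<close>, of a map \<open>T\<close> from \<open>U\<close> to the
  bounded \<open>k\<close>-linear maps with the operator norm.  The derivative is the \<open>(k+1)\<close>-linear map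
  \<open>T'\<close>, whose first argument is the direction of differentiation.
\<close>

definition has_multilinear_derivative_at ::
  "'a::real_vector set \<Rightarrow> ('a \<Rightarrow> real) \<Rightarrow> ('b::real_vector \<Rightarrow> real) \<Rightarrow> nat \<Rightarrow> 'a set
    \<Rightarrow> ('a \<Rightarrow> 'a list \<Rightarrow> 'b) \<Rightarrow> ('a list \<Rightarrow> 'b) \<Rightarrow> 'a \<Rightarrow> bool" where
  "has_multilinear_derivative_at E nE nF k U T T' x \<longleftrightarrow>
     (\<forall>e>0. \<exists>d>0. \<forall>y\<in>U. nE (y - x) < d \<longrightarrow>
        (\<forall>vs. length vs = k \<and> set vs \<subseteq> E \<longrightarrow>
           nF (T y vs - T x vs - T' ((y - x) # vs)) \<le> e * nE (y - x) * prod_list (map nE vs)))"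

text \<open>\<open>C\<^sup>\<infinity>\<close> in the sense of Frechet: \<open>D k x\<close> is the \<open>k\<close>-th derivative of \<open>f\<close> at \<open>x\<close>.\<close>

definition smooth_map_on ::
  "'a::real_vector set \<Rightarrow> ('a \<Rightarrow> real) \<Rightarrow> 'b::real_vector set \<Rightarrow> ('b \<Rightarrow> real) \<Rightarrow> 'a set
    \<Rightarrow> ('a \<Rightarrow> 'b) \<Rightarrow> bool" where
  "smooth_map_on E nE F nF U f \<longleftrightarrow>
     openin (norm_topology E nE) U \<and>
     (\<exists>D. (\<forall>x\<in>U. D 0 x [] = f x) \<and>
          (\<forall>k. \<forall>x\<in>U. bounded_multilinear_on E nE F nF k (D k x)) \<and>
          (\<forall>k. \<forall>x\<in>U. has_multilinear_derivative_at E nE nF k U (D k) (D (Suc k) x) x))"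

definition smooth_diffeomorphism ::
  "'a::real_vector set \<Rightarrow> ('a \<Rightarrow> real) \<Rightarrow> 'a set \<Rightarrow> 'a set \<Rightarrow> ('a \<Rightarrow> 'a) \<Rightarrow> bool" where
  "smooth_diffeomorphism E nE U V \<phi> \<longleftrightarrow>
     bij_betw \<phi> U V \<and> smooth_map_on E nE E nE U \<phi> \<and> smooth_map_on E nE E nE V (inv_into U \<phi>)"

text \<open>\<open>F\<close> is a closed subspace of \<open>E\<close> that has a closed complement \<open>G\<close>.\<close>

definition closed_splitting ::
  "'a::real_vector set \<Rightarrow> ('a \<Rightarrow> real) \<Rightarrow> 'a set \<Rightarrow> 'a set \<Rightarrow> bool" where
  "closed_splitting E nE F G \<longleftrightarrow>
     subspace F \<and> subspace G \<and>
     closedin (norm_topology E nE) F \<and> closedin (norm_topology E nE) G \<and>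
     F \<inter> G = {0} \<and> {f + g |f g. f \<in> F \<and> g \<in> G} = E"

text \<open>
  \<open>S\<close> is a smooth submanifold of the open subset \<open>\<Omega>\<close> of \<open>E\<close>: around each of its points there is a
  smooth chart of \<open>\<Omega>\<close> that flattens \<open>S\<close> to a closed complemented subspace.
\<close>

definition smooth_submanifold ::
  "'a::real_vector set \<Rightarrow> ('a \<Rightarrow> real) \<Rightarrow> 'a set \<Rightarrow> 'a set \<Rightarrow> bool" where
  "smooth_submanifold E nE \<Omega> S \<longleftrightarrow>
     openin (norm_topology E nE) \<Omega> \<and> S \<subseteq> \<Omega> \<and>
     (\<forall>x\<in>S. \<exists>U V \<phi> F G.
        x \<in> U \<and> U \<subseteq> \<Omega> \<and>
        openin (norm_topology E nE) U \<and> openin (norm_topology E nE) V \<and>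
        smooth_diffeomorphism E nE U V \<phi> \<and>
        closed_splitting E nE F G \<and>
        \<phi> ` (S \<inter> U) = V \<inter> F)"

section \<open>Sobolev spaces of closed curves\<close>

definition periodic1 :: "(real \<Rightarrow> 'b) \<Rightarrow> bool" where
  "periodic1 f \<longleftrightarrow> (\<forall>t. f (t + 1) = f t)"

definition L2_periodic :: "(real \<Rightarrow> 'b::euclidean_space) set" where
  "L2_periodic = {f. periodic1 f \<and> f \<in> borel_measurable lborel \<and>
     set_integrable lborel {0..1} (\<lambda>t. (norm (f t))\<^sup>2)}"

definition L2_norm_sq :: "(real \<Rightarrow> 'b::euclidean_space) \<Rightarrow> real" where
  "L2_norm_sq f = (LINT t:{0..1}|lborel. (norm (f t))\<^sup>2)"

definition has_weak_derivative ::
  "(real \<Rightarrow> 'b::euclidean_space) \<Rightarrow> (real \<Rightarrow> 'b) \<Rightarrow> bool" where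
  "has_weak_derivative f g \<longleftrightarrow>
     (\<forall>(\<psi>::real \<Rightarrow> real) \<psi>'.
        periodic1 \<psi> \<and> (\<forall>t. (\<psi> has_real_derivative \<psi>' t) (at t)) \<and> continuous_on UNIV \<psi>' \<longrightarrow>
        (LINT t:{0..1}|lborel. \<psi>' t *\<^sub>R f t) = - (LINT t:{0..1}|lborel. \<psi> t *\<^sub>R g t))"

text \<open>
  \<open>weak_deriv f\<close> is determined only almost everywhere.  It is used below only in expressions that
  do not change when it is modified on a null set.
\<close>

definition weak_deriv :: "(real \<Rightarrow> 'b::euclidean_space) \<Rightarrow> (real \<Rightarrow> 'b)" where
  "weak_deriv f = (SOME g. g \<in> L2_periodic \<and> has_weak_derivative f g)"

definition weakly_differentiable :: "(real \<Rightarrow> 'b::euclidean_space) \<Rightarrow> bool" where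
  "weakly_differentiable f \<longleftrightarrow> (\<exists>g \<in> L2_periodic. has_weak_derivative f g)"

text \<open>Square of the Gagliardo (Sobolev-Slobodeckij) seminorm of order \<open>s < 1\<close> on the circle.\<close>

definition gagliardo_sq :: "real \<Rightarrow> (real \<Rightarrow> 'b::euclidean_space) \<Rightarrow> ennreal" where
  "gagliardo_sq s f =
     (\<integral>\<^sup>+u\<in>{0..1}. (\<integral>\<^sup>+w\<in>{-1/2..1/2}.
        ennreal ((norm (f (u + w) - f u))\<^sup>2 / \<bar>w\<bar> powr (1 + 2 * s)) \<partial>lborel) \<partial>lborel)"

text \<open>
  \<open>H\<^sup>1\<^sup>+\<^sup>s = W\<^sup>1\<^sup>+\<^sup>s\<^sup>,\<^sup>2\<close> for \<open>0 < s \<le> 1\<close>; the order \<open>s = 1\<close> is the classical \<open>W\<^sup>2\<^sup>,\<^sup>2\<close>.  Every class in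
  \<open>W\<^sup>1\<^sup>,\<^sup>2\<close> of the circle has exactly one continuous representative, and this representative is the
  element of \<open>sobolev s\<close>; being periodic, it is bounded.  For \<open>s > 1/2\<close> it is continuously
  differentiable, so that \<open>vector_derivative\<close> below is its classical derivative.
\<close>

definition sobolev :: "real \<Rightarrow> (real \<Rightarrow>\<^sub>C 'b::euclidean_space) set" where
  "sobolev s = {\<gamma>. periodic1 (apply_bcontfun \<gamma>) \<and>
     weakly_differentiable (apply_bcontfun \<gamma>) \<and>
     (if s = 1 then weakly_differentiable (weak_deriv (apply_bcontfun \<gamma>))
      else gagliardo_sq s (weak_deriv (apply_bcontfun \<gamma>)) < \<infinity>)}"

definition sobolev_norm :: "real \<Rightarrow> (real \<Rightarrow>\<^sub>C 'b::euclidean_space) \<Rightarrow> real" where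
  "sobolev_norm s \<gamma> = sqrt
     (L2_norm_sq (apply_bcontfun \<gamma>) + L2_norm_sq (weak_deriv (apply_bcontfun \<gamma>)) +
      (if s = 1 then L2_norm_sq (weak_deriv (weak_deriv (apply_bcontfun \<gamma>)))
       else enn2real (gagliardo_sq s (weak_deriv (apply_bcontfun \<gamma>)))))"

definition sobolev_regular :: "real \<Rightarrow> (real \<Rightarrow>\<^sub>C 'b::euclidean_space) set" where
  "sobolev_regular s =
     {\<gamma> \<in> sobolev s. \<forall>t. norm (vector_derivative (apply_bcontfun \<gamma>) (at t)) > 0}"

definition sobolev_injective_regular :: "real \<Rightarrow> (real \<Rightarrow>\<^sub>C 'b::euclidean_space) set" where
  "sobolev_injective_regular s =
     {\<gamma> \<in> sobolev_regular s. inj_on (apply_bcontfun \<gamma>) {0..<1}}"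

definition arclength_curves :: "real \<Rightarrow> (real \<Rightarrow>\<^sub>C 'b::euclidean_space) set" where
  "arclength_curves s =
     {\<gamma> \<in> sobolev s. \<forall>t. norm (vector_derivative (apply_bcontfun \<gamma>) (at t)) = 1}"

definition arclength_knots :: "real \<Rightarrow> (real \<Rightarrow>\<^sub>C 'b::euclidean_space) set" where
  "arclength_knots s = {\<gamma> \<in> arclength_curves s. inj_on (apply_bcontfun \<gamma>) {0..<1}}"

end

theory Submission
  imports Defs
begin

text \<open>
  Let \<open>\<gamma>\<close> be an arclength parametrized curve with velocity \<open>u\<close>. For \<open>h \<in> H\<^sup>1\<^sup>+\<^sup>s\<close>, the
  identity \<open>\<bar>u + h'\<bar>\<^sup>2 = 1 + 2 (u \<bullet> h' + \<bar>h'\<bar>\<^sup>2 / 2)\<close> shows that \<open>\<gamma> + h\<close> is parametrized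
  by arclength if and only if \<open>u \<bullet> h' + \<bar>h'\<bar>\<^sup>2 / 2 = 0\<close>. This is a quadratic perturbation
  of the linear condition \<open>u \<bullet> h' = 0\<close>. Suppose that \<open>h \<mapsto> u \<bullet> h'\<close>, as an operator from
  \<open>H\<^sup>1\<^sup>+\<^sup>s\<close> to the scalar functions in \<open>H\<^sup>s\<close>, has a bounded linear right inverse \<open>R\<close>, and
  put \<open>\<phi> (\<gamma> + h) = h + R (\<bar>h'\<bar>\<^sup>2) / 2\<close>. Then \<open>u \<bullet> (\<phi> (\<gamma> + h))' = u \<bullet> h' + \<bar>h'\<bar>\<^sup>2 / 2\<close>, so
  \<open>\<phi>\<close> maps the arclength parametrized curves near \<open>\<gamma>\<close> to the kernel of \<open>h \<mapsto> u \<bullet> h'\<close>. This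
  kernel is also the kernel of the bounded projection \<open>h \<mapsto> R (u \<bullet> h')\<close> and therefore
  complemented. Thus \<open>\<phi>\<close> is the required chart (\<open>smooth_submanifold_arclength\<close>).

  The right inverse has to produce closed curves. The field \<open>l u\<close> has tangential component
  \<open>l\<close> but in general a nonzero mean. Subtracting the normal part of a constant vector \<open>b\<close>
  does not change the tangential component, and \<open>b\<close> can be chosen such that the mean
  vanishes, because a closed curve does not run along a line at constant speed
  (\<open>mean_normal_part_surjective\<close>).

  The chart is \<open>h \<mapsto> h + Q h h\<close> with a bounded symmetric bilinear map \<open>Q\<close>. It is a
  polynomial, and on a small ball it is inverted by a contraction. The derivative of the
  inverse at \<open>y\<close> is the inverse of \<open>1 + 2 Q x\<close>, where \<open>x\<close> is the preimage of \<open>y\<close>. Hence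
  all higher derivatives are expressions in \<open>x\<close>, \<open>Q\<close> and this inverse operator. They are
  treated as syntactic objects, and an induction on the expression gives a Taylor estimate
  with quadratic remainder (\<open>jet_val_remainder\<close>, \<open>quadratic_constraint_chart\<close>).

  The analysis behind this consists of three facts about \<open>s > 1/2\<close>. The elements of
  \<open>H\<^sup>1\<^sup>+\<^sup>s\<close> are continuously differentiable (\<open>sobolevD\<close>): for \<open>s \<noteq> 1\<close>, the averages of the
  weak derivative over dyadic intervals converge uniformly (\<open>gagliardo_embedding\<close>); for
  \<open>s = 1\<close>, the weak derivative agrees almost everywhere with a primitive of the second one
  (\<open>du_Bois_Reymond\<close>). The velocities are bounded by their norm and form an algebra
  (\<open>Hs_norm_bilinear\<close>), which makes \<open>Q\<close> and \<open>R\<close> bounded. The space is complete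
  (\<open>sobolev_complete\<close>), by Fatou's lemma and the completeness of \<open>L\<^sup>2\<close>. The bound for the
  velocities also shows that regular curves and injective regular curves form open sets.
\<close>

section \<open>Normed spaces given by a carrier\<close>

text \<open>
  A Banach space given by a carrier and a norm. Nonnegativity and evenness of the norm are
  required on the whole type because the symmetry and nonnegativity axioms of a metric
  space are not restricted to its carrier.
\<close>

locale banach_carrier =
  fixes E :: "'a::real_vector set" and nE :: "'a \<Rightarrow> real"
  assumes E_subspace: "subspace E"
    and nE_nonneg [simp]: "0 \<le> nE x"
    and nE_uminus: "nE (- x) = nE x"
    and nE_eq_0: "x \<in> E \<Longrightarrow> nE x = 0 \<Longrightarrow> x = 0"
    and nE_scale: "x \<in> E \<Longrightarrow> nE (c *\<^sub>R x) = \<bar>c\<bar> * nE x"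
    and nE_triangle: "x \<in> E \<Longrightarrow> y \<in> E \<Longrightarrow> nE (x + y) \<le> nE x + nE y"
    and complete: "(\<And>n. \<sigma> n \<in> E) \<Longrightarrow> (\<And>e. e > 0 \<Longrightarrow> \<exists>N. \<forall>m\<ge>N. \<forall>n\<ge>N. nE (\<sigma> m - \<sigma> n) < e)
       \<Longrightarrow> \<exists>x\<in>E. (\<lambda>n. nE (\<sigma> n - x)) \<longlonglongrightarrow> 0"
begin

lemma E_zero [simp]: "0 \<in> E"
  and E_add [simp]: "x \<in> E \<Longrightarrow> y \<in> E \<Longrightarrow> x + y \<in> E"
  and E_scale [simp]: "x \<in> E \<Longrightarrow> c *\<^sub>R x \<in> E"
  and E_diff [simp]: "x \<in> E \<Longrightarrow> y \<in> E \<Longrightarrow> x - y \<in> E"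
  and E_uminus [simp]: "x \<in> E \<Longrightarrow> - x \<in> E"
  using E_subspace by (auto simp: subspace_def subspace_diff subspace_neg)

lemma nE_zero [simp]: "nE 0 = 0"
  using nE_scale[of 0 0] by simp

lemma nE_minus_commute: "nE (x - y) = nE (y - x)"
  using nE_uminus[of "x - y"] by simp

lemma nE_diff_le: "x \<in> E \<Longrightarrow> y \<in> E \<Longrightarrow> nE (x - y) \<le> nE x + nE y"
  using nE_triangle[of x "- y"] by (simp add: nE_uminus)

lemma nE_diff_trans: "x \<in> E \<Longrightarrow> y \<in> E \<Longrightarrow> z \<in> E \<Longrightarrow> nE (x - z) \<le> nE (x - y) + nE (y - z)"
  using nE_triangle[of "x - y" "y - z"] by simp

lemma Metric_space_nE: "Metric_space E (\<lambda>x y. nE (x - y))"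
proof
  show "nE (x - y) = nE (y - x)" for x y by (rule nE_minus_commute)
  show "nE (x - y) = 0 \<longleftrightarrow> x = y" if "x \<in> E" "y \<in> E" for x y
    using that nE_eq_0[of "x - y"] by auto
  show "nE (x - z) \<le> nE (x - y) + nE (y - z)" if "x \<in> E" "y \<in> E" "z \<in> E" for x y z
    using that by (rule nE_diff_trans)
qed simp

lemma openin_norm_topology:
  "openin (norm_topology E nE) U \<longleftrightarrow> U \<subseteq> E \<and> (\<forall>x\<in>U. \<exists>r>0. \<forall>y\<in>E. nE (y - x) < r \<longrightarrow> y \<in> U)"
proof -
  have "{y. x \<in> E \<and> y \<in> E \<and> nE (x - y) < r} \<subseteq> U \<longleftrightarrow> (\<forall>y\<in>E. nE (y - x) < r \<longrightarrow> y \<in> U)"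
    if "x \<in> E" for x r
    unfolding nE_minus_commute[of x] using that by blast
  then have "(\<forall>x. x \<in> U \<longrightarrow> (\<exists>r>0. {y. x \<in> E \<and> y \<in> E \<and> nE (x - y) < r} \<subseteq> U)) \<longleftrightarrow>
      (\<forall>x\<in>U. \<exists>r>0. \<forall>y\<in>E. nE (y - x) < r \<longrightarrow> y \<in> U)" if "U \<subseteq> E"
    using subsetD[OF that] by (simp only: Ball_def cong: imp_cong)
  then show ?thesis
    unfolding norm_topology_def Metric_space.openin_mtopology[OF Metric_space_nE]
      Metric_space.mball_def[OF Metric_space_nE] by (rule conj_cong[OF refl])
qed

lemma topspace_norm_topology [simp]: "topspace (norm_topology E nE) = E"
  unfolding norm_topology_def by (rule Metric_space.topspace_mtopology[OF Metric_space_nE])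

lemma contraction_fixed_point:
  assumes T: "\<And>x. x \<in> E \<Longrightarrow> nE x \<le> r \<Longrightarrow> T x \<in> E \<and> nE (T x) \<le> r" and "0 \<le> r"
    and lip: "\<And>x y. x \<in> E \<Longrightarrow> y \<in> E \<Longrightarrow> nE x \<le> r \<Longrightarrow> nE y \<le> r \<Longrightarrow>
      nE (T x - T y) \<le> 1/2 * nE (x - y)"
  obtains x where "x \<in> E" "nE x \<le> r" "T x = x"
proof -
  let ?M = "{x \<in> E. nE x \<le> r}"
  interpret M: Metric_space ?M "\<lambda>x y. nE (x - y)"
    by (rule Metric_space.subspace[OF Metric_space_nE]) auto
  have "M.mcomplete"
    unfolding M.mcomplete_def
  proof (intro allI impI)
    fix \<sigma> assume "M.MCauchy \<sigma>"
    then have \<sigma>: "\<sigma> n \<in> E" "nE (\<sigma> n) \<le> r" and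
      c: "e > 0 \<Longrightarrow> \<exists>N. \<forall>m\<ge>N. \<forall>n\<ge>N. nE (\<sigma> m - \<sigma> n) < e" for n e
      unfolding M.MCauchy_def by (auto simp: image_subset_iff)
    obtain x where x: "x \<in> E" "(\<lambda>n. nE (\<sigma> n - x)) \<longlonglongrightarrow> 0"
      using complete[OF \<sigma>(1) c] by (auto simp: Bex_def)
    have "nE x \<le> r + nE (\<sigma> n - x)" for n
      using nE_triangle[of "\<sigma> n" "x - \<sigma> n"] \<sigma>[of n] x nE_minus_commute[of x "\<sigma> n"] by auto
    then have "nE x \<le> r + 0"
      by (intro tendsto_lowerbound[OF tendsto_add[OF tendsto_const x(2)]]) auto
    moreover have "\<exists>N. \<forall>n\<ge>N. nE (\<sigma> n - x) < e" if "e > 0" for e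
      using x(2) that by (force simp: lim_sequentially)
    ultimately show "\<exists>x. limitin M.mtopology \<sigma> x sequentially"
      using x \<sigma> by (auto simp: M.limit_metric_sequentially)
  qed
  moreover have "?M \<noteq> {}" using \<open>0 \<le> r\<close> by (auto intro!: exI[of _ 0])
  moreover have "T \<in> ?M \<rightarrow> ?M" using T by auto
  moreover have "(1/2 :: real) < 1" by simp
  moreover have "nE (T x - T y) \<le> 1/2 * nE (x - y)" if "x \<in> ?M" "y \<in> ?M" for x y
    using that lip by auto
  ultimately obtain x where "x \<in> ?M" "T x = x"
    by (rule M.Banach_fixedpoint_thm)
  then show ?thesis using that by auto
qed

text \<open>
  The complement is open: if \<open>T x \<noteq> 0\<close>, then \<open>T\<close> cannot reach \<open>0\<close> within the distance
  \<open>nE (T x) / (\<bar>K\<bar> + 1)\<close> of \<open>x\<close>, because it is Lipschitz with constant \<open>K\<close>.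
\<close>

lemma closedin_kernel:
  assumes T: "\<And>x. x \<in> E \<Longrightarrow> T x \<in> E"
    and diff: "\<And>x y. x \<in> E \<Longrightarrow> y \<in> E \<Longrightarrow> T (x - y) = T x - T y"
    and bound: "\<And>x. x \<in> E \<Longrightarrow> nE (T x) \<le> K * nE x"
  shows "closedin (norm_topology E nE) {x \<in> E. T x = 0}"
  unfolding closedin_def topspace_norm_topology openin_norm_topology
proof (intro conjI ballI)
  fix x assume "x \<in> E - {x \<in> E. T x = 0}"
  then have x: "x \<in> E" "T x \<noteq> 0" by auto
  then have pos: "nE (T x) > 0"
    using nE_eq_0 nE_nonneg T by (metis order_le_less)
  have "T y \<noteq> 0" if y: "y \<in> E" "nE (y - x) < nE (T x) / (\<bar>K\<bar> + 1)" for y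
  proof
    assume "T y = 0"
    then have "nE (T x) = nE (T (y - x))"
      using diff[of y x] x y T by (simp add: nE_uminus)
    also have "\<dots> \<le> K * nE (y - x)" using bound x y by simp
    also have "\<dots> \<le> (\<bar>K\<bar> + 1) * nE (y - x)" using x y by (intro mult_right_mono) auto
    also have "\<dots> < nE (T x)" using y(2) by (simp add: pos_less_divide_eq mult.commute)
    finally show False by simp
  qed
  moreover have "nE (T x) / (\<bar>K\<bar> + 1) > 0" using pos by simp
  ultimately show "\<exists>r>0. \<forall>y\<in>E. nE (y - x) < r \<longrightarrow> y \<in> E - {x \<in> E. T x = 0}"
    by blast
qed auto

lemma closed_splitting_projection:
  assumes T: "\<And>x. x \<in> E \<Longrightarrow> T x \<in> E"
    and add: "\<And>x y. x \<in> E \<Longrightarrow> y \<in> E \<Longrightarrow> T (x + y) = T x + T y"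
    and scale: "\<And>x c. x \<in> E \<Longrightarrow> T (c *\<^sub>R x) = c *\<^sub>R T x"
    and bound: "\<And>x. x \<in> E \<Longrightarrow> nE (T x) \<le> K * nE x"
    and idem: "\<And>x. x \<in> E \<Longrightarrow> T (T x) = T x"
  shows "closed_splitting E nE {x \<in> E. T x = 0} {x \<in> E. T x = x}"
proof -
  have diff: "T (x - y) = T x - T y" if "x \<in> E" "y \<in> E" for x y
    using add[of "x - y" y] that by simp
  have T0: "T 0 = 0" using diff[of 0 0] by simp
  have bnd: "nE (T x - x) \<le> (1 + K) * nE x" if "x \<in> E" for x
    using nE_diff_le[of "T x" x] bound[of x] T that by (simp add: algebra_simps)
  have "closedin (norm_topology E nE) {x \<in> E. T x - x = 0}"
    by (rule closedin_kernel[where K = "1 + K"]) (simp_all add: T diff bnd)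
  then have cG: "closedin (norm_topology E nE) {x \<in> E. T x = x}" by simp
  have cF: "closedin (norm_topology E nE) {x \<in> E. T x = 0}"
    by (rule closedin_kernel[where K = K]) (simp_all add: T diff bound)
  have "x \<in> {f + g |f g. f \<in> {x \<in> E. T x = 0} \<and> g \<in> {x \<in> E. T x = x}}" if "x \<in> E" for x
  proof (rule CollectI, rule exI[of _ "x - T x"], rule exI[of _ "T x"])
    show "x = x - T x + T x \<and> x - T x \<in> {x \<in> E. T x = 0} \<and> T x \<in> {x \<in> E. T x = x}"
      using that by (simp add: T diff idem)
  qed
  then have "E \<subseteq> {f + g |f g. f \<in> {x \<in> E. T x = 0} \<and> g \<in> {x \<in> E. T x = x}}" by (rule subsetI)
  moreover have "{f + g |f g. f \<in> {x \<in> E. T x = 0} \<and> g \<in> {x \<in> E. T x = x}} \<subseteq> E"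
    by (rule subsetI) (elim CollectE exE conjE, simp)
  ultimately have sum: "{f + g |f g. f \<in> {x \<in> E. T x = 0} \<and> g \<in> {x \<in> E. T x = x}} = E"
    by (rule equalityI[rotated])
  have "subspace {x \<in> E. T x = 0}" "subspace {x \<in> E. T x = x}"
    using T0 by (auto simp: subspace_def add scale)
  moreover have "{x \<in> E. T x = 0} \<inter> {x \<in> E. T x = x} = {0}" using T0 by auto
  ultimately show ?thesis
    unfolding closed_splitting_def using cG cF sum by (intro conjI)
qed

end

section \<open>Inverting a quadratic perturbation of the identity\<close>

text \<open>
  The bound \<open>small\<close> on the radius makes \<open>2 Q x\<close>, for \<open>x\<close> in the ball of radius \<open>r\<close>, an
  operator of norm at most \<open>1/2\<close>. All inversions below are contractions for this reason.
\<close>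

locale quadratic_perturbation = banach_carrier E nE
  for E :: "'a::real_vector set" and nE :: "'a \<Rightarrow> real" +
  fixes Q :: "'a \<Rightarrow> 'a \<Rightarrow> 'a" and C r :: real
  assumes Q_in [simp]: "x \<in> E \<Longrightarrow> y \<in> E \<Longrightarrow> Q x y \<in> E"
    and Q_commute: "x \<in> E \<Longrightarrow> y \<in> E \<Longrightarrow> Q x y = Q y x"
    and Q_add_left: "x \<in> E \<Longrightarrow> y \<in> E \<Longrightarrow> z \<in> E \<Longrightarrow> Q (x + y) z = Q x z + Q y z"
    and Q_scale_left: "x \<in> E \<Longrightarrow> z \<in> E \<Longrightarrow> Q (c *\<^sub>R x) z = c *\<^sub>R Q x z"
    and Q_bound: "x \<in> E \<Longrightarrow> y \<in> E \<Longrightarrow> nE (Q x y) \<le> C * nE x * nE y"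
    and C_nonneg: "0 \<le> C" and r_pos: "0 < r" and small: "4 * C * r \<le> 1"
begin

lemma Q_add_right: "x \<in> E \<Longrightarrow> y \<in> E \<Longrightarrow> z \<in> E \<Longrightarrow> Q z (x + y) = Q z x + Q z y"
  using Q_add_left[of x y z] by (simp add: Q_commute)

lemma Q_scale_right: "x \<in> E \<Longrightarrow> z \<in> E \<Longrightarrow> Q z (c *\<^sub>R x) = c *\<^sub>R Q z x"
  using Q_scale_left[of x z c] by (simp add: Q_commute)

lemma Q_diff_left: "x \<in> E \<Longrightarrow> y \<in> E \<Longrightarrow> z \<in> E \<Longrightarrow> Q (x - y) z = Q x z - Q y z"
  using Q_add_left[of "x - y" y z] by simp

lemma Q_diff_right: "x \<in> E \<Longrightarrow> y \<in> E \<Longrightarrow> z \<in> E \<Longrightarrow> Q z (x - y) = Q z x - Q z y"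
  using Q_add_right[of "x - y" y z] by simp

lemma Q_zero [simp]: "x \<in> E \<Longrightarrow> Q 0 x = 0" "x \<in> E \<Longrightarrow> Q x 0 = 0"
  using Q_diff_left[of 0 0 x] Q_diff_right[of 0 0 x] by auto

lemma Q_le: "nE (Q x y) \<le> C * a * b"
  if "x \<in> E" "y \<in> E" "nE x \<le> a" "nE y \<le> b"
proof -
  have "nE (Q x y) \<le> C * (nE x * nE y)" using Q_bound[of x y] that by (simp add: mult.assoc)
  also have "\<dots> \<le> C * (a * b)"
    using that by (intro mult_left_mono mult_mono C_nonneg) (auto intro: order_trans[OF nE_nonneg])
  finally show ?thesis by (simp add: mult.assoc)
qed

lemma Q_small: "nE (Q x y) \<le> 1/4 * b" if "x \<in> E" "y \<in> E" "nE x \<le> r" "nE y \<le> b"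
proof -
  have "nE (Q x y) \<le> C * r * b" using that by (rule Q_le)
  also have "\<dots> \<le> 1/4 * b" using small order_trans[OF nE_nonneg that(4)] by (intro mult_right_mono) auto
  finally show ?thesis .
qed

text \<open>The inverse of \<open>1 + 2 Q x\<close>, which is the derivative at \<open>x\<close> of \<open>h \<mapsto> h + Q h h\<close>.\<close>

definition linv :: "'a \<Rightarrow> 'a \<Rightarrow> 'a" where
  "linv x v = (THE w. w \<in> E \<and> w + 2 *\<^sub>R Q x w = v)"

lemma linv_estimate:
  assumes "x \<in> E" "nE x \<le> r" "w \<in> E"
  shows "nE w \<le> 2 * nE (w + 2 *\<^sub>R Q x w)"
proof -
  have "nE w \<le> nE (w + 2 *\<^sub>R Q x w) + nE (2 *\<^sub>R Q x w)"
    using nE_diff_le[of "w + 2 *\<^sub>R Q x w" "2 *\<^sub>R Q x w"] assms by simp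
  also have "nE (2 *\<^sub>R Q x w) \<le> 1/2 * nE w"
    using Q_small[of x w "nE w"] assms by (simp add: nE_scale)
  finally show ?thesis by simp
qed

lemma linv:
  assumes x: "x \<in> E" "nE x \<le> r" and v: "v \<in> E"
  shows "linv x v \<in> E" "linv x v + 2 *\<^sub>R Q x (linv x v) = v" "nE (linv x v) \<le> 2 * nE v"
    and linv_unique: "w \<in> E \<Longrightarrow> w + 2 *\<^sub>R Q x w = v \<Longrightarrow> linv x v = w"
proof -
  have uniq: "w = w'" if "w \<in> E" "w' \<in> E" "w + 2 *\<^sub>R Q x w = v" "w' + 2 *\<^sub>R Q x w' = v" for w w'
  proof -
    have "(w - w') + 2 *\<^sub>R Q x (w - w') = (w + 2 *\<^sub>R Q x w) - (w' + 2 *\<^sub>R Q x w')"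
      using that x by (simp add: Q_diff_right algebra_simps)
    then have "nE (w - w') \<le> 0"
      using linv_estimate[OF x, of "w - w'"] that by simp
    then show ?thesis
      using nE_eq_0[of "w - w'"] that by (simp add: order.antisym)
  qed
  obtain w where "w \<in> E" "v - 2 *\<^sub>R Q x w = w"
  proof (rule contraction_fixed_point[of "2 * nE v" "\<lambda>w. v - 2 *\<^sub>R Q x w"])
    fix w assume w: "w \<in> E" "nE w \<le> 2 * nE v"
    show "v - 2 *\<^sub>R Q x w \<in> E \<and> nE (v - 2 *\<^sub>R Q x w) \<le> 2 * nE v"
      using nE_diff_le[of v "2 *\<^sub>R Q x w"] Q_small[OF x(1) w(1) x(2) w(2)] x w v by (simp add: nE_scale)
  next
    fix w z assume w: "w \<in> E" "z \<in> E"
    have "(v - 2 *\<^sub>R Q x w) - (v - 2 *\<^sub>R Q x z) = - (2 *\<^sub>R Q x (w - z))"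
      using x w by (simp add: Q_diff_right algebra_simps)
    then show "nE ((v - 2 *\<^sub>R Q x w) - (v - 2 *\<^sub>R Q x z)) \<le> 1/2 * nE (w - z)"
      using Q_small[of x "w - z" "nE (w - z)"] x w by (simp add: nE_scale nE_uminus)
  qed auto
  then have "w \<in> E \<and> w + 2 *\<^sub>R Q x w = v" by (metis diff_add_cancel)
  then have *: "linv x v \<in> E \<and> linv x v + 2 *\<^sub>R Q x (linv x v) = v"
    unfolding linv_def by (rule theI) (use uniq \<open>w \<in> E \<and> w + 2 *\<^sub>R Q x w = v\<close> in blast)
  then show "linv x v \<in> E" "linv x v + 2 *\<^sub>R Q x (linv x v) = v" by auto
  then show "nE (linv x v) \<le> 2 * nE v" using linv_estimate[OF x, of "linv x v"] by simp
  show "linv x v = w" if "w \<in> E" "w + 2 *\<^sub>R Q x w = v" for w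
    using that * uniq by blast
qed

lemma linv_add:
  assumes "x \<in> E" "nE x \<le> r" "v \<in> E" "w \<in> E"
  shows "linv x (v + w) = linv x v + linv x w"
proof (rule linv_unique)
  have "linv x v + linv x w + 2 *\<^sub>R Q x (linv x v + linv x w)
      = (linv x v + 2 *\<^sub>R Q x (linv x v)) + (linv x w + 2 *\<^sub>R Q x (linv x w))"
    using assms by (simp add: Q_add_right linv(1) algebra_simps)
  then show "linv x v + linv x w + 2 *\<^sub>R Q x (linv x v + linv x w) = v + w"
    using assms by (simp add: linv(2))
qed (use assms in \<open>auto simp: linv(1)\<close>)

lemma linv_scale:
  assumes "x \<in> E" "nE x \<le> r" "v \<in> E"
  shows "linv x (c *\<^sub>R v) = c *\<^sub>R linv x v"
proof (rule linv_unique)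
  have "c *\<^sub>R linv x v + 2 *\<^sub>R Q x (c *\<^sub>R linv x v) = c *\<^sub>R (linv x v + 2 *\<^sub>R Q x (linv x v))"
    using assms by (simp add: Q_scale_right linv(1) algebra_simps)
  then show "c *\<^sub>R linv x v + 2 *\<^sub>R Q x (c *\<^sub>R linv x v) = c *\<^sub>R v"
    using assms by (simp add: linv(2))
qed (use assms in \<open>auto simp: linv(1)\<close>)

lemma linv_diff:
  assumes "x \<in> E" "nE x \<le> r" "v \<in> E" "w \<in> E"
  shows "linv x (v - w) = linv x v - linv x w"
  using linv_add[of x "v - w" w] assms by simp

text \<open>
  A resolvent identity: \<open>S' = S + S (L - L') S'\<close> for inverses \<open>S, S'\<close> of \<open>L, L'\<close>. It is
  what makes the derivative of \<open>x \<mapsto> linv x v\<close> expressible through \<open>linv\<close> and \<open>Q\<close> alone.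
\<close>

lemma linv_change_base:
  assumes "x \<in> E" "nE x \<le> r" "x' \<in> E" "nE x' \<le> r" "v \<in> E"
  shows "linv x' v = linv x v - 2 *\<^sub>R linv x (Q (x' - x) (linv x' v))"
proof -
  let ?w' = "linv x' v" and ?w = "linv x v"
  have "?w' + 2 *\<^sub>R Q x' ?w' = v" "?w + 2 *\<^sub>R Q x ?w = v"
    using linv(2)[of x v] linv(2)[of x' v] assms by simp_all
  then have "(?w' - ?w) + 2 *\<^sub>R Q x (?w' - ?w) = - (2 *\<^sub>R Q (x' - x) ?w')"
    using assms by (simp add: Q_diff_right Q_diff_left linv(1) algebra_simps)
  then have "linv x (- (2 *\<^sub>R Q (x' - x) ?w')) = ?w' - ?w"
    using assms by (intro linv_unique) (auto simp: linv(1))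
  moreover have "linv x (- (2 *\<^sub>R Q (x' - x) ?w')) = (- 2) *\<^sub>R linv x (Q (x' - x) ?w')"
    using assms by (subst linv_scale[symmetric]) (auto simp: linv(1))
  ultimately show ?thesis by (simp add: algebra_simps)
qed

definition pert :: "'a \<Rightarrow> 'a" where "pert h = h + Q h h"

text \<open>
  The inverse of \<open>pert\<close> with values in the ball of radius \<open>r\<close>; \<open>y\<close> will range over the
  ball of radius \<open>r/2\<close>.
\<close>

definition pert_inv :: "'a \<Rightarrow> 'a" where "pert_inv y = (THE h. h \<in> E \<and> nE h \<le> r \<and> pert h = y)"

lemma pert_in [simp]: "h \<in> E \<Longrightarrow> pert h \<in> E" by (simp add: pert_def)

lemma pert_diff:
  assumes "h \<in> E" "h' \<in> E"
  shows "pert h' - pert h = (h' - h) + Q (h' + h) (h' - h)"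
  using assms by (simp add: pert_def Q_diff_right Q_add_left Q_commute[of h' h])

text \<open>
  By symmetry, \<open>Q h' h' - Q h h = Q (h' + h) (h' - h)\<close>, and \<open>Q (h' + h)\<close> has norm at most
  \<open>1/2\<close>.
\<close>

lemma pert_expansive:
  assumes "h \<in> E" "nE h \<le> r" "h' \<in> E" "nE h' \<le> r"
  shows "nE (h' - h) \<le> 2 * nE (pert h' - pert h)"
proof -
  have "nE (h' - h) \<le> nE (pert h' - pert h) + nE (Q (h' + h) (h' - h))"
    using nE_diff_le[of "pert h' - pert h" "Q (h' + h) (h' - h)"] pert_diff[of h h'] assms by simp
  also have "Q (h' + h) (h' - h) = Q h' (h' - h) + Q h (h' - h)"
    using assms by (simp add: Q_add_left)
  also have "nE \<dots> \<le> 1/2 * nE (h' - h)"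
    using nE_triangle[of "Q h' (h' - h)" "Q h (h' - h)"] Q_small[of h' "h' - h" "nE (h' - h)"]
      Q_small[of h "h' - h" "nE (h' - h)"] assms by simp
  finally show ?thesis by simp
qed

lemma pert_inj:
  assumes "h \<in> E" "nE h \<le> r" "h' \<in> E" "nE h' \<le> r" "pert h' = pert h"
  shows "h' = h"
  using pert_expansive[of h h'] nE_eq_0[of "h' - h"] assms by (simp add: order.antisym)

lemma pert_inv:
  assumes y: "y \<in> E" "nE y < r/2"
  shows "pert_inv y \<in> E" "nE (pert_inv y) < r" "pert (pert_inv y) = y"
    and pert_inv_unique: "h \<in> E \<Longrightarrow> nE h \<le> r \<Longrightarrow> pert h = y \<Longrightarrow> pert_inv y = h"
proof -
  obtain h where "h \<in> E" "nE h \<le> r" "y - Q h h = h"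
  proof (rule contraction_fixed_point[of r "\<lambda>h. y - Q h h"])
    fix h assume h: "h \<in> E" "nE h \<le> r"
    then show "y - Q h h \<in> E \<and> nE (y - Q h h) \<le> r"
      using nE_diff_le[of y "Q h h"] Q_small[of h h r] y r_pos by simp
  next
    fix h g assume h: "h \<in> E" "g \<in> E" "nE h \<le> r" "nE g \<le> r"
    have "(y - Q h h) - (y - Q g g) = - (Q h (h - g) + Q g (h - g))"
      using h by (simp add: Q_diff_right Q_commute[of g h])
    then have "nE ((y - Q h h) - (y - Q g g)) \<le> nE (Q h (h - g)) + nE (Q g (h - g))"
      using h nE_triangle[of "Q h (h - g)" "Q g (h - g)"] by (simp only: nE_uminus) simp
    then show "nE ((y - Q h h) - (y - Q g g)) \<le> 1/2 * nE (h - g)"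
      using Q_small[of h "h - g" "nE (h - g)"] Q_small[of g "h - g" "nE (h - g)"] h by simp
  qed (use r_pos in auto)
  then have h: "h \<in> E \<and> nE h \<le> r \<and> pert h = y"
    unfolding pert_def by (simp add: diff_eq_eq[THEN iffD1, symmetric])
  then have *: "pert_inv y \<in> E \<and> nE (pert_inv y) \<le> r \<and> pert (pert_inv y) = y"
    unfolding pert_inv_def by (rule theI) (use pert_inj[of h] h in auto)
  then show "pert_inv y \<in> E" "pert (pert_inv y) = y" by auto
  show "pert_inv y = h" if "h \<in> E" "nE h \<le> r" "pert h = y" for h
    using pert_inj[of h "pert_inv y"] that * by simp
  have "nE (pert_inv y) \<le> nE (pert (pert_inv y)) + nE (Q (pert_inv y) (pert_inv y))"
    using nE_diff_le[of "pert (pert_inv y)" "Q (pert_inv y) (pert_inv y)"] * by (simp add: pert_def)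
  then show "nE (pert_inv y) < r"
    using Q_small[of "pert_inv y" "pert_inv y" r] * y r_pos by simp
qed

lemma pert_inv_lipschitz:
  assumes "y \<in> E" "nE y < r/2" "y' \<in> E" "nE y' < r/2"
  shows "nE (pert_inv y' - pert_inv y) \<le> 2 * nE (y' - y)"
  using pert_expansive[OF pert_inv(1) less_imp_le[OF pert_inv(2)] pert_inv(1) less_imp_le[OF pert_inv(2)],
    OF assms(1,2) assms(1,2) assms(3,4) assms(3,4)] pert_inv(3) assms by simp

text \<open>
  With \<open>d = pert_inv y' - pert_inv y\<close>, expanding \<open>pert\<close> at \<open>pert_inv y\<close> gives
  \<open>y' - y = (1 + 2 Q (pert_inv y)) d + Q d d\<close> exactly. Applying \<open>linv\<close> leaves a remainder
  that is quadratic in \<open>d\<close>, and \<open>d\<close> is controlled by the Lipschitz bound.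
\<close>

lemma pert_inv_remainder:
  assumes "y \<in> E" "nE y < r/2" "y' \<in> E" "nE y' < r/2"
  shows "nE (pert_inv y' - pert_inv y - linv (pert_inv y) (y' - y)) \<le> 8 * C * (nE (y' - y))\<^sup>2"
proof -
  let ?d = "pert_inv y' - pert_inv y"
  have in_E: "pert_inv y \<in> E" "pert_inv y' \<in> E" "nE (pert_inv y) \<le> r"
    using assms pert_inv(1,2) by (auto intro: less_imp_le)
  have "pert_inv y' + pert_inv y = 2 *\<^sub>R pert_inv y + ?d" by (simp add: scaleR_2)
  moreover have "Q (2 *\<^sub>R pert_inv y + ?d) ?d = 2 *\<^sub>R Q (pert_inv y) ?d + Q ?d ?d"
    using in_E by (subst Q_add_left) (auto simp: Q_scale_left)
  moreover have "y' - y = ?d + Q (pert_inv y' + pert_inv y) ?d"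
    using pert_diff[OF in_E(1,2)] pert_inv(3)[OF assms(1,2)] pert_inv(3)[OF assms(3,4)] by simp
  ultimately have "y' - y = (?d + 2 *\<^sub>R Q (pert_inv y) ?d) + Q ?d ?d" by (simp only: add.assoc)
  moreover have "linv (pert_inv y) (?d + 2 *\<^sub>R Q (pert_inv y) ?d) = ?d"
    using in_E by (intro linv_unique) auto
  ultimately have "linv (pert_inv y) (y' - y) = ?d + linv (pert_inv y) (Q ?d ?d)"
    using in_E by (simp add: linv_add)
  then have "nE (?d - linv (pert_inv y) (y' - y)) \<le> 2 * nE (Q ?d ?d)"
    using linv(3)[of "pert_inv y" "Q ?d ?d"] in_E by (simp add: nE_uminus)
  also have "\<dots> \<le> 2 * (C * (2 * nE (y' - y)) * (2 * nE (y' - y)))"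
    using Q_le[of ?d ?d "2 * nE (y' - y)" "2 * nE (y' - y)"] pert_inv_lipschitz[OF assms] in_E by (intro mult_left_mono) auto
  finally show ?thesis by (simp add: power2_eq_square)
qed

end

section \<open>Higher derivatives of the inverse\<close>

text \<open>
  All derivatives of \<open>pert_inv\<close> are built by finitely many operations from the value
  \<open>pert_inv y\<close> (\<open>Base\<close>), the directions of differentiation (\<open>Dir i\<close>), the bilinear map \<open>Q\<close>
  (\<open>Bil\<close>), the operator \<open>linv (pert_inv y)\<close> (\<open>Lin\<close>), sums and signs. Such expressions are
  represented here as syntax. Differentiating them is a syntactic operation, and estimates
  that are uniform in the base point are proved by induction on the expression. The
  smoothness of \<open>pert_inv\<close> follows without a calculus of composite maps between spaces of
  multilinear maps.
\<close>

datatype jet =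
  Zero | Base | Dir nat | Bil jet jet | Lin jet | Plus jet jet | Minus jet

primrec shift :: "jet \<Rightarrow> jet" where
  "shift Zero = Zero"
| "shift Base = Base"
| "shift (Dir i) = Dir (Suc i)"
| "shift (Bil a b) = Bil (shift a) (shift b)"
| "shift (Lin a) = Lin (shift a)"
| "shift (Plus a b) = Plus (shift a) (shift b)"
| "shift (Minus a) = Minus (shift a)"

text \<open>
  The new direction receives index \<open>0\<close>, so that the old ones move up by one, as required
  by the convention that the direction of differentiation is the first argument of the
  derivative.

  \<open>Base\<close> has derivative \<open>linv (pert_inv y)\<close>. For \<open>Lin a\<close>, differentiating
  \<open>w + 2 Q x w = a\<close>, where \<open>x = pert_inv y\<close>, gives \<open>w' = linv x a' - 2 linv x (Q x' w)\<close>.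
  The factor \<open>2\<close> is written as a sum and the difference by means of \<open>Minus\<close>.
\<close>

primrec deriv_jet :: "jet \<Rightarrow> jet" where
  "deriv_jet Zero = Zero"
| "deriv_jet Base = Lin (Dir 0)"
| "deriv_jet (Dir i) = Zero"
| "deriv_jet (Bil a b) = Plus (Bil (deriv_jet a) (shift b)) (Bil (shift a) (deriv_jet b))"
| "deriv_jet (Lin a) = Minus (Plus (Minus (Lin (deriv_jet a)))
     (Plus (Lin (Bil (Lin (Dir 0)) (Lin (shift a)))) (Lin (Bil (Lin (Dir 0)) (Lin (shift a))))))"
| "deriv_jet (Plus a b) = Plus (deriv_jet a) (deriv_jet b)"
| "deriv_jet (Minus a) = Minus (deriv_jet a)"

text \<open>
  Every monomial of the expression contains each direction with index in \<open>S\<close> exactly once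
  and no other direction. \<open>Zero\<close> counts as multilinear in any set.
\<close>

primrec multilinear_in :: "nat set \<Rightarrow> jet \<Rightarrow> bool" where
  "multilinear_in S Zero \<longleftrightarrow> True"
| "multilinear_in S Base \<longleftrightarrow> S = {}"
| "multilinear_in S (Dir i) \<longleftrightarrow> S = {i}"
| "multilinear_in S (Bil a b) \<longleftrightarrow>
     (\<exists>A B. S = A \<union> B \<and> A \<inter> B = {} \<and> multilinear_in A a \<and> multilinear_in B b)"
| "multilinear_in S (Lin a) \<longleftrightarrow> multilinear_in S a"
| "multilinear_in S (Plus a b) \<longleftrightarrow> multilinear_in S a \<and> multilinear_in S b"
| "multilinear_in S (Minus a) \<longleftrightarrow> multilinear_in S a"

lemma multilinear_in_shift: "multilinear_in S t \<Longrightarrow> multilinear_in (Suc ` S) (shift t)"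
proof (induction t arbitrary: S)
  case (Bil a b)
  then obtain A B where "S = A \<union> B" "A \<inter> B = {}" "multilinear_in A a" "multilinear_in B b" by auto
  with Bil.IH show ?case
    unfolding shift.simps multilinear_in.simps
    by (rule_tac exI[where x = "Suc ` A"], rule_tac exI[where x = "Suc ` B"]) auto
qed auto

lemma multilinear_in_deriv:
  "multilinear_in S t \<Longrightarrow> multilinear_in (insert 0 (Suc ` S)) (deriv_jet t)"
proof (induction t arbitrary: S)
  case (Bil a b)
  then obtain A B where AB: "S = A \<union> B" "A \<inter> B = {}" "multilinear_in A a" "multilinear_in B b" by auto
  have "multilinear_in (insert 0 (Suc ` S)) (Bil (deriv_jet a) (shift b))"
    using AB Bil.IH(1)[OF AB(3)] multilinear_in_shift[OF AB(4)]
    unfolding multilinear_in.simps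
    by (rule_tac exI[where x = "insert 0 (Suc ` A)"], rule_tac exI[where x = "Suc ` B"]) auto
  moreover have "multilinear_in (insert 0 (Suc ` S)) (Bil (shift a) (deriv_jet b))"
    using AB Bil.IH(2)[OF AB(4)] multilinear_in_shift[OF AB(3)]
    unfolding multilinear_in.simps
    by (rule_tac exI[where x = "Suc ` A"], rule_tac exI[where x = "insert 0 (Suc ` B)"]) auto
  ultimately show ?case by simp
next
  case (Lin a)
  have "multilinear_in (insert 0 (Suc ` S)) (Bil (Lin (Dir 0)) (Lin (shift a)))"
    using multilinear_in_shift[of S a] Lin.prems
    unfolding multilinear_in.simps
    by (rule_tac exI[where x = "{0}"], rule_tac exI[where x = "Suc ` S"]) auto
  then show ?case using Lin by simp
qed auto

lemma multilinear_in_derivs: "multilinear_in {..<k} ((deriv_jet ^^ k) Base)"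
proof (induction k)
  case (Suc k)
  show ?case using multilinear_in_deriv[OF Suc] by (simp add: lessThan_Suc_eq_insert_0)
qed simp

context quadratic_perturbation
begin

definition halfball :: "'a set" where "halfball = {y \<in> E. nE y < r/2}"

primrec jet_val :: "'a \<Rightarrow> 'a list \<Rightarrow> jet \<Rightarrow> 'a" where
  "jet_val y vs Zero = 0"
| "jet_val y vs Base = pert_inv y"
| "jet_val y vs (Dir i) = vs ! i"
| "jet_val y vs (Bil a b) = Q (jet_val y vs a) (jet_val y vs b)"
| "jet_val y vs (Lin a) = linv (pert_inv y) (jet_val y vs a)"
| "jet_val y vs (Plus a b) = jet_val y vs a + jet_val y vs b"
| "jet_val y vs (Minus a) = - jet_val y vs a"

lemma pert_inv_halfball: "y \<in> halfball \<Longrightarrow> pert_inv y \<in> E" "y \<in> halfball \<Longrightarrow> nE (pert_inv y) \<le> r"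
  using pert_inv(1,2) by (auto simp: halfball_def intro: less_imp_le)

lemma jet_val_shift [simp]: "jet_val y (h # vs) (shift t) = jet_val y vs t"
  by (induction t) auto

lemma jet_val_in:
  "multilinear_in S t \<Longrightarrow> y \<in> halfball \<Longrightarrow> set vs \<subseteq> E \<Longrightarrow> S \<subseteq> {..<length vs} \<Longrightarrow> jet_val y vs t \<in> E"
proof (induction t arbitrary: S)
  case Base then show ?case by (simp add: pert_inv_halfball)
next
  case (Dir i) then show ?case using nth_mem by auto
next
  case (Bil a b) then show ?case by (auto intro!: Q_in) 
next
  case (Lin a) then show ?case using linv(1) pert_inv_halfball by simp
qed auto

lemma jet_val_update_other:
  "multilinear_in S t \<Longrightarrow> i \<notin> S \<Longrightarrow> jet_val y (vs[i := v]) t = jet_val y vs t"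
proof (induction t arbitrary: S)
  case (Bil a b) then show ?case by (metis UnI1 UnI2 jet_val.simps(4) multilinear_in.simps(4))
qed auto

lemma jet_val_linear:
  assumes "multilinear_in S t" "i \<in> S" "y \<in> halfball" "set vs \<subseteq> E" "S \<subseteq> {..<length vs}" "v \<in> E" "w \<in> E"
  shows "jet_val y (vs[i := c *\<^sub>R v + w]) t = c *\<^sub>R jet_val y (vs[i := v]) t + jet_val y (vs[i := w]) t"
  using assms
proof (induction t arbitrary: S)
  case (Bil a b)
  then obtain A B where AB: "S = A \<union> B" "A \<inter> B = {}" "multilinear_in A a" "multilinear_in B b" by auto
  have up: "set (vs[i := z]) \<subseteq> E" if "z \<in> E" for z
    using that Bil.prems(4) set_update_subset_insert[of vs i z] by auto
  have E: "jet_val y (vs[i := z]) a \<in> E" "jet_val y (vs[i := z]) b \<in> E" if "z \<in> E" for z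
    using jet_val_in[OF AB(3), of y "vs[i := z]"] jet_val_in[OF AB(4), of y "vs[i := z]"] AB(1) Bil.prems(3,5) up[OF that]
    by auto
  show ?case
  proof (cases "i \<in> A")
    case True
    then have "i \<notin> B" using AB by auto
    then have "jet_val y (vs[i := z]) b = jet_val y vs b" for z using jet_val_update_other[OF AB(4)] by simp
    moreover have "jet_val y (vs[i := c *\<^sub>R v + w]) a = c *\<^sub>R jet_val y (vs[i := v]) a + jet_val y (vs[i := w]) a"
      using AB True Bil by (intro Bil.IH(1)[of A]) auto
    ultimately show ?thesis
      using E[of v] E[of w] Bil.prems by (simp add: Q_add_left Q_scale_left)
  next
    case False
    then have "jet_val y (vs[i := z]) a = jet_val y vs a" for z using jet_val_update_other[OF AB(3)] by simp
    moreover have "jet_val y (vs[i := c *\<^sub>R v + w]) b = c *\<^sub>R jet_val y (vs[i := v]) b + jet_val y (vs[i := w]) b"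
      using AB False Bil by (intro Bil.IH(2)[of B]) auto
    ultimately show ?thesis
      using E[of v] E[of w] Bil.prems by (simp add: Q_add_right Q_scale_right)
  qed
next
  case (Lin a)
  have "set (vs[i := z]) \<subseteq> E" if "z \<in> E" for z
    using that Lin.prems(4) set_update_subset_insert[of vs i z] by auto
  then have "jet_val y (vs[i := z]) a \<in> E" if "z \<in> E" for z
    using Lin.prems that by (intro jet_val_in[of S]) auto
  moreover have "jet_val y (vs[i := c *\<^sub>R v + w]) a = c *\<^sub>R jet_val y (vs[i := v]) a + jet_val y (vs[i := w]) a"
    using Lin by simp
  ultimately show ?case
    using Lin.prems pert_inv_halfball[OF Lin.prems(3)] by (simp add: linv_add linv_scale)
qed (auto simp: scaleR_right_distrib)

definition size_on :: "nat set \<Rightarrow> 'a list \<Rightarrow> real" where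
  "size_on S vs = (\<Prod>i\<in>S. nE (vs ! i))"

lemma size_on_nonneg [simp]: "0 \<le> size_on S vs"
  by (simp add: size_on_def prod_nonneg)

lemma size_on_Un: "finite A \<Longrightarrow> finite B \<Longrightarrow> A \<inter> B = {} \<Longrightarrow> size_on (A \<union> B) vs = size_on A vs * size_on B vs"
  by (simp add: size_on_def prod.union_disjoint)

lemma size_on_Cons: "finite S \<Longrightarrow> size_on (insert 0 (Suc ` S)) (h # vs) = nE h * size_on S vs"
  by (simp add: size_on_def prod.reindex)

lemma jet_val_bound:
  assumes "multilinear_in S t" "finite S"
  shows "\<exists>K\<ge>0. \<forall>y\<in>halfball. \<forall>vs. set vs \<subseteq> E \<and> S \<subseteq> {..<length vs} \<longrightarrow> nE (jet_val y vs t) \<le> K * size_on S vs"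
  using assms
proof (induction t arbitrary: S)
  case Zero then show ?case by (intro exI[of _ 0]) simp
next
  case Base then show ?case using pert_inv_halfball r_pos by (intro exI[of _ r]) (auto simp: size_on_def)
next
  case (Dir i) then show ?case by (intro exI[of _ 1]) (auto simp: size_on_def)
next
  case (Bil a b)
  then obtain A B where AB: "S = A \<union> B" "A \<inter> B = {}" "multilinear_in A a" "multilinear_in B b" by auto
  then have fin: "finite A" "finite B" using Bil.prems by auto
  obtain K where K: "K \<ge> 0" "\<And>y vs. y \<in> halfball \<Longrightarrow> set vs \<subseteq> E \<Longrightarrow> A \<subseteq> {..<length vs} \<Longrightarrow> nE (jet_val y vs a) \<le> K * size_on A vs"
    using Bil.IH(1)[OF AB(3) fin(1)] by blast
  obtain L where L: "L \<ge> 0" "\<And>y vs. y \<in> halfball \<Longrightarrow> set vs \<subseteq> E \<Longrightarrow> B \<subseteq> {..<length vs} \<Longrightarrow> nE (jet_val y vs b) \<le> L * size_on B vs"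
    using Bil.IH(2)[OF AB(4) fin(2)] by blast
  show ?case
  proof (intro exI[of _ "C * K * L"] conjI ballI allI impI)
    fix y vs assume y: "y \<in> halfball" and vs: "set vs \<subseteq> E \<and> S \<subseteq> {..<length vs}"
    have "nE (Q (jet_val y vs a) (jet_val y vs b)) \<le> C * (K * size_on A vs) * (L * size_on B vs)"
      using y vs AB by (intro Q_le jet_val_in[OF AB(3)] jet_val_in[OF AB(4)] K L) auto
    then show "nE (jet_val y vs (Bil a b)) \<le> C * K * L * size_on S vs"
      using AB fin by (simp add: size_on_Un mult_ac)
  qed (use K L C_nonneg in simp)
next
  case (Lin a)
  obtain K where K: "K \<ge> 0" "\<And>y vs. y \<in> halfball \<Longrightarrow> set vs \<subseteq> E \<Longrightarrow> S \<subseteq> {..<length vs} \<Longrightarrow> nE (jet_val y vs a) \<le> K * size_on S vs"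
    using Lin.IH[of S] Lin.prems by auto
  show ?case
  proof (intro exI[of _ "2 * K"] conjI ballI allI impI)
    fix y vs assume y: "y \<in> halfball" and vs: "set vs \<subseteq> E \<and> S \<subseteq> {..<length vs}"
    then have "nE (linv (pert_inv y) (jet_val y vs a)) \<le> 2 * nE (jet_val y vs a)"
      using Lin.prems pert_inv_halfball[OF y] by (intro linv(3) jet_val_in[of S]) auto
    then show "nE (jet_val y vs (Lin a)) \<le> 2 * K * size_on S vs" using K(2)[OF y] vs by force
  qed (use K in simp)
next
  case (Plus a b)
  obtain K where K: "K \<ge> 0" "\<And>y vs. y \<in> halfball \<Longrightarrow> set vs \<subseteq> E \<Longrightarrow> S \<subseteq> {..<length vs} \<Longrightarrow> nE (jet_val y vs a) \<le> K * size_on S vs"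
    using Plus.IH(1)[of S] Plus.prems by auto
  obtain L where L: "L \<ge> 0" "\<And>y vs. y \<in> halfball \<Longrightarrow> set vs \<subseteq> E \<Longrightarrow> S \<subseteq> {..<length vs} \<Longrightarrow> nE (jet_val y vs b) \<le> L * size_on S vs"
    using Plus.IH(2)[of S] Plus.prems by auto
  show ?case
  proof (intro exI[of _ "K + L"] conjI ballI allI impI)
    fix y vs assume y: "y \<in> halfball" and vs: "set vs \<subseteq> E \<and> S \<subseteq> {..<length vs}"
    then have "nE (jet_val y vs a + jet_val y vs b) \<le> nE (jet_val y vs a) + nE (jet_val y vs b)"
      using Plus.prems by (intro nE_triangle jet_val_in[of S]) auto
    then show "nE (jet_val y vs (Plus a b)) \<le> (K + L) * size_on S vs"
      using K(2)[OF y, of vs] L(2)[OF y, of vs] vs by (simp add: algebra_simps)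
  qed (use K L in simp)
next
  case (Minus a) then show ?case by (simp add: nE_uminus)
qed

lemma insert_Suc_subset: "S \<subseteq> {..<length vs} \<Longrightarrow> insert 0 (Suc ` S) \<subseteq> {..<length (h # vs)}"
  by auto

text \<open>
  A second order Taylor estimate gives a Lipschitz estimate on the bounded domain
  \<open>halfball\<close>, since the derivative is again a multilinear expression and therefore
  bounded. It is stated for one expression, with the Taylor estimate as a hypothesis,
  because the induction that proves the Taylor estimate applies it to subexpressions.
\<close>

lemma jet_val_lipschitz_of_remainder:
  assumes t: "multilinear_in S t" "finite S" and "0 \<le> R"
    and R: "\<And>y y' vs. y \<in> halfball \<Longrightarrow> y' \<in> halfball \<Longrightarrow> set vs \<subseteq> E \<Longrightarrow> S \<subseteq> {..<length vs} \<Longrightarrow>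
      nE (jet_val y' vs t - jet_val y vs t - jet_val y ((y' - y) # vs) (deriv_jet t)) \<le> R * (nE (y' - y))\<^sup>2 * size_on S vs"
  shows "\<exists>L\<ge>0. \<forall>y\<in>halfball. \<forall>y'\<in>halfball. \<forall>vs. set vs \<subseteq> E \<and> S \<subseteq> {..<length vs} \<longrightarrow>
      nE (jet_val y' vs t - jet_val y vs t) \<le> L * nE (y' - y) * size_on S vs"
proof -
  obtain K where K: "K \<ge> 0" "\<And>y vs. y \<in> halfball \<Longrightarrow> set vs \<subseteq> E \<Longrightarrow> insert 0 (Suc ` S) \<subseteq> {..<length vs} \<Longrightarrow>
      nE (jet_val y vs (deriv_jet t)) \<le> K * size_on (insert 0 (Suc ` S)) vs"
    using jet_val_bound[OF multilinear_in_deriv[OF t(1)]] t(2) by auto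
  show ?thesis
  proof (intro exI[of _ "R * r + K"] conjI ballI allI impI)
    fix y y' vs assume y: "y \<in> halfball" "y' \<in> halfball" and "set vs \<subseteq> E \<and> S \<subseteq> {..<length vs}"
    then have vs: "set vs \<subseteq> E" "S \<subseteq> {..<length vs}" by auto
    have yE: "y \<in> E" "y' \<in> E" "nE (y' - y) \<le> r"
      using y nE_diff_le[of y' y] by (auto simp: halfball_def)
    let ?p = "size_on S vs" and ?h = "nE (y' - y)"
    have vs': "set ((y' - y) # vs) \<subseteq> E" using yE vs by auto
    let ?D = "jet_val y ((y' - y) # vs) (deriv_jet t)"
    have in_E: "jet_val y' vs t \<in> E" "jet_val y vs t \<in> E" "?D \<in> E"
      using jet_val_in[OF t(1) _ vs] jet_val_in[OF multilinear_in_deriv[OF t(1)] y(1) vs' insert_Suc_subset[OF vs(2)]] y by auto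
    have "nE (jet_val y' vs t - jet_val y vs t) \<le> nE (jet_val y' vs t - jet_val y vs t - ?D) + nE ?D"
      using nE_triangle[of "jet_val y' vs t - jet_val y vs t - ?D" ?D] in_E by simp
    also have "nE ?D \<le> K * (?h * ?p)"
      using K(2)[OF y(1) vs' insert_Suc_subset[OF vs(2)]] t(2) by (simp add: size_on_Cons)
    also have "nE (jet_val y' vs t - jet_val y vs t - ?D) \<le> R * ?h\<^sup>2 * ?p" by (rule R[OF y vs])
    also have "R * ?h\<^sup>2 * ?p \<le> R * (?h * r) * ?p"
      using yE \<open>0 \<le> R\<close> by (intro mult_right_mono mult_left_mono) (auto simp: power2_eq_square intro: mult_left_mono)
    finally show "nE (jet_val y' vs t - jet_val y vs t) \<le> (R * r + K) * ?h * ?p"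
      by (simp add: algebra_simps)
  qed (use K r_pos \<open>0 \<le> R\<close> in simp)
qed

text \<open>
  A remainder that is quadratic in \<open>y' - y\<close>, uniformly in the base point and in the
  directions, is more than differentiability requires, but it is the form that is stable
  under the operations: in the product and in the operator \<open>linv\<close>, every error term is
  either a remainder times a bounded factor or a product of two Lipschitz differences.
\<close>

lemma jet_val_remainder:
  assumes "multilinear_in S t" "finite S"
  shows "\<exists>R\<ge>0. \<forall>y\<in>halfball. \<forall>y'\<in>halfball. \<forall>vs. set vs \<subseteq> E \<and> S \<subseteq> {..<length vs} \<longrightarrow>
    nE (jet_val y' vs t - jet_val y vs t - jet_val y ((y' - y) # vs) (deriv_jet t)) \<le> R * (nE (y' - y))\<^sup>2 * size_on S vs"
  using assms
proof (induction t arbitrary: S)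
  case Zero then show ?case by (intro exI[of _ 0]) simp
next
  case Base
  show ?case
  proof (intro exI[of _ "8 * C"] conjI ballI allI impI)
    fix y y' vs assume "y \<in> halfball" "y' \<in> halfball"
    then show "nE (jet_val y' vs Base - jet_val y vs Base - jet_val y ((y' - y) # vs) (deriv_jet Base))
        \<le> 8 * C * (nE (y' - y))\<^sup>2 * size_on S vs"
      using pert_inv_remainder[of y y'] Base by (simp add: halfball_def size_on_def)
  qed (use C_nonneg in simp)
next
  case (Dir i) then show ?case by (intro exI[of _ 0]) simp
next
  case (Bil a b)
  then obtain A B where AB: "S = A \<union> B" "A \<inter> B = {}" "multilinear_in A a" "multilinear_in B b" by auto
  then have fin: "finite A" "finite B" using Bil.prems by auto
  obtain Ra where Ra: "Ra \<ge> 0" "\<And>y y' vs. y \<in> halfball \<Longrightarrow> y' \<in> halfball \<Longrightarrow> set vs \<subseteq> E \<Longrightarrow> A \<subseteq> {..<length vs} \<Longrightarrow>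
      nE (jet_val y' vs a - jet_val y vs a - jet_val y ((y' - y) # vs) (deriv_jet a)) \<le> Ra * (nE (y' - y))\<^sup>2 * size_on A vs"
    using Bil.IH(1)[OF AB(3) fin(1)] by auto
  obtain Rb where Rb: "Rb \<ge> 0" "\<And>y y' vs. y \<in> halfball \<Longrightarrow> y' \<in> halfball \<Longrightarrow> set vs \<subseteq> E \<Longrightarrow> B \<subseteq> {..<length vs} \<Longrightarrow>
      nE (jet_val y' vs b - jet_val y vs b - jet_val y ((y' - y) # vs) (deriv_jet b)) \<le> Rb * (nE (y' - y))\<^sup>2 * size_on B vs"
    using Bil.IH(2)[OF AB(4) fin(2)] by auto
  obtain Ka where Ka: "Ka \<ge> 0" "\<And>y vs. y \<in> halfball \<Longrightarrow> set vs \<subseteq> E \<Longrightarrow> A \<subseteq> {..<length vs} \<Longrightarrow> nE (jet_val y vs a) \<le> Ka * size_on A vs"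
    using jet_val_bound[OF AB(3) fin(1)] by auto
  obtain Kb where Kb: "Kb \<ge> 0" "\<And>y vs. y \<in> halfball \<Longrightarrow> set vs \<subseteq> E \<Longrightarrow> B \<subseteq> {..<length vs} \<Longrightarrow> nE (jet_val y vs b) \<le> Kb * size_on B vs"
    using jet_val_bound[OF AB(4) fin(2)] by auto
  obtain Lb where Lb: "Lb \<ge> 0" "\<And>y y' vs. y \<in> halfball \<Longrightarrow> y' \<in> halfball \<Longrightarrow> set vs \<subseteq> E \<Longrightarrow> B \<subseteq> {..<length vs} \<Longrightarrow>
      nE (jet_val y' vs b - jet_val y vs b) \<le> Lb * nE (y' - y) * size_on B vs"
    using jet_val_lipschitz_of_remainder[OF AB(4) fin(2) Rb] by auto
  obtain Da where Da: "Da \<ge> 0" "\<And>y vs. y \<in> halfball \<Longrightarrow> set vs \<subseteq> E \<Longrightarrow> insert 0 (Suc ` A) \<subseteq> {..<length vs} \<Longrightarrow>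
      nE (jet_val y vs (deriv_jet a)) \<le> Da * size_on (insert 0 (Suc ` A)) vs"
    using jet_val_bound[OF multilinear_in_deriv[OF AB(3)]] fin(1) by auto
  show ?case
  proof (intro exI[of _ "C * Ra * Kb + C * Ka * Rb + C * Da * Lb"] conjI ballI allI impI)
    fix y y' vs assume y: "y \<in> halfball" "y' \<in> halfball" and "set vs \<subseteq> E \<and> S \<subseteq> {..<length vs}"
    then have vs: "set vs \<subseteq> E" "A \<subseteq> {..<length vs}" "B \<subseteq> {..<length vs}" using AB by auto
    have yE: "y \<in> E" "y' \<in> E" using y by (auto simp: halfball_def)
    have vs': "set ((y' - y) # vs) \<subseteq> E" using yE vs by auto
    let ?h = "nE (y' - y)" and ?pa = "size_on A vs" and ?pb = "size_on B vs"
    define a0 a1 da b0 b1 db where d: "a0 = jet_val y vs a" "a1 = jet_val y' vs a" "da = jet_val y ((y' - y) # vs) (deriv_jet a)"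
      "b0 = jet_val y vs b" "b1 = jet_val y' vs b" "db = jet_val y ((y' - y) # vs) (deriv_jet b)"
    have in_E: "a0 \<in> E" "a1 \<in> E" "da \<in> E" "b0 \<in> E" "b1 \<in> E" "db \<in> E"
      unfolding d using y vs vs' insert_Suc_subset
      by (auto intro!: jet_val_in[OF AB(3)] jet_val_in[OF AB(4)] jet_val_in[OF multilinear_in_deriv[OF AB(3)]] jet_val_in[OF multilinear_in_deriv[OF AB(4)]] simp del: length_Cons)
    have bnds: "nE (a1 - a0 - da) \<le> Ra * ?h\<^sup>2 * ?pa" "nE (b1 - b0 - db) \<le> Rb * ?h\<^sup>2 * ?pb"
      "nE b1 \<le> Kb * ?pb" "nE a0 \<le> Ka * ?pa" "nE (b1 - b0) \<le> Lb * ?h * ?pb" "nE da \<le> Da * (?h * ?pa)"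
      unfolding d using Ra(2)[OF y vs(1,2)] Rb(2)[OF y vs(1,3)] Kb(2)[OF y(2) vs(1,3)] Ka(2)[OF y(1) vs(1,2)]
        Lb(2)[OF y vs(1,3)] Da(2)[OF y(1) vs' insert_Suc_subset[OF vs(2)]] fin
      by (simp_all add: size_on_Cons)
    have "jet_val y' vs (Bil a b) - jet_val y vs (Bil a b) - jet_val y ((y' - y) # vs) (deriv_jet (Bil a b))
        = Q (a1 - a0 - da) b1 + Q a0 (b1 - b0 - db) + Q da (b1 - b0)"
      using in_E by (simp add: d[symmetric] Q_diff_left Q_diff_right)
    also have "nE \<dots> \<le> nE (Q (a1 - a0 - da) b1) + nE (Q a0 (b1 - b0 - db)) + nE (Q da (b1 - b0))"
      using in_E by (intro order_trans[OF nE_triangle] add_mono nE_triangle) auto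
    also have "\<dots> \<le> C * (Ra * ?h\<^sup>2 * ?pa) * (Kb * ?pb) + C * (Ka * ?pa) * (Rb * ?h\<^sup>2 * ?pb)
        + C * (Da * (?h * ?pa)) * (Lb * ?h * ?pb)"
      using in_E bnds by (intro add_mono Q_le) auto
    also have "\<dots> = (C * Ra * Kb + C * Ka * Rb + C * Da * Lb) * ?h\<^sup>2 * size_on S vs"
      using AB fin by (simp add: size_on_Un algebra_simps power2_eq_square)
    finally show "nE (jet_val y' vs (Bil a b) - jet_val y vs (Bil a b) - jet_val y ((y' - y) # vs) (deriv_jet (Bil a b)))
        \<le> (C * Ra * Kb + C * Ka * Rb + C * Da * Lb) * ?h\<^sup>2 * size_on S vs" .
  qed (use Ra Rb Ka Kb Lb Da C_nonneg in simp)
next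
  case (Lin a)
  then have a: "multilinear_in S a" "finite S" by auto
  obtain Ra where Ra: "Ra \<ge> 0" "\<And>y y' vs. y \<in> halfball \<Longrightarrow> y' \<in> halfball \<Longrightarrow> set vs \<subseteq> E \<Longrightarrow> S \<subseteq> {..<length vs} \<Longrightarrow>
      nE (jet_val y' vs a - jet_val y vs a - jet_val y ((y' - y) # vs) (deriv_jet a)) \<le> Ra * (nE (y' - y))\<^sup>2 * size_on S vs"
    using Lin.IH[OF a] by auto
  obtain Ka where Ka: "Ka \<ge> 0" "\<And>y vs. y \<in> halfball \<Longrightarrow> set vs \<subseteq> E \<Longrightarrow> S \<subseteq> {..<length vs} \<Longrightarrow> nE (jet_val y vs a) \<le> Ka * size_on S vs"
    using jet_val_bound[OF a] by auto
  obtain La where La: "La \<ge> 0" "\<And>y y' vs. y \<in> halfball \<Longrightarrow> y' \<in> halfball \<Longrightarrow> set vs \<subseteq> E \<Longrightarrow> S \<subseteq> {..<length vs} \<Longrightarrow>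
      nE (jet_val y' vs a - jet_val y vs a) \<le> La * nE (y' - y) * size_on S vs"
    using jet_val_lipschitz_of_remainder[OF a Ra] by auto
  \<comment> \<open>Lipschitz constant of the expression \<open>Lin a\<close>, from
    \<open>w' - w = linv x (a1 - a0) - 2 linv x (Q (x' - x) w')\<close>.\<close>
  define M where "M = 2 * La + 16 * C * Ka"
  show ?case
  proof (intro exI[of _ "2 * Ra + 4 * (C * (8 * C) * (2 * Ka) + C * 2 * M)"] conjI ballI allI impI)
    fix y y' vs assume y: "y \<in> halfball" "y' \<in> halfball" and "set vs \<subseteq> E \<and> S \<subseteq> {..<length vs}"
    then have vs: "set vs \<subseteq> E" "S \<subseteq> {..<length vs}" by auto
    have yE: "y \<in> E" "y' \<in> E" "nE y < r/2" "nE y' < r/2" using y by (auto simp: halfball_def)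
    have vs': "set ((y' - y) # vs) \<subseteq> E" using yE vs by auto
    let ?h = "nE (y' - y)" and ?p = "size_on S vs"
    define x x' dx where x: "x = pert_inv y" "x' = pert_inv y'" "dx = linv (pert_inv y) (y' - y)"
    define a0 a1 da where d: "a0 = jet_val y vs a" "a1 = jet_val y' vs a" "da = jet_val y ((y' - y) # vs) (deriv_jet a)"
    define w w' where w: "w = linv x a0" "w' = linv x' a1"
    have xb: "x \<in> E" "nE x \<le> r" "x' \<in> E" "nE x' \<le> r" using pert_inv_halfball y by (auto simp: x)
    have in_E: "a0 \<in> E" "a1 \<in> E" "da \<in> E"
      unfolding d using y vs vs' insert_Suc_subset[OF vs(2)]
      by (auto intro!: jet_val_in[OF a(1)] jet_val_in[OF multilinear_in_deriv[OF a(1)]] simp del: length_Cons)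
    have dxE: "dx \<in> E" using linv(1) xb yE by (simp add: x)
    have wE: "w \<in> E" "w' \<in> E" using linv(1) xb in_E by (auto simp: w)
    have ba: "nE a1 \<le> Ka * ?p" "nE (a1 - a0) \<le> La * ?h * ?p" "nE (a1 - a0 - da) \<le> Ra * ?h\<^sup>2 * ?p"
      unfolding d using Ka(2)[OF y(2) vs] La(2)[OF y vs] Ra(2)[OF y vs] by auto
    have bx: "nE (x' - x) \<le> 2 * ?h" "nE (x' - x - dx) \<le> 8 * C * ?h\<^sup>2" "nE dx \<le> 2 * ?h"
      using pert_inv_lipschitz[OF yE(1,3,2,4)] pert_inv_remainder[OF yE(1,3,2,4)] linv(3)[of x "y' - y"] xb yE
      by (auto simp: x)
    have bw': "nE w' \<le> 2 * Ka * ?p" using linv(3)[OF xb(3,4) in_E(2)] ba(1) by (simp add: w)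
    have w'_eq: "w' = linv x a1 - 2 *\<^sub>R linv x (Q (x' - x) w')"
      using linv_change_base[OF xb in_E(2)] by (simp add: w)
    have QE: "Q (x' - x) w' \<in> E" "Q dx w \<in> E" using xb wE dxE by auto
    have "w' - w = linv x (a1 - a0) - 2 *\<^sub>R linv x (Q (x' - x) w')"
      by (subst w'_eq) (use xb in_E in \<open>simp add: w linv_diff\<close>)
    also have "nE \<dots> \<le> nE (linv x (a1 - a0)) + nE (2 *\<^sub>R linv x (Q (x' - x) w'))"
      using xb in_E QE linv(1) by (intro nE_diff_le) auto
    also have "\<dots> \<le> 2 * nE (a1 - a0) + 2 * (2 * nE (Q (x' - x) w'))"
      using linv(3)[OF xb(1,2), of "a1 - a0"] linv(3)[OF xb(1,2) QE(1)] linv(1)[OF xb(1,2) QE(1)] in_E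
      by (simp add: nE_scale)
    also have "nE (Q (x' - x) w') \<le> C * (2 * ?h) * (2 * Ka * ?p)"
      using xb wE bx(1) bw' by (intro Q_le) auto
    finally have bww: "nE (w' - w) \<le> M * ?h * ?p"
      using ba(2) by (simp add: M_def algebra_simps)
    \<comment> \<open>The exact increment contains \<open>Q (x' - x) w'\<close>, the formal derivative \<open>Q dx w\<close>. They
      differ by the Taylor remainder of \<open>x\<close> and by a product of two small factors.\<close>
    have "linv x (Q (x' - x) w') - linv x (Q dx w) = linv x (Q (x' - x) w' - Q dx w)"
      using xb QE by (simp add: linv_diff)
    also have "Q (x' - x) w' - Q dx w = Q (x' - x - dx) w' + Q dx (w' - w)"
      using xb wE dxE by (simp add: Q_diff_left Q_diff_right)
    finally have Q_eq: "linv x (Q (x' - x) w') - linv x (Q dx w) = linv x (Q (x' - x - dx) w' + Q dx (w' - w))" .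
    have linvE: "linv x z \<in> E" if "z \<in> E" for z using linv(1)[OF xb(1,2) that] .
    have l1: "nE (linv x (a1 - a0 - da)) \<le> 2 * nE (a1 - a0 - da)"
      using xb in_E by (intro linv(3)) auto
    have "nE (linv x (Q (x' - x - dx) w' + Q dx (w' - w))) \<le> 2 * nE (Q (x' - x - dx) w' + Q dx (w' - w))"
      using xb wE dxE by (intro linv(3)) auto
    also have "\<dots> \<le> 2 * (nE (Q (x' - x - dx) w') + nE (Q dx (w' - w)))"
      using xb wE dxE by (intro mult_left_mono nE_triangle) auto
    finally have l2: "nE (2 *\<^sub>R linv x (Q (x' - x - dx) w' + Q dx (w' - w)))
        \<le> 2 * (2 * (nE (Q (x' - x - dx) w') + nE (Q dx (w' - w))))"
      using xb wE dxE linvE by (simp add: nE_scale)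
    have "jet_val y' vs (Lin a) - jet_val y vs (Lin a) - jet_val y ((y' - y) # vs) (deriv_jet (Lin a))
        = w' - w - (linv x da - 2 *\<^sub>R linv x (Q dx w))"
      by (simp add: w x d scaleR_2)
    also have "\<dots> = linv x (a1 - a0 - da) - 2 *\<^sub>R (linv x (Q (x' - x) w') - linv x (Q dx w))"
      by (subst w'_eq) (use xb in_E in \<open>simp add: w linv_diff linv_add algebra_simps\<close>)
    also have "\<dots> = linv x (a1 - a0 - da) - 2 *\<^sub>R linv x (Q (x' - x - dx) w' + Q dx (w' - w))"
      by (simp only: Q_eq)
    also have "nE \<dots> \<le> nE (linv x (a1 - a0 - da)) + nE (2 *\<^sub>R linv x (Q (x' - x - dx) w' + Q dx (w' - w)))"
      using xb in_E wE dxE linvE by (intro nE_diff_le) auto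
    also have "\<dots> \<le> 2 * nE (a1 - a0 - da) + 2 * (2 * (nE (Q (x' - x - dx) w') + nE (Q dx (w' - w))))"
      using l1 l2 by (rule add_mono)
    also have "\<dots> \<le> 2 * (Ra * ?h\<^sup>2 * ?p) + 2 * (2 * (C * (8 * C * ?h\<^sup>2) * (2 * Ka * ?p) + C * (2 * ?h) * (M * ?h * ?p)))"
      using xb wE dxE by (intro add_mono mult_left_mono ba bx bw' bww Q_le) auto
    also have "\<dots> = (2 * Ra + 4 * (C * (8 * C) * (2 * Ka) + C * 2 * M)) * ?h\<^sup>2 * ?p"
      by (simp add: algebra_simps power2_eq_square)
    finally show "nE (jet_val y' vs (Lin a) - jet_val y vs (Lin a) - jet_val y ((y' - y) # vs) (deriv_jet (Lin a)))
        \<le> (2 * Ra + 4 * (C * (8 * C) * (2 * Ka) + C * 2 * M)) * ?h\<^sup>2 * ?p" .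
  qed (use Ra Ka La C_nonneg in \<open>simp add: M_def\<close>)
next
  case (Plus a b)
  then have ab: "multilinear_in S a" "multilinear_in S b" "finite S" by auto
  obtain Ra where Ra: "Ra \<ge> 0" "\<And>y y' vs. y \<in> halfball \<Longrightarrow> y' \<in> halfball \<Longrightarrow> set vs \<subseteq> E \<Longrightarrow> S \<subseteq> {..<length vs} \<Longrightarrow>
      nE (jet_val y' vs a - jet_val y vs a - jet_val y ((y' - y) # vs) (deriv_jet a)) \<le> Ra * (nE (y' - y))\<^sup>2 * size_on S vs"
    using Plus.IH(1)[OF ab(1,3)] by auto
  obtain Rb where Rb: "Rb \<ge> 0" "\<And>y y' vs. y \<in> halfball \<Longrightarrow> y' \<in> halfball \<Longrightarrow> set vs \<subseteq> E \<Longrightarrow> S \<subseteq> {..<length vs} \<Longrightarrow>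
      nE (jet_val y' vs b - jet_val y vs b - jet_val y ((y' - y) # vs) (deriv_jet b)) \<le> Rb * (nE (y' - y))\<^sup>2 * size_on S vs"
    using Plus.IH(2)[OF ab(2,3)] by auto
  show ?case
  proof (intro exI[of _ "Ra + Rb"] conjI ballI allI impI)
    fix y y' vs assume y: "y \<in> halfball" "y' \<in> halfball" and "set vs \<subseteq> E \<and> S \<subseteq> {..<length vs}"
    then have vs: "set vs \<subseteq> E" "S \<subseteq> {..<length vs}" by auto
    have vs': "set ((y' - y) # vs) \<subseteq> E" using y vs by (auto simp: halfball_def)
    let ?a = "jet_val y' vs a - jet_val y vs a - jet_val y ((y' - y) # vs) (deriv_jet a)"
    let ?b = "jet_val y' vs b - jet_val y vs b - jet_val y ((y' - y) # vs) (deriv_jet b)"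
    have "?a \<in> E"
      by (intro E_diff jet_val_in[OF ab(1) _ vs] jet_val_in[OF multilinear_in_deriv[OF ab(1)] _ vs' insert_Suc_subset[OF vs(2)]] y)
    moreover have "?b \<in> E"
      by (intro E_diff jet_val_in[OF ab(2) _ vs] jet_val_in[OF multilinear_in_deriv[OF ab(2)] _ vs' insert_Suc_subset[OF vs(2)]] y)
    moreover have "jet_val y' vs (Plus a b) - jet_val y vs (Plus a b) - jet_val y ((y' - y) # vs) (deriv_jet (Plus a b)) = ?a + ?b"
      by simp
    ultimately have "nE (jet_val y' vs (Plus a b) - jet_val y vs (Plus a b) - jet_val y ((y' - y) # vs) (deriv_jet (Plus a b)))
        \<le> nE ?a + nE ?b"
      using nE_triangle[of ?a ?b] by (simp only:)
    then show "nE (jet_val y' vs (Plus a b) - jet_val y vs (Plus a b) - jet_val y ((y' - y) # vs) (deriv_jet (Plus a b)))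
        \<le> (Ra + Rb) * (nE (y' - y))\<^sup>2 * size_on S vs"
      using Ra(2)[OF y vs] Rb(2)[OF y vs] unfolding distrib_right by linarith
  qed (use Ra Rb in simp)
next
  case (Minus a)
  have eq: "jet_val y' vs (Minus a) - jet_val y vs (Minus a) - jet_val y ((y' - y) # vs) (deriv_jet (Minus a))
      = - (jet_val y' vs a - jet_val y vs a - jet_val y ((y' - y) # vs) (deriv_jet a))" for y y' vs
    by simp
  show ?case using Minus unfolding eq nE_uminus by simp
qed

section \<open>The chart of a quadratic constraint\<close>

definition chart :: "'a \<Rightarrow> 'a \<Rightarrow> 'a" where "chart x0 x = pert (x - x0)"

text \<open>
  The last condition cuts the ball down to the preimage of \<open>halfball\<close>, so that the chart
  maps it exactly onto \<open>halfball\<close>.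
\<close>

definition chart_dom :: "'a \<Rightarrow> 'a set" where
  "chart_dom x0 = {x \<in> E. nE (x - x0) < r \<and> chart x0 x \<in> halfball}"

lemma size_on_lessThan: "size_on {..<length vs} vs = prod_list (map nE vs)"
proof -
  have "prod_list (map nE vs) = (\<Prod>i<length vs. nE (vs ! i))"
    by (induction vs) (simp_all add: prod.lessThan_Suc_shift del: prod.lessThan_Suc)
  then show ?thesis by (simp add: size_on_def)
qed

lemma prod_nE_nonneg [simp]: "0 \<le> prod_list (map nE vs)"
  by (induction vs) auto

lemma openin_halfball: "openin (norm_topology E nE) halfball"
  unfolding openin_norm_topology
proof (intro conjI ballI)
  fix x assume x: "x \<in> halfball"
  show "\<exists>e>0. \<forall>y\<in>E. nE (y - x) < e \<longrightarrow> y \<in> halfball"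
  proof (intro exI[of _ "r/2 - nE x"] conjI ballI impI)
    fix y assume "y \<in> E" "nE (y - x) < r/2 - nE x"
    then show "y \<in> halfball"
      using nE_triangle[of "y - x" x] x by (simp add: halfball_def)
  qed (use x in \<open>simp add: halfball_def\<close>)
qed (auto simp: halfball_def)

lemma pert_lipschitz:
  assumes "h \<in> E" "nE h \<le> r" "h' \<in> E" "nE h' \<le> r"
  shows "nE (pert h' - pert h) \<le> 2 * nE (h' - h)"
proof -
  have "nE (pert h' - pert h) \<le> nE (h' - h) + nE (Q h' (h' - h) + Q h (h' - h))"
    using pert_diff[of h h'] nE_triangle[of "h' - h" "Q h' (h' - h) + Q h (h' - h)"] assms
    by (simp add: Q_add_left)
  also have "nE (Q h' (h' - h) + Q h (h' - h)) \<le> 1/2 * nE (h' - h)"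
    using nE_triangle[of "Q h' (h' - h)" "Q h (h' - h)"] Q_small[of h' "h' - h" "nE (h' - h)"]
      Q_small[of h "h' - h" "nE (h' - h)"] assms by simp
  finally show ?thesis using nE_nonneg[of "h' - h"] by linarith
qed

lemma openin_chart_dom:
  assumes "x0 \<in> E"
  shows "openin (norm_topology E nE) (chart_dom x0)"
  unfolding openin_norm_topology
proof (intro conjI ballI)
  fix x assume x: "x \<in> chart_dom x0"
  then have xE: "x \<in> E" "nE (x - x0) < r" "pert (x - x0) \<in> E" "nE (pert (x - x0)) < r/2"
    by (auto simp: chart_dom_def chart_def halfball_def)
  define e where "e = min (r - nE (x - x0)) ((r/2 - nE (pert (x - x0))) / 2)"
  show "\<exists>e>0. \<forall>y\<in>E. nE (y - x) < e \<longrightarrow> y \<in> chart_dom x0"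
  proof (intro exI[of _ e] conjI ballI impI)
    fix y assume y: "y \<in> E" "nE (y - x) < e"
    have 1: "nE (y - x0) < r"
      using nE_diff_trans[of y x x0] y xE assms by (simp add: e_def)
    have "nE (pert (y - x0) - pert (x - x0)) \<le> 2 * nE (y - x)"
      using pert_lipschitz[of "x - x0" "y - x0"] 1 xE y assms by simp
    also have "\<dots> < r/2 - nE (pert (x - x0))" using y by (simp add: e_def)
    finally have "nE (pert (y - x0)) < r/2"
      using nE_triangle[of "pert (y - x0) - pert (x - x0)" "pert (x - x0)"] y xE assms by simp
    then show "y \<in> chart_dom x0"
      using y 1 assms by (simp add: chart_dom_def chart_def halfball_def)
  qed (use xE in \<open>simp add: e_def\<close>)
qed (auto simp: chart_dom_def)

lemma bij_betw_chart:
  assumes "x0 \<in> E"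
  shows "bij_betw (chart x0) (chart_dom x0) halfball"
proof (rule bij_betwI[where g = "\<lambda>y. x0 + pert_inv y"])
  show "chart x0 \<in> chart_dom x0 \<rightarrow> halfball" by (auto simp: chart_dom_def)
  show "(\<lambda>y. x0 + pert_inv y) \<in> halfball \<rightarrow> chart_dom x0"
    using assms pert_inv by (auto simp: chart_dom_def chart_def halfball_def)
  show "x0 + pert_inv (chart x0 x) = x" if "x \<in> chart_dom x0" for x
  proof -
    have "pert_inv (pert (x - x0)) = x - x0"
      using that assms by (intro pert_inv_unique) (auto simp: chart_dom_def chart_def halfball_def)
    then show ?thesis by (simp add: chart_def)
  qed
  show "chart x0 (x0 + pert_inv y) = y" if "y \<in> halfball" for y
    using that pert_inv(3) by (simp add: chart_def halfball_def)
qed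

lemma inv_into_chart:
  assumes "x0 \<in> E" "y \<in> halfball"
  shows "inv_into (chart_dom x0) (chart x0) y = x0 + pert_inv y"
proof (rule inv_into_f_eq)
  show "inj_on (chart x0) (chart_dom x0)" using bij_betw_chart[OF assms(1)] by (rule bij_betw_imp_inj_on)
  show "x0 + pert_inv y \<in> chart_dom x0" "chart x0 (x0 + pert_inv y) = y"
    using assms pert_inv by (auto simp: chart_dom_def chart_def halfball_def)
qed

text \<open>
  The \<open>k\<close>-th derivative is the value of the \<open>k\<close>-fold formal derivative of \<open>Base\<close>;
  boundedness, multilinearity and differentiability are the properties of expressions
  established before.
\<close>

lemma smooth_inverse_chart:
  assumes "x0 \<in> E"
  shows "smooth_map_on E nE E nE halfball (inv_into (chart_dom x0) (chart x0))"
proof -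
  define t where "t k = (deriv_jet ^^ k) Base" for k
  have t: "multilinear_in {..<k} (t k)" for k unfolding t_def by (rule multilinear_in_derivs)
  have t_Suc: "deriv_jet (t k) = t (Suc k)" for k by (simp add: t_def)
  \<comment> \<open>The translation by \<open>x0\<close> only changes the derivative of order \<open>0\<close>.\<close>
  define D where "D k y vs = (if k = 0 then x0 else 0) + jet_val y vs (t k)" for k :: nat and y vs
  have "bounded_multilinear_on E nE E nE k (D k y)" if y: "y \<in> halfball" for k y
    unfolding bounded_multilinear_on_def
  proof (intro conjI allI impI)
    fix vs assume vs: "length vs = k \<and> set vs \<subseteq> E"
    then show "D k y vs \<in> E"
      using assms jet_val_in[OF t y, of vs k] by (simp add: D_def)
  next
    fix vs i v w c assume "length vs = k \<and> set vs \<subseteq> E \<and> i < k \<and> v \<in> E \<and> w \<in> E"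
    then show "D k y (vs[i := c *\<^sub>R v + w]) = c *\<^sub>R D k y (vs[i := v]) + D k y (vs[i := w])"
      using jet_val_linear[OF t[of k] _ y, of i vs v w c] by (auto simp: D_def)
  next
    obtain K where K: "K \<ge> 0" "\<And>y vs. y \<in> halfball \<Longrightarrow> set vs \<subseteq> E \<Longrightarrow> {..<k} \<subseteq> {..<length vs} \<Longrightarrow>
        nE (jet_val y vs (t k)) \<le> K * size_on {..<k} vs"
      using jet_val_bound[OF t[of k]] by auto
    show "\<exists>B. \<forall>vs. length vs = k \<and> set vs \<subseteq> E \<longrightarrow> nE (D k y vs) \<le> B * prod_list (map nE vs)"
    proof (intro exI[of _ "nE x0 + K"] allI impI)
      fix vs assume vs: "length vs = k \<and> set vs \<subseteq> E"
      then have jet_val: "nE (jet_val y vs (t k)) \<le> K * prod_list (map nE vs)" "jet_val y vs (t k) \<in> E"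
        using K(2)[OF y, of vs] size_on_lessThan[of vs] jet_val_in[OF t y, of vs k] by auto
      show "nE (D k y vs) \<le> (nE x0 + K) * prod_list (map nE vs)"
      proof (cases "k = 0")
        case True
        then show ?thesis using jet_val vs nE_triangle[of x0 "jet_val y vs (t 0)"] assms by (simp add: D_def)
      next
        case False
        have "0 \<le> nE x0 * prod_list (map nE vs)" by (intro mult_nonneg_nonneg) simp_all
        then have "nE (jet_val y vs (t k)) \<le> (nE x0 + K) * prod_list (map nE vs)"
          using jet_val(1) unfolding distrib_right by linarith
        then show ?thesis using False by (simp add: D_def)
      qed
    qed
  qed
  moreover have "has_multilinear_derivative_at E nE nE k halfball (D k) (D (Suc k) y) y"
    if y: "y \<in> halfball" for k y
  proof -
    obtain R where R: "R \<ge> 0" "\<And>y' vs. y' \<in> halfball \<Longrightarrow> set vs \<subseteq> E \<Longrightarrow> {..<k} \<subseteq> {..<length vs} \<Longrightarrow>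
        nE (jet_val y' vs (t k) - jet_val y vs (t k) - jet_val y ((y' - y) # vs) (t (Suc k))) \<le> R * (nE (y' - y))\<^sup>2 * size_on {..<k} vs"
      using jet_val_remainder[OF t[of k]] y t_Suc[of k] by auto
    show ?thesis
      unfolding has_multilinear_derivative_at_def
    proof (intro allI impI)
      fix e :: real assume "e > 0"
      show "\<exists>d>0. \<forall>y'\<in>halfball. nE (y' - y) < d \<longrightarrow> (\<forall>vs. length vs = k \<and> set vs \<subseteq> E \<longrightarrow>
          nE (D k y' vs - D k y vs - D (Suc k) y ((y' - y) # vs)) \<le> e * nE (y' - y) * prod_list (map nE vs))"
      proof (intro exI[of _ "e / (R + 1)"] conjI ballI allI impI)
        fix y' vs assume y': "y' \<in> halfball" "nE (y' - y) < e / (R + 1)" and vs: "length vs = k \<and> set vs \<subseteq> E"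
        let ?p = "prod_list (map nE vs)"
        have p: "0 \<le> ?p" "size_on {..<k} vs = ?p"
          using vs size_on_lessThan[of vs] by auto
        have "nE (y' - y) * (R + 1) \<le> e" using y'(2) R(1) by (simp add: pos_less_divide_eq)
        moreover have "R * nE (y' - y) = nE (y' - y) * (R + 1) - nE (y' - y)" by (simp add: algebra_simps)
        ultimately have "R * nE (y' - y) \<le> e" using nE_nonneg[of "y' - y"] by linarith
        have "nE (D k y' vs - D k y vs - D (Suc k) y ((y' - y) # vs)) \<le> (R * nE (y' - y)) * (nE (y' - y) * ?p)"
          using R(2)[OF y'(1), of vs] vs p by (simp add: D_def power2_eq_square mult_ac)
        also have "\<dots> \<le> e * (nE (y' - y) * ?p)"
          using \<open>R * nE (y' - y) \<le> e\<close> p by (intro mult_right_mono) auto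
        finally show "nE (D k y' vs - D k y vs - D (Suc k) y ((y' - y) # vs)) \<le> e * nE (y' - y) * ?p"
          by (simp add: mult_ac)
      qed (use R \<open>e > 0\<close> in auto)
    qed
  qed
  moreover have "D 0 y [] = inv_into (chart_dom x0) (chart x0) y" if "y \<in> halfball" for y
    using that assms by (simp add: D_def t_def inv_into_chart)
  ultimately show ?thesis
    unfolding smooth_map_on_def using openin_halfball by blast
qed

lemma smooth_chart:
  assumes "x0 \<in> E"
  shows "smooth_map_on E nE E nE (chart_dom x0) (chart x0)"
proof -
  \<comment> \<open>The chart is a polynomial of degree \<open>2\<close>, with derivatives written down explicitly.\<close>
  define D where "D k x vs = (if k = 0 then chart x0 x
      else if k = 1 then vs ! 0 + 2 *\<^sub>R Q (x - x0) (vs ! 0)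
      else if k = 2 then 2 *\<^sub>R Q (vs ! 0) (vs ! 1) else 0)" for k :: nat and x vs
  have dom: "x \<in> E" "nE (x - x0) \<le> r" if "x \<in> chart_dom x0" for x
    using that by (auto simp: chart_dom_def)
  have list1: "\<exists>v. vs = [v]" if "length vs = 1" for vs :: "'a list" using that by (auto simp: length_Suc_conv)
  have list2: "\<exists>v w. vs = [v, w]" if "length vs = 2" for vs :: "'a list"
    using that by (auto simp: length_Suc_conv numeral_2_eq_2)
  have "bounded_multilinear_on E nE E nE k (D k x)" if x: "x \<in> chart_dom x0" for k x
  proof -
    consider "k = 0" | "k = 1" | "k = 2" | "k > 2" by linarith
    then show ?thesis
    proof cases
      case 1
      then show ?thesis using dom[OF x] assms
        by (auto simp: bounded_multilinear_on_def D_def chart_def intro!: exI[of _ "nE (pert (x - x0))"])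
    next
      case 2
      have *: "nE (v + 2 *\<^sub>R Q (x - x0) v) \<le> 2 * nE v" if "v \<in> E" for v
      proof -
        have "nE (v + 2 *\<^sub>R Q (x - x0) v) \<le> nE v + 2 * nE (Q (x - x0) v)"
          using nE_triangle[of v "2 *\<^sub>R Q (x - x0) v"] that dom[OF x] assms by (simp add: nE_scale)
        moreover have "nE (Q (x - x0) v) \<le> 1/4 * nE v"
          using that dom[OF x] assms by (intro Q_small) auto
        ultimately show ?thesis using nE_nonneg[of v] by linarith
      qed
      show ?thesis unfolding bounded_multilinear_on_def 2
      proof (intro conjI allI impI exI[of _ 2])
        fix vs :: "'a list" assume vs: "length vs = 1 \<and> set vs \<subseteq> E"
        then obtain v where "vs = [v]" using list1 by blast
        then show "D 1 x vs \<in> E" "nE (D 1 x vs) \<le> 2 * prod_list (map nE vs)"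
          using vs * dom[OF x] assms by (auto simp: D_def)
      next
        fix vs :: "'a list" and i :: nat and v w :: 'a and c :: real assume vs: "length vs = 1 \<and> set vs \<subseteq> E \<and> i < 1 \<and> v \<in> E \<and> w \<in> E"
        then show "D 1 x (vs[i := c *\<^sub>R v + w]) = c *\<^sub>R D 1 x (vs[i := v]) + D 1 x (vs[i := w])"
          using dom[OF x] assms by (simp add: D_def Q_add_right Q_scale_right scaleR_right_distrib)
      qed
    next
      case 3
      show ?thesis unfolding bounded_multilinear_on_def 3
      proof (intro conjI allI impI exI[of _ "2 * C"])
        fix vs :: "'a list" assume vs: "length vs = 2 \<and> set vs \<subseteq> E"
        then obtain v w where "vs = [v, w]" using list2 by blast
        then show "D 2 x vs \<in> E" "nE (D 2 x vs) \<le> 2 * C * prod_list (map nE vs)"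
          using vs Q_bound[of v w] by (auto simp: D_def nE_scale)
      next
        fix vs :: "'a list" and i :: nat and v w :: 'a and c :: real assume vs: "length vs = 2 \<and> set vs \<subseteq> E \<and> i < 2 \<and> v \<in> E \<and> w \<in> E"
        then obtain a b where ab: "vs = [a, b]" using list2 by blast
        have "i = 0 \<or> i = 1" using vs by auto
        then show "D 2 x (vs[i := c *\<^sub>R v + w]) = c *\<^sub>R D 2 x (vs[i := v]) + D 2 x (vs[i := w])"
          using vs ab by (auto simp: D_def Q_add_right Q_scale_right Q_add_left Q_scale_left scaleR_right_distrib)
      qed
    next
      case 4
      then show ?thesis by (auto simp: bounded_multilinear_on_def D_def intro!: exI[of _ 0])
    qed
  qed
  moreover have "has_multilinear_derivative_at E nE nE k (chart_dom x0) (D k) (D (Suc k) x) x"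
    if x: "x \<in> chart_dom x0" for k x
    unfolding has_multilinear_derivative_at_def
  proof (intro allI impI)
    fix e :: real assume "e > 0"
    show "\<exists>d>0. \<forall>y\<in>chart_dom x0. nE (y - x) < d \<longrightarrow> (\<forall>vs. length vs = k \<and> set vs \<subseteq> E \<longrightarrow>
        nE (D k y vs - D k x vs - D (Suc k) x ((y - x) # vs)) \<le> e * nE (y - x) * prod_list (map nE vs))"
    proof (intro exI[of _ "e / (C + 1)"] conjI ballI allI impI)
      fix y vs assume y: "y \<in> chart_dom x0" "nE (y - x) < e / (C + 1)" and vs: "length vs = k \<and> set vs \<subseteq> E"
      have yE: "y \<in> E" "x \<in> E" using dom x y by auto
      consider "k = 0" | "k = 1" | "k = 2" | "k > 2" by linarith
      then show "nE (D k y vs - D k x vs - D (Suc k) x ((y - x) # vs)) \<le> e * nE (y - x) * prod_list (map nE vs)"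
      proof cases
        case 1
        have *: "pert (y - x0) - pert (x - x0) = ((y - x) + 2 *\<^sub>R Q (x - x0) (y - x)) + Q (y - x) (y - x)"
        proof -
          have "(y - x0) + (x - x0) = 2 *\<^sub>R (x - x0) + (y - x)" by (simp add: scaleR_2)
          moreover have "Q (2 *\<^sub>R (x - x0) + (y - x)) (y - x) = 2 *\<^sub>R Q (x - x0) (y - x) + Q (y - x) (y - x)"
            using yE assms by (subst Q_add_left) (auto simp: Q_scale_left)
          moreover have "(y - x0) - (x - x0) = y - x" by simp
          moreover have "pert (y - x0) - pert (x - x0) = ((y - x0) - (x - x0)) + Q ((y - x0) + (x - x0)) ((y - x0) - (x - x0))"
            using yE assms by (intro pert_diff) auto
          ultimately show ?thesis by (simp only: add.assoc)
        qed
        have "nE (Q (y - x) (y - x)) \<le> C * nE (y - x) * nE (y - x)"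
          using yE by (intro Q_bound) auto
        also have "\<dots> \<le> e * nE (y - x)"
        proof (rule mult_right_mono)
          have "nE (y - x) * (C + 1) \<le> e" using y(2) C_nonneg by (simp add: pos_less_divide_eq)
          moreover have "C * nE (y - x) = nE (y - x) * (C + 1) - nE (y - x)" by (simp add: algebra_simps)
          ultimately show "C * nE (y - x) \<le> e" using nE_nonneg[of "y - x"] by linarith
        qed simp
        finally show ?thesis using 1 vs * by (simp add: D_def chart_def)
      next
        case 2
        then obtain v where "vs = [v]" using list1 vs by blast
        moreover have "D 1 y [v] - D 1 x [v] - D 2 x [y - x, v] = 0" if "v \<in> E"
          using yE assms that by (simp add: D_def Q_diff_left algebra_simps)
        ultimately show ?thesis using 2 vs \<open>e > 0\<close> by (simp add: numeral_2_eq_2)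
      next
        case 3
        have "0 \<le> e * nE (y - x) * prod_list (map nE vs)" using \<open>e > 0\<close> by simp
        then show ?thesis using 3 by (simp add: D_def)
      next
        case 4
        have "0 \<le> e * nE (y - x) * prod_list (map nE vs)" using \<open>e > 0\<close> by simp
        then show ?thesis using 4 by (simp add: D_def)
      qed
    qed (use C_nonneg \<open>e > 0\<close> in auto)
  qed
  moreover have "D 0 x [] = chart x0 x" for x by (simp add: D_def)
  ultimately show ?thesis
    unfolding smooth_map_on_def using openin_chart_dom[OF assms] by blast
qed

lemma smooth_diffeomorphism_chart:
  "x0 \<in> E \<Longrightarrow> smooth_diffeomorphism E nE (chart_dom x0) halfball (chart x0)"
  unfolding smooth_diffeomorphism_def
  using bij_betw_chart smooth_chart smooth_inverse_chart by blast

end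

context banach_carrier
begin

text \<open>
  If the equation that cuts out \<open>S\<close> near \<open>x0\<close> is \<open>P (h + Q h h) = 0\<close> for \<open>h = x - x0\<close> with
  a bounded projection \<open>P\<close>, then \<open>h \<mapsto> h + Q h h\<close>, restricted to a small neighbourhood of
  \<open>0\<close>, is a chart that maps \<open>S\<close> to the kernel of \<open>P\<close>. The kernel is complemented by the
  range of \<open>P\<close>.
\<close>

lemma quadratic_constraint_chart:
  assumes P: "\<And>x. x \<in> E \<Longrightarrow> P x \<in> E" "\<And>x y. x \<in> E \<Longrightarrow> y \<in> E \<Longrightarrow> P (x + y) = P x + P y"
      "\<And>x c. x \<in> E \<Longrightarrow> P (c *\<^sub>R x) = c *\<^sub>R P x" "\<And>x. x \<in> E \<Longrightarrow> nE (P x) \<le> K * nE x"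
      "\<And>x. x \<in> E \<Longrightarrow> P (P x) = P x"
    and Q: "\<And>x y. x \<in> E \<Longrightarrow> y \<in> E \<Longrightarrow> Q x y \<in> E" "\<And>x y. x \<in> E \<Longrightarrow> y \<in> E \<Longrightarrow> Q x y = Q y x"
      "\<And>x y z. x \<in> E \<Longrightarrow> y \<in> E \<Longrightarrow> z \<in> E \<Longrightarrow> Q (x + y) z = Q x z + Q y z"
      "\<And>x z c. x \<in> E \<Longrightarrow> z \<in> E \<Longrightarrow> Q (c *\<^sub>R x) z = c *\<^sub>R Q x z"
      "\<And>x y. x \<in> E \<Longrightarrow> y \<in> E \<Longrightarrow> nE (Q x y) \<le> C * nE x * nE y" "0 \<le> C"
    and \<Omega>: "openin (norm_topology E nE) \<Omega>" and x0: "x0 \<in> S" "S \<subseteq> \<Omega>"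
    and S: "\<And>x. x \<in> \<Omega> \<Longrightarrow> x \<in> S \<longleftrightarrow> P (x - x0 + Q (x - x0) (x - x0)) = 0"
  shows "\<exists>U V \<phi> F G. x0 \<in> U \<and> U \<subseteq> \<Omega> \<and> openin (norm_topology E nE) U \<and> openin (norm_topology E nE) V \<and>
        smooth_diffeomorphism E nE U V \<phi> \<and> closed_splitting E nE F G \<and> \<phi> ` (S \<inter> U) = V \<inter> F"
proof -
  have x0E: "x0 \<in> E" and x0\<Omega>: "x0 \<in> \<Omega>" using x0 \<Omega> by (auto simp: openin_norm_topology)
  obtain e where e: "e > 0" "\<And>y. y \<in> E \<Longrightarrow> nE (y - x0) < e \<Longrightarrow> y \<in> \<Omega>"
    using \<Omega> x0\<Omega> unfolding openin_norm_topology by blast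
  \<comment> \<open>\<open>C + 1\<close> avoids a division by zero.\<close>
  define r where "r = min e (1 / (4 * (C + 1)))"
  have "4 * C * r \<le> 4 * (C + 1) * (1 / (4 * (C + 1)))"
    using \<open>0 \<le> C\<close> e(1) by (intro mult_mono) (auto simp: r_def)
  also have "\<dots> = 1" using \<open>0 \<le> C\<close> by simp
  finally have small: "4 * C * r \<le> 1" .
  have "r > 0" using e \<open>0 \<le> C\<close> by (simp add: r_def)
  interpret quadratic_perturbation E nE Q C r
    by unfold_locales (use Q small \<open>r > 0\<close> in auto)
  let ?F = "{x \<in> E. P x = 0}"
  have "r \<le> e" by (simp add: r_def)
  then have U: "chart_dom x0 \<subseteq> \<Omega>" using e(2) by (auto simp: chart_dom_def)
  have "chart x0 ` (S \<inter> chart_dom x0) = halfball \<inter> ?F"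
  proof (intro equalityI subsetI)
    fix y assume "y \<in> chart x0 ` (S \<inter> chart_dom x0)"
    then obtain x where x: "x \<in> S" "x \<in> chart_dom x0" "y = chart x0 x" by blast
    then have "P y = 0" using S[OF subsetD[OF U x(2)]] by (simp add: chart_def pert_def)
    moreover have "y \<in> halfball" using x by (auto simp: chart_dom_def)
    ultimately show "y \<in> halfball \<inter> ?F" by (simp add: halfball_def)
  next
    fix y assume y: "y \<in> halfball \<inter> ?F"
    then have "y \<in> chart x0 ` chart_dom x0"
      using bij_betw_imp_surj_on[OF bij_betw_chart[OF x0E]] by simp
    then obtain x where x: "y = chart x0 x" "x \<in> chart_dom x0" by (rule imageE)
    then have "x \<in> S" using S[OF subsetD[OF U x(2)]] y by (simp add: chart_def pert_def)
    then show "y \<in> chart x0 ` (S \<inter> chart_dom x0)" using x by blast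
  qed
  moreover have "x0 \<in> chart_dom x0"
    using x0E \<open>r > 0\<close> by (simp add: chart_dom_def chart_def pert_def halfball_def)
  moreover have "closed_splitting E nE ?F {x \<in> E. P x = x}"
    by (rule closed_splitting_projection) (use P in auto)
  moreover note U openin_chart_dom[OF x0E] openin_halfball smooth_diffeomorphism_chart[OF x0E]
  ultimately show ?thesis by (intro exI conjI)
qed

end

section \<open>Primitives and periodic functions\<close>

definition loc_integrable :: "(real \<Rightarrow> 'b::euclidean_space) \<Rightarrow> bool" where
  "loc_integrable g \<longleftrightarrow> g \<in> borel_measurable borel \<and> (\<forall>a b. set_integrable lborel {a..b} g)"

text \<open>
  The primitive that vanishes at \<open>0\<close>. One of the two intervals is empty or a point, so
  that the formula covers both signs of \<open>t\<close>.
\<close>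

definition prim :: "(real \<Rightarrow> 'b::euclidean_space) \<Rightarrow> real \<Rightarrow> 'b" where
  "prim g t = (LINT x:{0..t}|lborel. g x) - (LINT x:{t..0}|lborel. g x)"

lemma loc_integrable_measurable: "loc_integrable g \<Longrightarrow> g \<in> borel_measurable borel"
  and loc_integrable_set: "loc_integrable g \<Longrightarrow> set_integrable lborel {a..b} g"
  by (auto simp: loc_integrable_def)

lemma loc_integrable_continuous: "continuous_on UNIV g \<Longrightarrow> loc_integrable g"
  unfolding loc_integrable_def
  by (auto intro: borel_measurable_continuous_onI borel_integrable_atLeastAtMost' continuous_on_subset)

lemma loc_integrable_diff: "loc_integrable f \<Longrightarrow> loc_integrable g \<Longrightarrow> loc_integrable (\<lambda>x. f x - g x)"
  and loc_integrable_scaleR: "loc_integrable f \<Longrightarrow> loc_integrable (\<lambda>x. c *\<^sub>R f x)"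
  by (auto simp: loc_integrable_def)

lemma loc_integrable_bounded_linear:
  assumes "bounded_linear T" "loc_integrable f" shows "loc_integrable (\<lambda>x. T (f x))"
proof -
  interpret T: bounded_linear T by fact
  have "set_integrable lborel {a..b} (\<lambda>x. T (f x))" for a b
    using integrable_bounded_linear[OF assms(1)] loc_integrable_set[OF assms(2), of a b]
    by (simp add: set_integrable_def T.scaleR[symmetric])
  moreover have "T \<in> borel_measurable borel"
    by (simp add: borel_measurable_continuous_onI linear_continuous_on assms(1))
  ultimately show ?thesis using assms(2) by (auto simp: loc_integrable_def)
qed

lemma set_integral_Icc_combine:
  assumes "loc_integrable g" "a \<le> b" "b \<le> c"
  shows "(LINT x:{a..c}|lborel. g x) = (LINT x:{a..b}|lborel. g x) + (LINT x:{b..c}|lborel. g x)"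
proof -
  have "integral {a..c} g = integral {a..b} g + integral {b..c} g"
    using Henstock_Kurzweil_Integration.integral_combine[of a b c g] assms
      set_borel_integral_eq_integral(1)[OF loc_integrable_set[OF assms(1)]] by simp
  then show ?thesis
    using set_borel_integral_eq_integral(2)[OF loc_integrable_set[OF assms(1)]] by simp
qed

lemma set_integral_Icc_trivial:
  fixes g :: "real \<Rightarrow> 'b::euclidean_space"
  assumes "b \<le> a" shows "(LINT x:{a..b}|lborel. g x) = 0"
proof (cases "a = b")
  case True
  have "AE x in lborel. indicator {b} x *\<^sub>R g x = 0"
    using AE_lborel_singleton[of b] by eventually_elim (auto simp: indicator_def)
  then have "(LINT x|lborel. indicator {b} x *\<^sub>R g x) = 0"
    by (rule integral_eq_zero_AE)
  then show ?thesis unfolding set_lebesgue_integral_def True atLeastAtMost_singleton .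
qed (use assms in \<open>simp add: set_lebesgue_integral_def\<close>)

lemma set_integral_empty [simp]: "set_lebesgue_integral M {} g = 0"
  by (simp add: set_lebesgue_integral_def)

lemma prim_diff:
  assumes "loc_integrable g" "a \<le> b"
  shows "prim g b - prim g a = (LINT x:{a..b}|lborel. g x)"
proof -
  consider "0 \<le> a" | "b \<le> 0" | "a < 0" "0 < b" by linarith
  then show ?thesis
  proof cases
    case 1
    then show ?thesis using set_integral_Icc_combine[OF assms(1), of 0 a b] assms
      by (simp add: prim_def set_integral_Icc_trivial)
  next
    case 2
    then show ?thesis using set_integral_Icc_combine[OF assms(1), of a b 0] assms
      by (simp add: prim_def set_integral_Icc_trivial)
  next
    case 3
    then show ?thesis using set_integral_Icc_combine[OF assms(1), of a 0 b] assms
      by (simp add: prim_def set_integral_Icc_trivial)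
  qed
qed

lemma prim_0 [simp]: "prim g 0 = 0"
  by (simp add: prim_def)

lemma prim_1: "prim g 1 = (LINT x:{0..1}|lborel. g x)"
  by (simp add: prim_def set_integral_Icc_trivial)

lemma prim_eq_integral:
  assumes "loc_integrable g" "a \<le> b"
  shows "prim g b = prim g a + integral {a..b} g"
  using prim_diff[OF assms] set_borel_integral_eq_integral(2)[OF loc_integrable_set[OF assms(1)]]
  by (simp add: algebra_simps)

lemma prim_cong_AE:
  assumes "AE x in lborel. f x = g x" "f \<in> borel_measurable borel" "g \<in> borel_measurable borel"
  shows "prim f = prim g"
  unfolding prim_def using assms
  by (auto simp: fun_eq_iff intro!: arg_cong2[where f = "(-)"] set_lebesgue_integral_cong_AE)

lemma prim_add: "loc_integrable f \<Longrightarrow> loc_integrable g \<Longrightarrow> prim (\<lambda>x. f x + g x) t = prim f t + prim g t"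
  and prim_minus: "loc_integrable f \<Longrightarrow> loc_integrable g \<Longrightarrow> prim (\<lambda>x. f x - g x) t = prim f t - prim g t"
  by (auto simp: prim_def loc_integrable_def set_integral_add set_integral_diff)

lemma prim_scaleR: "prim (\<lambda>x. c *\<^sub>R f x) t = c *\<^sub>R prim f t"
  by (simp add: prim_def scaleR_diff_right)

lemma prim_bounded_linear:
  assumes T: "bounded_linear T" and f: "loc_integrable f"
  shows "prim (\<lambda>x. T (f x)) t = T (prim f t)"
proof -
  interpret T: bounded_linear T by fact
  have "(LINT x:{a..b}|lborel. T (f x)) = T (LINT x:{a..b}|lborel. f x)" for a b
    using integral_bounded_linear[OF T, of lborel "\<lambda>x. indicator {a..b} x *\<^sub>R f x"] loc_integrable_set[OF f, of a b]
    by (simp add: set_lebesgue_integral_def set_integrable_def T.scaleR)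
  then show ?thesis by (simp add: prim_def T.diff)
qed

lemma prim_const: "prim (\<lambda>_. c) t = t *\<^sub>R c"
proof -
  have "loc_integrable (\<lambda>_::real. c)" by (intro loc_integrable_continuous) auto
  then show ?thesis
    using prim_eq_integral[of "\<lambda>_. c" 0 t] prim_eq_integral[of "\<lambda>_. c" t 0] by (cases "0 \<le> t") auto
qed

lemma isCont_prim:
  assumes "loc_integrable g" shows "isCont (prim g) x"
proof -
  have "g integrable_on {x - 1..x + 1}"
    using set_borel_integral_eq_integral(1)[OF loc_integrable_set[OF assms]] .
  then have "continuous_on {x - 1..x + 1} (\<lambda>t. prim g (x - 1) + integral {x - 1..t} g)"
    by (intro continuous_intros indefinite_integral_continuous_1)
  then have "continuous_on {x - 1..x + 1} (prim g)"
    by (rule continuous_on_eq) (use prim_eq_integral[OF assms] in auto)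
  then show ?thesis by (rule continuous_on_interior) auto
qed

lemma continuous_on_prim: "loc_integrable g \<Longrightarrow> continuous_on A (prim g)"
  using isCont_prim[of g] by (intro continuous_at_imp_continuous_on) blast

lemma prim_has_vector_derivative:
  assumes "continuous_on UNIV g" shows "(prim g has_vector_derivative g x) (at x)"
proof -
  have "((\<lambda>t. integral {x - 1..t} g) has_vector_derivative g x) (at x within {x - 1..x + 1})"
    using assms by (intro integral_has_vector_derivative continuous_on_subset[OF assms]) auto
  then have "((\<lambda>t. integral {x - 1..t} g) has_vector_derivative g x) (at x)"
    using at_within_Icc_at[of "x - 1" x "x + 1"] by simp
  then have "((\<lambda>t. prim g (x - 1) + integral {x - 1..t} g) has_vector_derivative g x) (at x)"
    by (auto intro!: derivative_eq_intros)
  then show ?thesis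
    by (rule has_vector_derivative_transform_within_open[where S = "{x - 1<..}"])
       (use prim_eq_integral[OF loc_integrable_continuous[OF assms], symmetric] in auto)
qed

lemma prim_of_derivative:
  assumes f: "\<And>t. (f has_vector_derivative f' t) (at t)" and f': "continuous_on UNIV f'"
  shows "prim f' t = f t - f 0"
proof -
  have d: "((\<lambda>t. prim f' t - f t) has_vector_derivative 0) (at t)" for t
    using has_vector_derivative_diff[OF prim_has_vector_derivative[OF f', of t] f[of t]] by simp
  obtain c where c: "\<And>t. prim f' t - f t = c"
    using has_vector_derivative_zero_constant[of UNIV "\<lambda>t. prim f' t - f t"] d by auto
  have "prim f' t - f t = prim f' 0 - f 0" unfolding c ..
  then show ?thesis by (simp add: algebra_simps)
qed

lemma periodic1_add_int:
  assumes "periodic1 f" shows "f (t + real_of_int k) = f t"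
proof -
  have nat: "f (t + real n) = f t" for n t
  proof (induction n arbitrary: t)
    case (Suc n)
    have "f (t + real (Suc n)) = f ((t + real n) + 1)" by (simp add: add_ac)
    also have "\<dots> = f (t + real n)" using assms unfolding periodic1_def by blast
    finally show ?case using Suc by simp
  qed simp
  show ?thesis
  proof (cases "k \<ge> 0")
    case True then show ?thesis using nat[of t "nat k"] by simp
  next
    case False then show ?thesis using nat[of "t + real_of_int k" "nat (- k)"] by simp
  qed
qed

lemma periodic1_frac: "periodic1 f \<Longrightarrow> f (frac t) = f t"
  using periodic1_add_int[of f t "- \<lfloor>t\<rfloor>"] by (simp add: frac_def)

lemma periodic1_eqI:
  assumes "periodic1 f" "periodic1 g" "\<And>t. 0 \<le> t \<Longrightarrow> t \<le> 1 \<Longrightarrow> f t = g t"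
  shows "f t = g t"
  using assms(3)[of "frac t"] periodic1_frac[OF assms(1), of t] periodic1_frac[OF assms(2), of t] frac_lt_1[of t]
  by (simp add: less_imp_le)

lemma set_integral_shift:
  fixes g :: "real \<Rightarrow> 'b::euclidean_space"
  assumes "periodic1 g"
  shows "(LINT x:{a + 1..b + 1}|lborel. g x) = (LINT x:{a..b}|lborel. g x)"
proof -
  have "(LINT x|lborel. indicator {a + 1..b + 1} x *\<^sub>R g x)
      = (LINT x|lborel. indicator {a + 1..b + 1} (1 + 1 * x) *\<^sub>R g (1 + 1 * x))"
    using lborel_integral_real_affine[of 1 "\<lambda>x. indicator {a + 1..b + 1} x *\<^sub>R g x" 1] by simp
  also have "\<dots> = (LINT x|lborel. indicator {a..b} x *\<^sub>R g x)"
    using assms by (intro Bochner_Integration.integral_cong) (auto simp: periodic1_def indicator_def add.commute)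
  finally show ?thesis by (simp add: set_lebesgue_integral_def)
qed

text \<open>
  \<open>prim g (t + 1) - prim g t\<close> does not depend on \<open>t\<close>, since the integral of a periodic
  function over an interval does not change when the interval is shifted by \<open>1\<close>.
\<close>

lemma prim_shift:
  assumes "loc_integrable g" "periodic1 g"
  shows "prim g (t + 1) = prim g t + prim g 1"
proof -
  define D where "D t = prim g (t + 1) - prim g t" for t
  have "D a = D b" if "a \<le> b" for a b
    using prim_diff[OF assms(1) that] prim_diff[OF assms(1), of "a + 1" "b + 1"] that set_integral_shift[OF assms(2), of a b]
    by (simp add: D_def algebra_simps)
  then have "D t = D 0" by (metis linear)
  then show ?thesis by (simp add: D_def algebra_simps)
qed

lemma periodic1_prim: "loc_integrable g \<Longrightarrow> periodic1 g \<Longrightarrow> prim g 1 = 0 \<Longrightarrow> periodic1 (prim g)"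
  using prim_shift[of g] unfolding periodic1_def by simp

lemma set_integrable_periodic:
  fixes g :: "real \<Rightarrow> 'b::euclidean_space"
  assumes "periodic1 g" "set_integrable lborel {0..1} g"
  shows "set_integrable lborel {a..b} g"
proof -
  have unit: "set_integrable lborel {real_of_int k..real_of_int k + 1} g" for k
  proof -
    have "(\<lambda>x. indicator {real_of_int k..real_of_int k + 1} (real_of_int k + 1 * x) *\<^sub>R g (real_of_int k + 1 * x))
        = (\<lambda>x. indicator {0..1} x *\<^sub>R g x)"
      using periodic1_add_int[OF assms(1)] by (auto simp: fun_eq_iff indicator_def add.commute)
    then show ?thesis
      using assms(2) lborel_integrable_real_affine_iff[of 1 "\<lambda>x. indicator {real_of_int k..real_of_int k + 1} x *\<^sub>R g x" "real_of_int k"]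
      by (simp add: set_integrable_def)
  qed
  have "set_integrable lborel {- real n..real n} g" for n
  proof (induction n)
    case 0
    then show ?case using set_integrable_subset[OF assms(2), of "{0}"] by simp
  next
    case (Suc n)
    have "{- real (Suc n)..real (Suc n)} = {- real (Suc n)..- real n} \<union> ({- real n..real n} \<union> {real n..real (Suc n)})"
      by auto
    moreover have "set_integrable lborel {- real (Suc n)..- real n} g"
      using unit[of "- int (Suc n)"] by simp
    moreover have "set_integrable lborel {real n..real (Suc n)} g"
      using unit[of "int n"] by (simp add: add.commute)
    ultimately show ?case using Suc by (simp add: set_integrable_Un)
  qed
  moreover obtain n where "\<bar>a\<bar> \<le> real n" "\<bar>b\<bar> \<le> real n"
    using real_arch_simple[of "max \<bar>a\<bar> \<bar>b\<bar>"] by auto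
  ultimately show ?thesis by (intro set_integrable_subset[of lborel "{- real n..real n}" g "{a..b}"]) auto
qed

text \<open>
  Local integrability comes from \<open>\<bar>g\<bar> \<le> 1 + \<bar>g\<bar>\<^sup>2\<close>.
\<close>

lemma L2_periodicD:
  assumes "g \<in> L2_periodic"
  shows "periodic1 g" "loc_integrable g" "set_integrable lborel {a..b} (\<lambda>t. (norm (g t))\<^sup>2)"
    "g \<in> borel_measurable borel"
proof -
  have "periodic1 g \<and> g \<in> borel_measurable borel \<and> set_integrable lborel {0..1} (\<lambda>t. (norm (g t))\<^sup>2)"
    using assms unfolding L2_periodic_def by simp
  then have p: "periodic1 g" and m: "g \<in> borel_measurable borel"
    and sq: "set_integrable lborel {0..1} (\<lambda>t. (norm (g t))\<^sup>2)" by simp_all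
  show "periodic1 g" "g \<in> borel_measurable borel" by (rule p m)+
  show "set_integrable lborel {a..b} (\<lambda>t. (norm (g t))\<^sup>2)"
    by (rule set_integrable_periodic) (use p sq in \<open>simp_all add: periodic1_def\<close>)
  have "set_integrable lborel {0..1} (\<lambda>t. 1 + (norm (g t))\<^sup>2)"
    using sq by (intro set_integral_add) (auto simp: set_integrable_def)
  then have "set_integrable lborel {0..1} g"
  proof (rule set_integrable_bound)
    show "set_borel_measurable lborel {0..1} g" using m by (simp add: set_borel_measurable_def)
    have "norm x \<le> norm (1 + (norm x)\<^sup>2)" for x :: 'a
    proof -
      have "0 \<le> (norm x - 1/2)\<^sup>2" by simp
      then show ?thesis by (simp add: power2_eq_square algebra_simps)
    qed
    then show "AE x in lborel. x \<in> {0..1} \<longrightarrow> norm (g x) \<le> norm (1 + (norm (g x))\<^sup>2)" by simp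
  qed
  then show "loc_integrable g"
    using set_integrable_periodic[OF p] m by (simp add: loc_integrable_def)
qed

lemma L2_periodicI:
  "periodic1 g \<Longrightarrow> g \<in> borel_measurable borel \<Longrightarrow> set_integrable lborel {0..1} (\<lambda>t. (norm (g t))\<^sup>2) \<Longrightarrow> g \<in> L2_periodic"
  by (simp add: L2_periodic_def)

lemma L2_periodic_continuous: "periodic1 g \<Longrightarrow> continuous_on UNIV g \<Longrightarrow> g \<in> L2_periodic"
  by (intro L2_periodicI borel_measurable_continuous_onI borel_integrable_atLeastAtMost' continuous_on_power
      continuous_on_norm) (auto intro: continuous_on_subset)

text \<open>
  The intervals generate the Borel sets and are stable under intersection, so the integral
  over every bounded Borel set vanishes, and a density whose integrals all vanish is zero
  almost everywhere.
\<close>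

lemma AE_zero_of_Icc_integrals:
  assumes g: "loc_integrable g" and 0: "\<And>a b. a \<le> b \<Longrightarrow> (LINT x:{a..b}|lborel. g x) = 0"
  shows "AE x in lborel. g x = 0"
proof -
  have "AE x in lborel. indicator {- real n..real n} x *\<^sub>R g x = 0" for n
  proof (rule sigma_finite_measure.density_zero)
    let ?g = "\<lambda>x. indicator {- real n..real n} x *\<^sub>R g x"
    show int: "integrable lborel ?g" using loc_integrable_set[OF g] by (simp add: set_integrable_def)
    have si: "set_integrable lborel A ?g" if "A \<in> sets borel" for A
      unfolding set_integrable_def by (rule integrable_mult_indicator[OF _ int]) (use that in simp)
    fix A :: "real set" assume "A \<in> sets lborel"
    then have "A \<in> sets borel" by simp
    then show "set_lebesgue_integral lborel A ?g = 0"
    proof (induction A rule: borel_set_induct)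
      case (interval a b)
      have "set_lebesgue_integral lborel {a..b} ?g = (LINT x:{max a (- real n)..min b (real n)}|lborel. g x)"
        unfolding set_lebesgue_integral_def by (intro Bochner_Integration.integral_cong) (auto simp: indicator_def)
      also have "\<dots> = 0"
        using 0[of "max a (- real n)" "min b (real n)"] set_integral_Icc_trivial[of "min b (real n)" "max a (- real n)" g]
        by linarith
      finally show ?case .
    next
      case (compl A)
      have "set_lebesgue_integral lborel (A \<union> - A) ?g = set_lebesgue_integral lborel A ?g + set_lebesgue_integral lborel (- A) ?g"
        using compl.hyps by (intro set_integral_Un si) auto
      moreover have "set_lebesgue_integral lborel (A \<union> - A) ?g = (LINT x:{- real n..real n}|lborel. g x)"
        by (simp add: set_lebesgue_integral_def)
      ultimately show ?case using compl.IH 0[of "- real n" "real n"] by simp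
    next
      case (union F)
      have "set_lebesgue_integral lborel (\<Union>(range F)) ?g = (\<Sum>i. set_lebesgue_integral lborel (F i) ?g)"
        using union.hyps by (intro lebesgue_integral_countable_add si) (auto simp: disjoint_family_on_def)
      then show ?case using union.IH by simp
    qed simp
  qed (rule sigma_finite_lborel)
  then have "AE x in lborel. \<forall>n. indicator {- real n..real n} x *\<^sub>R g x = 0"
    unfolding AE_all_countable by (rule allI)
  then show ?thesis
  proof eventually_elim
    case (elim x)
    obtain n where "\<bar>x\<bar> \<le> real n" using real_arch_simple[of "\<bar>x\<bar>"] by auto
    then have "x \<in> {- real n..real n}" by auto
    then show ?case using spec[OF elim, of n] by simp
  qed
qed

lemma AE_eq_of_prim_eq:
  assumes "loc_integrable f" "loc_integrable g" "prim f = prim g"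
  shows "AE x in lborel. f x = g x"
proof -
  have "AE x in lborel. f x - g x = 0"
  proof (rule AE_zero_of_Icc_integrals[OF loc_integrable_diff[OF assms(1,2)]])
    fix a b :: real assume "a \<le> b"
    then show "(LINT x:{a..b}|lborel. f x - g x) = 0"
      using prim_diff[OF loc_integrable_diff[OF assms(1,2)], of a b] prim_minus[OF assms(1,2)] assms(3) by simp
  qed
  then show ?thesis by eventually_elim (rule eq_iff_diff_eq_0[THEN iffD2])
qed

section \<open>Integration by parts and weak derivatives\<close>

lemma borel_measurable_bilinear:
  fixes B :: "'a::euclidean_space \<Rightarrow> 'b::euclidean_space \<Rightarrow> 'c::euclidean_space"
  assumes "bounded_bilinear B" "f \<in> borel_measurable M" "g \<in> borel_measurable M"
  shows "(\<lambda>x. B (f x) (g x)) \<in> borel_measurable M"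
  using assms(2,3)
  by (rule borel_measurable_continuous_Pair)
     (intro bounded_bilinear.continuous_on[OF assms(1)] continuous_intros)

lemma integrable_bilinear_pair:
  fixes f :: "real \<Rightarrow> 'a::euclidean_space" and g :: "real \<Rightarrow> 'b::euclidean_space"
    and B :: "'a \<Rightarrow> 'b \<Rightarrow> 'c::euclidean_space"
  assumes B: "bounded_bilinear B" and f: "integrable lborel f" and g: "integrable lborel g"
    and A [measurable]: "A \<in> sets (borel \<Otimes>\<^sub>M borel)"
  shows "integrable (lborel \<Otimes>\<^sub>M lborel) (\<lambda>(x, y). indicator A (x, y) *\<^sub>R B (f x) (g y))"
proof -
  have [measurable]: "f \<in> borel_measurable borel" "g \<in> borel_measurable borel"
    using f g by (auto dest: borel_measurable_integrable)
  have "integrable (lborel \<Otimes>\<^sub>M lborel) (\<lambda>z. norm (f (fst z)) * norm (g (snd z)))"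
  proof (rule lborel_pair.Fubini_integrable)
    show "integrable lborel (\<lambda>x. LBINT y. norm (norm (f (fst (x, y))) * norm (g (snd (x, y)))))"
      using f by (simp add: abs_mult)
    show "AE x in lborel. integrable lborel (\<lambda>y. norm (f (fst (x, y))) * norm (g (snd (x, y))))"
      using g by simp
  qed measurable
  then have bnd: "integrable (lborel \<Otimes>\<^sub>M lborel) (\<lambda>z. (norm (f (fst z)) * norm (g (snd z))) * K)"
    for K :: real by (rule integrable_mult_left)
  obtain K where K: "0 \<le> K" "\<And>a b. norm (B a b) \<le> norm a * norm b * K"
    using bounded_bilinear.nonneg_bounded[OF B] by auto
  have [measurable]: "(\<lambda>z. B (f (fst z)) (g (snd z))) \<in> borel_measurable (borel \<Otimes>\<^sub>M borel)"
    by (intro borel_measurable_bilinear[OF B]) measurable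
  show ?thesis
    by (rule Bochner_Integration.integrable_bound[OF bnd[of K]])
       (auto simp: split_beta indicator_def abs_mult K)
qed

lemma integral_bilinear_right:
  fixes B :: "'a::euclidean_space \<Rightarrow> 'b::euclidean_space \<Rightarrow> 'c::euclidean_space"
  shows "bounded_bilinear B \<Longrightarrow> integrable M f \<Longrightarrow> (LINT x|M. B c (f x)) = B c (LINT x|M. f x)"
  by (intro integral_bounded_linear bounded_bilinear.bounded_linear_right)

lemma integral_bilinear_left:
  fixes B :: "'a::euclidean_space \<Rightarrow> 'b::euclidean_space \<Rightarrow> 'c::euclidean_space"
  shows "bounded_bilinear B \<Longrightarrow> integrable M f \<Longrightarrow> (LINT x|M. B (f x) c) = B (LINT x|M. f x) c"
  using integral_bounded_linear[OF bounded_bilinear.bounded_linear_left] .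

text \<open>
  Integration by parts for functions that are merely integrable. The integral of
  \<open>B (h x) (k y)\<close> over the square \<open>[0,T]\<^sup>2\<close> is \<open>B (prim h T) (prim k T)\<close>; Fubini on the
  two triangles into which the diagonal cuts the square turns the two parts into the two
  integrals on the left.
\<close>

lemma prim_bilinear:
  fixes B :: "'a::euclidean_space \<Rightarrow> 'b::euclidean_space \<Rightarrow> 'c::euclidean_space"
  assumes B: "bounded_bilinear B" and h: "loc_integrable h" and k: "loc_integrable k" and T: "0 \<le> T"
  shows "set_integrable lborel {0..T} (\<lambda>x. B (h x) (prim k x))"
    "set_integrable lborel {0..T} (\<lambda>x. B (prim h x) (k x))"
    "(LINT x:{0..T}|lborel. B (h x) (prim k x)) + (LINT x:{0..T}|lborel. B (prim h x) (k x))
      = B (prim h T) (prim k T)"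
proof -
  interpret B: bounded_bilinear B by fact
  let ?I = "indicator {0..T} :: real \<Rightarrow> real"
  define f g where "f x = ?I x *\<^sub>R h x" and "g x = ?I x *\<^sub>R k x" for x
  have f: "integrable lborel f" and g: "integrable lborel g"
    using loc_integrable_set[OF h] loc_integrable_set[OF k] by (simp_all add: f_def[abs_def] g_def[abs_def] set_integrable_def)
  \<comment> \<open>The triangle below the diagonal; the diagonal itself is a null set.\<close>
  define L where "L = {z :: real \<times> real. snd z \<le> fst z}"
  have L: "L \<in> sets (borel \<Otimes>\<^sub>M borel)" "- L \<in> sets (borel \<Otimes>\<^sub>M borel)"
  proof -
    have "closed L" unfolding L_def by (intro closed_Collect_le continuous_intros)
    then show "L \<in> sets (borel \<Otimes>\<^sub>M borel)" unfolding borel_prod by (rule borel_closed)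
    then show "- L \<in> sets (borel \<Otimes>\<^sub>M borel)" unfolding borel_prod by (rule borel_comp)
  qed
  let ?F = "\<lambda>x y. indicator L (x, y) *\<^sub>R B (f x) (g y)" and ?G = "\<lambda>x y. indicator (- L) (x, y) *\<^sub>R B (f x) (g y)"
  have F: "integrable (lborel \<Otimes>\<^sub>M lborel) (\<lambda>(x, y). ?F x y)" and G: "integrable (lborel \<Otimes>\<^sub>M lborel) (\<lambda>(x, y). ?G x y)"
    by (rule integrable_bilinear_pair[OF B f g] L)+
  have [measurable]: "f \<in> borel_measurable borel" "g \<in> borel_measurable borel"
    using f g by (auto dest: borel_measurable_integrable)
  note L [measurable]
  have gL: "integrable lborel (\<lambda>y. indicator L (x, y) *\<^sub>R g y)" for x
    by (rule Bochner_Integration.integrable_bound[OF g])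
       (auto simp: indicator_def)
  have fL: "integrable lborel (\<lambda>x. indicator (- L) (x, y) *\<^sub>R f x)" for y
    by (rule Bochner_Integration.integrable_bound[OF f])
       (auto simp: indicator_def)
  have 1: "(LBINT y. ?F x y) = ?I x *\<^sub>R B (h x) (prim k x)" for x
  proof -
    have "(LBINT y. ?F x y) = (LBINT y. B (f x) (indicator L (x, y) *\<^sub>R g y))"
      by (simp add: B.scaleR_right)
    also have "\<dots> = B (f x) (LBINT y. indicator L (x, y) *\<^sub>R g y)"
      by (rule integral_bilinear_right[OF B gL])
    finally have "(LBINT y. ?F x y) = \<dots>" .
    moreover have "(LBINT y. indicator L (x, y) *\<^sub>R g y) = (LBINT y:{0..x}. k y)" if "x \<in> {0..T}"
      unfolding set_lebesgue_integral_def using that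
      by (intro Bochner_Integration.integral_cong) (auto simp: g_def L_def indicator_def)
    then have "B (f x) (LBINT y. indicator L (x, y) *\<^sub>R g y) = ?I x *\<^sub>R B (h x) (prim k x)"
      using prim_diff[OF k, of 0 x] by (cases "x \<in> {0..T}") (auto simp: f_def B.zero_left)
    ultimately show ?thesis by simp
  qed
  have 2: "(LBINT x. ?G x y) = ?I y *\<^sub>R B (prim h y) (k y)" for y
  proof -
    have "(LBINT x. ?G x y) = (LBINT x. B (indicator (- L) (x, y) *\<^sub>R f x) (g y))"
      by (simp add: B.scaleR_left)
    also have "\<dots> = B (LBINT x. indicator (- L) (x, y) *\<^sub>R f x) (g y)"
      by (rule integral_bilinear_left[OF B fL])
    finally have "(LBINT x. ?G x y) = \<dots>" .
    moreover have "(LBINT x. indicator (- L) (x, y) *\<^sub>R f x) = (LBINT x:{0..y}. h x)" if "y \<in> {0..T}"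
      unfolding set_lebesgue_integral_def
    proof (rule integral_cong_AE)
      show "(\<lambda>x. indicator (- L) (x, y) *\<^sub>R f x) \<in> borel_measurable lborel"
        using fL by (rule borel_measurable_integrable)
      show "(\<lambda>x. indicator {0..y} x *\<^sub>R h x) \<in> borel_measurable lborel"
        using loc_integrable_set[OF h, of 0 y] unfolding set_integrable_def by (rule borel_measurable_integrable)
      show "AE x in lborel. indicator (- L) (x, y) *\<^sub>R f x = indicator {0..y} x *\<^sub>R h x"
        using AE_lborel_singleton[of y]
        by eventually_elim (use that in \<open>auto simp: f_def L_def indicator_def\<close>)
    qed
    then have "B (LBINT x. indicator (- L) (x, y) *\<^sub>R f x) (g y) = ?I y *\<^sub>R B (prim h y) (k y)"
      using prim_diff[OF h, of 0 y] by (cases "y \<in> {0..T}") (auto simp: g_def B.zero_right)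
    ultimately show ?thesis by simp
  qed
  show i1: "set_integrable lborel {0..T} (\<lambda>x. B (h x) (prim k x))"
    using lborel_pair.integrable_fst[OF F] by (simp add: 1 set_integrable_def)
  show i2: "set_integrable lborel {0..T} (\<lambda>x. B (prim h x) (k x))"
    using lborel_pair.integrable_snd[OF G] by (simp add: 2 set_integrable_def)
  have "(LINT x:{0..T}|lborel. B (h x) (prim k x)) + (LINT x:{0..T}|lborel. B (prim h x) (k x))
      = (LBINT x. LBINT y. ?F x y) + (LBINT y. LBINT x. ?G x y)"
    by (simp only: 1 2 set_lebesgue_integral_def)
  also have "(LBINT y. LBINT x. ?G x y) = (LBINT x. LBINT y. ?G x y)"
    by (rule lborel_pair.Fubini_integral[OF G])
  also have "(LBINT x. LBINT y. ?F x y) + (LBINT x. LBINT y. ?G x y) = (LBINT x. (LBINT y. ?F x y) + (LBINT y. ?G x y))"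
    by (rule Bochner_Integration.integral_add[symmetric, OF lborel_pair.integrable_fst[OF F] lborel_pair.integrable_fst[OF G]])
  also have "\<dots> = (LBINT x. B (f x) (LBINT y. g y))"
  proof (rule integral_cong_AE)
    show "AE x in lborel. (LBINT y. ?F x y) + (LBINT y. ?G x y) = B (f x) (LBINT y. g y)"
      using lborel_pair.AE_integrable_fst[OF F] lborel_pair.AE_integrable_fst[OF G]
    proof eventually_elim
      case (elim x)
      have "(LBINT y. ?F x y) + (LBINT y. ?G x y) = (LBINT y. ?F x y + ?G x y)"
        using elim by simp
      also have "\<dots> = (LBINT y. B (f x) (g y))"
        by (intro Bochner_Integration.integral_cong) (auto simp: indicator_def)
      also have "\<dots> = B (f x) (LBINT y. g y)" by (rule integral_bilinear_right[OF B g])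
      finally show ?case .
    qed
    show "(\<lambda>x. (LBINT y. ?F x y) + (LBINT y. ?G x y)) \<in> borel_measurable lborel"
      using lborel_pair.integrable_fst[OF F] lborel_pair.integrable_fst[OF G]
      by (intro borel_measurable_add borel_measurable_integrable)
    show "(\<lambda>x. B (f x) (LBINT y. g y)) \<in> borel_measurable lborel"
      using integrable_bounded_linear[OF B.bounded_linear_left f] by (rule borel_measurable_integrable)
  qed
  also have "\<dots> = B (LBINT x. f x) (LBINT y. g y)" by (rule integral_bilinear_left[OF B f])
  also have "(LBINT x. f x) = prim h T"
    using prim_diff[OF h T] by (simp add: f_def set_lebesgue_integral_def)
  also have "(LBINT y. g y) = prim k T"
    using prim_diff[OF k T] by (simp add: g_def set_lebesgue_integral_def)
  finally show "(LINT x:{0..T}|lborel. B (h x) (prim k x)) + (LINT x:{0..T}|lborel. B (prim h x) (k x))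
      = B (prim h T) (prim k T)" .
qed

text \<open>
  The case of scalar multiplication by the derivative of a test function. The boundary
  term vanishes because both primitives take the value \<open>0\<close> at \<open>1\<close>.
\<close>

lemma weak_product_rule:
  fixes g :: "real \<Rightarrow> 'b::euclidean_space" and \<psi> :: "real \<Rightarrow> real"
  assumes g: "loc_integrable g" and 0: "prim g 1 = 0"
    and \<psi>: "periodic1 \<psi>" "\<And>t. (\<psi> has_real_derivative \<psi>' t) (at t)" "continuous_on UNIV \<psi>'"
  shows "(LINT t:{0..1}|lborel. \<psi>' t *\<^sub>R prim g t) = - (LINT t:{0..1}|lborel. \<psi> t *\<^sub>R g t)"
proof -
  have p: "prim \<psi>' t = \<psi> t - \<psi> 0" for t
    using \<psi>(2,3) by (intro prim_of_derivative) (auto simp: has_real_derivative_iff_has_vector_derivative)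
  have "\<psi> 1 = \<psi> 0" using \<psi>(1) unfolding periodic1_def by (metis add_0)
  then have "prim \<psi>' 1 = 0" using p by simp
  have l: "loc_integrable \<psi>'" using \<psi>(3) by (rule loc_integrable_continuous)
  note pb = prim_bilinear[OF bounded_bilinear_scaleR l g, of 1]
  have "(LINT t:{0..1}|lborel. \<psi>' t *\<^sub>R prim g t) + (LINT t:{0..1}|lborel. prim \<psi>' t *\<^sub>R g t) = 0"
    using pb(3) \<open>prim \<psi>' 1 = 0\<close> by simp
  moreover have "(LINT t:{0..1}|lborel. prim \<psi>' t *\<^sub>R g t) = (LINT t:{0..1}|lborel. \<psi> t *\<^sub>R g t - \<psi> 0 *\<^sub>R g t)"
    by (simp add: p scaleR_diff_left)
  moreover have "\<dots> = (LINT t:{0..1}|lborel. \<psi> t *\<^sub>R g t) - (LINT t:{0..1}|lborel. \<psi> 0 *\<^sub>R g t)"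
  proof (rule set_integral_diff)
    have i0: "set_integrable lborel {0..1} (\<lambda>t. \<psi> 0 *\<^sub>R g t)" using loc_integrable_set[OF g] by simp
    then show "set_integrable lborel {0..1} (\<lambda>t. \<psi> 0 *\<^sub>R g t)" .
    have "set_integrable lborel {0..1} (\<lambda>t. prim \<psi>' t *\<^sub>R g t)" using pb(2) by simp
    from set_integral_add(1)[OF this i0] show "set_integrable lborel {0..1} (\<lambda>t. \<psi> t *\<^sub>R g t)"
      by (simp add: p scaleR_diff_left)
  qed
  ultimately show ?thesis using 0 by (simp add: prim_1 eq_neg_iff_add_eq_0)
qed

text \<open>
  Constants are test functions on the circle.
\<close>

lemma has_weak_derivative_mean_zero:
  assumes "has_weak_derivative f g" shows "prim g 1 = 0"
proof -
  have "(LINT t:{0..1}|lborel. (0::real) *\<^sub>R f t) = - (LINT t:{0..1}|lborel. (1::real) *\<^sub>R g t)"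
    using assms[unfolded has_weak_derivative_def, rule_format, of "\<lambda>_. 1" "\<lambda>_. 0"] by (simp add: periodic1_def)
  then show ?thesis by (simp add: prim_1 set_lebesgue_integral_def)
qed

lemma continuous_zero_of_square_integral:
  fixes u :: "real \<Rightarrow> real"
  assumes "continuous_on UNIV u" "(LINT t:{0..1}|lborel. u t * u t) = 0" "0 \<le> t" "t \<le> 1"
  shows "u t = 0"
proof -
  have c: "continuous_on {0..1} (\<lambda>t. u t * u t)"
    by (intro continuous_intros continuous_on_subset[OF assms(1)]) auto
  then have "integral {0..1} (\<lambda>t. u t * u t) = 0"
    using set_borel_integral_eq_integral(2)[OF borel_integrable_atLeastAtMost'[OF c]] assms(2) by simp
  then have "\<forall>x\<in>{0..1}. u x * u x = 0"
    using integral_eq_0_iff[OF c] by auto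
  then show ?thesis using assms(3,4) by auto
qed

text \<open>
  The difference \<open>u\<close> of \<open>f\<close> and the primitive of \<open>g\<close> is orthogonal to every derivative of
  a periodic function, that is, to every continuous periodic function of mean zero. A
  component of \<open>u\<close> minus its mean is such a function, and being orthogonal to it means
  that this function vanishes.
\<close>

lemma du_Bois_Reymond_continuous:
  fixes f :: "real \<Rightarrow> 'b::euclidean_space"
  assumes f: "continuous_on UNIV f" "periodic1 f" and g: "loc_integrable g" "periodic1 g"
    and w: "has_weak_derivative f g"
  shows "f t = f 0 + prim g t"
proof -
  have g1: "prim g 1 = 0" using w by (rule has_weak_derivative_mean_zero)
  define u where "u t = f t - prim g t" for t
  have cu: "continuous_on UNIV u"
    unfolding u_def by (intro continuous_intros f continuous_on_prim g)
  have pu: "periodic1 u"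
    using f(2) periodic1_prim[OF g g1] by (simp add: u_def periodic1_def)
  have weak: "(LINT t:{0..1}|lborel. \<psi>' t *\<^sub>R u t) = 0"
    if \<psi>: "periodic1 \<psi>" "\<And>t. (\<psi> has_real_derivative \<psi>' t) (at t)" "continuous_on UNIV \<psi>'" for \<psi> \<psi>' :: "real \<Rightarrow> real"
  proof -
    have "set_integrable lborel {0..1} (\<lambda>t. \<psi>' t *\<^sub>R h t)" if "continuous_on UNIV h" for h :: "real \<Rightarrow> 'b"
      using that \<psi>(3) by (intro borel_integrable_atLeastAtMost' continuous_on_scaleR) (auto intro: continuous_on_subset)
    then have "(LINT t:{0..1}|lborel. \<psi>' t *\<^sub>R u t) = (LINT t:{0..1}|lborel. \<psi>' t *\<^sub>R f t) - (LINT t:{0..1}|lborel. \<psi>' t *\<^sub>R prim g t)"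
      using f(1) continuous_on_prim[OF g(1)] by (simp add: u_def scaleR_diff_right set_integral_diff)
    also have "(LINT t:{0..1}|lborel. \<psi>' t *\<^sub>R f t) = (LINT t:{0..1}|lborel. \<psi>' t *\<^sub>R prim g t)"
      using w[unfolded has_weak_derivative_def, rule_format, of \<psi> \<psi>'] weak_product_rule[OF g(1) g1 \<psi>] \<psi> by simp
    finally show ?thesis by simp
  qed
  have "u t \<bullet> i = u 0 \<bullet> i" if "i \<in> Basis" for t i
  proof -
    define v where "v t = u t \<bullet> i" for t
    have cv: "continuous_on UNIV v" unfolding v_def by (intro continuous_intros cu)
    define m where "m = prim v 1"
    define \<theta> where "\<theta> t = v t - m" for t
    have c\<theta>: "continuous_on UNIV \<theta>" unfolding \<theta>_def by (intro continuous_intros cv)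
    have p\<theta>: "periodic1 \<theta>" using pu by (simp add: \<theta>_def v_def periodic1_def)
    have l: "loc_integrable v" "loc_integrable (\<lambda>_::real. m)" "loc_integrable \<theta>"
      using cv c\<theta> by (auto intro: loc_integrable_continuous)
    have z: "prim \<theta> 1 = 0" using prim_minus[OF l(1,2), of 1] by (simp add: \<theta>_def[abs_def] m_def prim_const)
    have "(prim \<theta> has_real_derivative \<theta> t) (at t)" for t
      using prim_has_vector_derivative[OF c\<theta>] by (simp add: has_real_derivative_iff_has_vector_derivative)
    \<comment> \<open>\<open>\<theta>\<close> is the derivative of the admissible test function \<open>prim \<theta>\<close>.\<close>
    then have "(LINT t:{0..1}|lborel. \<theta> t *\<^sub>R u t) = 0"
      by (rule weak[OF periodic1_prim[OF l(3) p\<theta> z] _ c\<theta>])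
    then have "0 = (LINT t|lborel. indicator {0..1} t *\<^sub>R \<theta> t *\<^sub>R u t) \<bullet> i"
      by (simp add: set_lebesgue_integral_def)
    also have "\<dots> = (LINT t|lborel. (indicator {0..1} t *\<^sub>R \<theta> t *\<^sub>R u t) \<bullet> i)"
    proof (rule integral_inner_left[symmetric])
      have "set_integrable lborel {0..1} (\<lambda>t. \<theta> t *\<^sub>R u t)"
        by (intro borel_integrable_atLeastAtMost' continuous_on_scaleR continuous_on_subset[OF c\<theta>] continuous_on_subset[OF cu]) auto
      then show "integrable lborel (\<lambda>t. indicator {0..1} t *\<^sub>R \<theta> t *\<^sub>R u t)"
        unfolding set_integrable_def .
    qed
    finally have "(LINT t:{0..1}|lborel. \<theta> t * v t) = 0"
      by (simp add: set_lebesgue_integral_def v_def mult.assoc)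
    moreover have "(LINT t:{0..1}|lborel. m * \<theta> t) = 0" using z by (simp add: prim_1)
    moreover have "(LINT t:{0..1}|lborel. \<theta> t * \<theta> t) = (LINT t:{0..1}|lborel. \<theta> t * v t) - (LINT t:{0..1}|lborel. m * \<theta> t)"
    proof (subst set_integral_diff(2)[symmetric])
      show "set_integrable lborel {0..1} (\<lambda>t. \<theta> t * v t)" "set_integrable lborel {0..1} (\<lambda>t. m * \<theta> t)"
        by (intro borel_integrable_atLeastAtMost' continuous_intros continuous_on_subset[OF c\<theta>] continuous_on_subset[OF cv]; simp)+
    qed (simp add: \<theta>_def algebra_simps)
    ultimately have "\<theta> t = 0" if "0 \<le> t" "t \<le> 1" for t
      using continuous_zero_of_square_integral[OF c\<theta> _ that] by simp
    then have z: "\<theta> t = 0" for t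
      using periodic1_eqI[OF p\<theta>, of "\<lambda>_. 0"] by (simp add: periodic1_def)
    show ?thesis using z[of t] z[of 0] by (simp add: \<theta>_def v_def)
  qed
  then have "u t = u 0" by (rule euclidean_eqI)
  then show ?thesis by (simp add: u_def algebra_simps)
qed

text \<open>
  A continuous factor is bounded on \<open>[0,1]\<close>.
\<close>

lemma set_integrable_scaleR_continuous:
  fixes \<theta> :: "real \<Rightarrow> real" and h :: "real \<Rightarrow> 'b::euclidean_space"
  assumes c: "continuous_on UNIV \<theta>" and l: "loc_integrable h"
  shows "set_integrable lborel {0..1} (\<lambda>t. \<theta> t *\<^sub>R h t)"
proof -
  have "bounded (\<theta> ` {0..1})"
    by (rule compact_imp_bounded[OF compact_continuous_image[OF continuous_on_subset[OF c]]]) auto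
  then obtain K where K: "\<forall>x\<in>{0..1}. norm (\<theta> x) \<le> K" unfolding bounded_iff by blast
  have "set_integrable lborel {0..1} (\<lambda>t. K *\<^sub>R h t)" using loc_integrable_set[OF l] by simp
  then show ?thesis
  proof (rule set_integrable_bound)
    show "set_borel_measurable lborel {0..1} (\<lambda>t. \<theta> t *\<^sub>R h t)"
      using borel_measurable_continuous_onI[OF c] loc_integrable_measurable[OF l]
      by (simp add: set_borel_measurable_def)
    show "AE x in lborel. x \<in> {0..1} \<longrightarrow> norm (\<theta> x *\<^sub>R h x) \<le> norm (K *\<^sub>R h x)"
      using K by (intro AE_I2 impI) (auto intro!: mult_right_mono intro: order_trans[OF _ abs_ge_self])
  qed
qed

text \<open>
  Without continuity, \<open>f - prim g\<close> cannot be used as a test function. After subtraction of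
  its mean, its primitive is continuous and has weak derivative \<open>0\<close>, so that the
  continuous case shows that this primitive is constant.
\<close>

lemma du_Bois_Reymond:
  fixes f :: "real \<Rightarrow> 'b::euclidean_space"
  assumes f: "loc_integrable f" "periodic1 f" and g: "loc_integrable g" "periodic1 g"
    and w: "has_weak_derivative f g"
  obtains c where "AE x in lborel. f x = c + prim g x"
proof -
  have g1: "prim g 1 = 0" using w by (rule has_weak_derivative_mean_zero)
  have lg: "loc_integrable (prim g)" by (intro loc_integrable_continuous continuous_on_prim g)
  define u where "u t = f t - prim g t" for t
  have lu: "loc_integrable u" unfolding u_def by (intro loc_integrable_diff f lg)
  have pu: "periodic1 u" using f(2) periodic1_prim[OF g g1] by (simp add: u_def periodic1_def)
  define c where "c = prim u 1"
  define y where "y t = u t - c" for t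
  have lc: "loc_integrable (\<lambda>_::real. c)" by (intro loc_integrable_continuous) auto
  have ly: "loc_integrable y" unfolding y_def by (intro loc_integrable_diff lu lc)
  have py: "periodic1 y" using pu by (simp add: y_def periodic1_def)
  have y1: "prim y 1 = 0" using prim_minus[OF lu lc, of 1] by (simp add: y_def[abs_def] c_def prim_const)
  note int = set_integrable_scaleR_continuous
  have weak: "(LINT t:{0..1}|lborel. \<theta> t *\<^sub>R u t) = 0"
    if \<theta>: "continuous_on UNIV \<theta>" "periodic1 \<theta>" "prim \<theta> 1 = 0" for \<theta> :: "real \<Rightarrow> real"
  proof -
    have l: "loc_integrable \<theta>" using \<theta>(1) by (rule loc_integrable_continuous)
    have \<psi>: "periodic1 (prim \<theta>)" "\<And>t. (prim \<theta> has_real_derivative \<theta> t) (at t)"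
      using periodic1_prim[OF l \<theta>(2,3)] prim_has_vector_derivative[OF \<theta>(1)]
      by (auto simp: has_real_derivative_iff_has_vector_derivative)
    have "(LINT t:{0..1}|lborel. \<theta> t *\<^sub>R u t) = (LINT t:{0..1}|lborel. \<theta> t *\<^sub>R f t) - (LINT t:{0..1}|lborel. \<theta> t *\<^sub>R prim g t)"
      using int[OF \<theta>(1) f(1)] int[OF \<theta>(1) lg] by (simp add: u_def scaleR_diff_right set_integral_diff)
    then show ?thesis
      using w[unfolded has_weak_derivative_def, rule_format, of "prim \<theta>" \<theta>] weak_product_rule[OF g(1) g1 \<psi> \<theta>(1)] \<psi> \<theta>(1) by simp
  qed
  have "has_weak_derivative (prim y) (\<lambda>_. 0)"
    unfolding has_weak_derivative_def
  proof (intro allI impI)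
    fix \<psi> \<psi>' :: "real \<Rightarrow> real"
    assume "periodic1 \<psi> \<and> (\<forall>t. (\<psi> has_real_derivative \<psi>' t) (at t)) \<and> continuous_on UNIV \<psi>'"
    then have \<psi>: "periodic1 \<psi>" "\<And>t. (\<psi> has_real_derivative \<psi>' t) (at t)" "continuous_on UNIV \<psi>'" by auto
    have c\<psi>: "continuous_on UNIV \<psi>"
      using \<psi>(2) by (meson DERIV_isCont continuous_at_imp_continuous_on)
    have l: "loc_integrable \<psi>" "loc_integrable (\<lambda>_::real. m)" for m :: real
      using c\<psi> by (auto intro: loc_integrable_continuous)
    define \<theta> where "\<theta> t = \<psi> t - prim \<psi> 1" for t
    have c\<theta>: "continuous_on UNIV \<theta>" unfolding \<theta>_def by (intro continuous_intros c\<psi>)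
    have p\<theta>: "periodic1 \<theta>" using \<psi>(1) by (simp add: \<theta>_def periodic1_def)
    have z: "prim \<theta> 1 = 0" using prim_minus[OF l(1) l(2)[of "prim \<psi> 1"], of 1] by (simp add: \<theta>_def[abs_def] prim_const)
    have "(LINT t:{0..1}|lborel. \<theta> t *\<^sub>R c) = (LINT t|lborel. (indicator {0..1} t *\<^sub>R \<theta> t) *\<^sub>R c)"
      by (simp add: set_lebesgue_integral_def)
    also have "\<dots> = (LINT t:{0..1}|lborel. \<theta> t) *\<^sub>R c"
      unfolding set_lebesgue_integral_def
      by (rule integral_scaleR_left)
         (use loc_integrable_set[OF loc_integrable_continuous[OF c\<theta>], of 0 1] in \<open>simp add: set_integrable_def\<close>)
    finally have "(LINT t:{0..1}|lborel. \<theta> t *\<^sub>R c) = (LINT t:{0..1}|lborel. \<theta> t) *\<^sub>R c" .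
    then have "(LINT t:{0..1}|lborel. \<theta> t *\<^sub>R c) = 0" using z by (simp add: prim_1)
    moreover have "(LINT t:{0..1}|lborel. \<theta> t *\<^sub>R y t) = (LINT t:{0..1}|lborel. \<theta> t *\<^sub>R u t) - (LINT t:{0..1}|lborel. \<theta> t *\<^sub>R c)"
      using int[OF c\<theta> lu] int[OF c\<theta> lc] by (simp add: y_def scaleR_diff_right set_integral_diff)
    moreover have "(LINT t:{0..1}|lborel. \<psi> t *\<^sub>R y t) = (LINT t:{0..1}|lborel. \<theta> t *\<^sub>R y t + prim \<psi> 1 *\<^sub>R y t)"
      by (simp add: \<theta>_def flip: scaleR_add_left)
    moreover have "\<dots> = (LINT t:{0..1}|lborel. \<theta> t *\<^sub>R y t) + (LINT t:{0..1}|lborel. prim \<psi> 1 *\<^sub>R y t)"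
      using int[OF c\<theta> ly] loc_integrable_set[OF ly] by (intro set_integral_add) auto
    moreover have "(LINT t:{0..1}|lborel. prim \<psi> 1 *\<^sub>R y t) = 0" using y1 by (simp add: prim_1)
    ultimately have "(LINT t:{0..1}|lborel. \<psi> t *\<^sub>R y t) = 0"
      using weak[OF c\<theta> p\<theta> z] by simp
    then show "(LINT t:{0..1}|lborel. \<psi>' t *\<^sub>R prim y t) = - (LINT t:{0..1}|lborel. \<psi> t *\<^sub>R 0)"
      using weak_product_rule[OF ly y1 \<psi>] by (simp add: set_lebesgue_integral_def)
  qed
  then have "prim y t = prim y 0 + prim (\<lambda>_. 0) t" for t
    by (intro du_Bois_Reymond_continuous continuous_on_prim ly periodic1_prim py y1 loc_integrable_continuous)
       (auto simp: periodic1_def)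
  then have "prim y = prim (\<lambda>_. 0)" by auto
  then have "AE x in lborel. y x = 0"
    by (intro AE_eq_of_prim_eq ly loc_integrable_continuous) auto
  then have "AE x in lborel. f x = c + prim g x"
    by eventually_elim (simp add: y_def u_def algebra_simps)
  then show ?thesis by (rule that)
qed

section \<open>The embedding into continuously differentiable functions\<close>

text \<open>
  The part of the window that leaves \<open>[0,1]\<close> is shifted back by one period and does not
  overlap the rest.
\<close>

lemma nn_integral_window_le_period:
  fixes F :: "real \<Rightarrow> ennreal"
  assumes F: "periodic1 F" and [measurable]: "F \<in> borel_measurable borel"
    and u: "0 \<le> u" "u < 1" and r: "r < 1"
  shows "(\<integral>\<^sup>+x\<in>{u..u + r}. F x \<partial>lborel) \<le> (\<integral>\<^sup>+x\<in>{0..1}. F x \<partial>lborel)"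
proof -
  have "(\<integral>\<^sup>+x\<in>{u..u + r}. F x \<partial>lborel) \<le> (\<integral>\<^sup>+x. F x * indicator {u..1} x + F x * indicator {1<..<u + 1} x \<partial>lborel)"
    using r by (intro nn_integral_mono) (auto simp: indicator_def)
  also have "\<dots> = (\<integral>\<^sup>+x. F x * indicator {u..1} x \<partial>lborel) + (\<integral>\<^sup>+x. F x * indicator {1<..<u + 1} x \<partial>lborel)"
    by (intro nn_integral_add) auto
  also have "(\<integral>\<^sup>+x. F x * indicator {1<..<u + 1} x \<partial>lborel)
      = (\<integral>\<^sup>+x. F (1 + x) * indicator {1<..<u + 1} (1 + x) \<partial>lborel)"
    using nn_integral_real_affine[of "\<lambda>x. F x * indicator {1<..<u + 1} x" 1 1] by simp
  also have "\<dots> = (\<integral>\<^sup>+x. F x * indicator {0<..<u} x \<partial>lborel)"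
    using F by (intro nn_integral_cong) (auto simp: periodic1_def add.commute indicator_def)
  also have "(\<integral>\<^sup>+x. F x * indicator {u..1} x \<partial>lborel) + \<dots>
      = (\<integral>\<^sup>+x. F x * indicator {u..1} x + F x * indicator {0<..<u} x \<partial>lborel)"
    by (intro nn_integral_add[symmetric]) auto
  also have "\<dots> \<le> (\<integral>\<^sup>+x\<in>{0..1}. F x \<partial>lborel)"
    using u by (intro nn_integral_mono) (auto simp: indicator_def)
  finally show ?thesis .
qed

lemma nn_integral_const_Icc:
  "0 \<le> c \<Longrightarrow> a \<le> b \<Longrightarrow> (\<integral>\<^sup>+x. ennreal c * indicator {a..b} x \<partial>lborel) = ennreal (c * (b - a))"
  by (subst nn_integral_cmult_indicator) (auto simp: ennreal_mult)

lemma norm_average_le: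
  fixes h :: "real \<Rightarrow> 'b::euclidean_space"
  assumes h: "loc_integrable h" and ab: "a < b"
  shows "ennreal (norm ((1 / (b - a)) *\<^sub>R (LINT x:{a..b}|lborel. h x) - c))
    \<le> ennreal (1 / (b - a)) * (\<integral>\<^sup>+x\<in>{a..b}. ennreal (norm (h x - c)) \<partial>lborel)"
proof -
  have lc: "loc_integrable (\<lambda>_::real. c)" by (intro loc_integrable_continuous) auto
  have int: "set_integrable lborel {a..b} (\<lambda>x. h x - c)"
    using loc_integrable_set[OF loc_integrable_diff[OF h lc]] .
  have "(LINT x:{a..b}|lborel. h x - c) = (LINT x:{a..b}|lborel. h x) - (b - a) *\<^sub>R c"
    using set_integral_diff(2)[OF loc_integrable_set[OF h] loc_integrable_set[OF lc]]
      prim_diff[OF lc, of a b] ab by (simp add: prim_const scaleR_diff_left)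
  then have "(1 / (b - a)) *\<^sub>R (LINT x:{a..b}|lborel. h x) - c = (1 / (b - a)) *\<^sub>R (LINT x:{a..b}|lborel. h x - c)"
    using ab by (simp add: scaleR_diff_right)
  then have "ennreal (norm ((1 / (b - a)) *\<^sub>R (LINT x:{a..b}|lborel. h x) - c))
      = ennreal (1 / (b - a)) * ennreal (norm (LINT x:{a..b}|lborel. h x - c))"
    using ab by (subst ennreal_mult'[symmetric]) auto
  also have "ennreal (norm (LINT x:{a..b}|lborel. h x - c)) \<le> (\<integral>\<^sup>+x\<in>{a..b}. ennreal (norm (h x - c)) \<partial>lborel)"
  proof -
    have "ennreal (norm (LINT x|lborel. indicator {a..b} x *\<^sub>R (h x - c)))
        \<le> (\<integral>\<^sup>+x. ennreal (norm (indicator {a..b} x *\<^sub>R (h x - c))) \<partial>lborel)"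
      using int unfolding set_integrable_def by (rule integral_norm_bound_ennreal)
    also have "\<dots> = (\<integral>\<^sup>+x\<in>{a..b}. ennreal (norm (h x - c)) \<partial>lborel)"
      by (intro nn_integral_cong) (auto simp: indicator_def)
    finally show ?thesis by (simp add: set_lebesgue_integral_def)
  qed
  finally show ?thesis by (simp add: mult_left_mono)
qed

definition gagliardo_density :: "real \<Rightarrow> (real \<Rightarrow> 'b::euclidean_space) \<Rightarrow> real \<Rightarrow> ennreal" where
  "gagliardo_density s f u =
     (\<integral>\<^sup>+w\<in>{-1/2..1/2}. ennreal ((norm (f (u + w) - f u))\<^sup>2 / \<bar>w\<bar> powr (1 + 2 * s)) \<partial>lborel)"

lemma gagliardo_sq_density: "gagliardo_sq s f = (\<integral>\<^sup>+u\<in>{0..1}. gagliardo_density s f u \<partial>lborel)"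
  by (simp add: gagliardo_sq_def gagliardo_density_def)

lemma gagliardo_density_measurable [measurable]:
  assumes [measurable]: "f \<in> borel_measurable borel"
  shows "gagliardo_density s f \<in> borel_measurable borel"
  unfolding gagliardo_density_def[abs_def] by measurable

lemma periodic1_gagliardo_density: "periodic1 f \<Longrightarrow> periodic1 (gagliardo_density s f)"
proof -
  assume f: "periodic1 f"
  have "f (t + 1 + w) = f (t + w)" for t w
    using f[unfolded periodic1_def, rule_format, of "t + w"] by (simp add: add_ac)
  then show ?thesis using f by (simp add: periodic1_def gagliardo_density_def)
qed

text \<open>
  For \<open>\<bar>w\<bar> \<le> r\<close>, the inequality between arithmetic and geometric means bounds
  \<open>\<bar>f (a + w) - f a\<bar>\<close> by the integrand of the seminorm, divided by \<open>2 \<mu>\<close>, plus \<open>\<mu>/2\<close> times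
  the weight \<open>\<bar>w\<bar> powr (1 + 2 s)\<close>, and the weight is at most \<open>r powr (1 + 2 s)\<close>. The
  parameter \<open>\<mu>\<close> takes the place of the Cauchy-Schwarz inequality.
\<close>

lemma gagliardo_window_pair:
  fixes f :: "real \<Rightarrow> 'b::euclidean_space"
  assumes f [measurable]: "f \<in> borel_measurable borel" and p: "periodic1 f" and s: "0 \<le> s"
    and u: "0 \<le> u" "u < 1" and r: "0 < r" "r \<le> 1/2" "0 < r'" "r' \<le> r" and \<mu>: "0 < \<mu>"
  shows "(\<integral>\<^sup>+a\<in>{u..u + r}. (\<integral>\<^sup>+b\<in>{u..u + r'}. ennreal (norm (f b - f a)) \<partial>lborel) \<partial>lborel)
    \<le> ennreal (1 / (2 * \<mu>)) * gagliardo_sq s f + ennreal (\<mu> / 2 * r powr (1 + 2 * s) * r' * r)"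
proof -
  let ?p = "1 + 2 * s"
  have am_gm: "x \<le> 1 / (2 * \<mu>) * (x\<^sup>2 / \<bar>w\<bar> powr ?p) + \<mu> / 2 * r powr ?p"
    if "0 \<le> x" "w \<noteq> 0" "\<bar>w\<bar> \<le> r" for x w :: real
  proof -
    define P where "P = \<bar>w\<bar> powr ?p"
    have P: "0 < P" "P \<le> r powr ?p" using that s by (auto simp: P_def intro: powr_mono2)
    have "0 \<le> (x - \<mu> * P)\<^sup>2" by simp
    then have "2 * x * (\<mu> * P) \<le> x\<^sup>2 + (\<mu> * P)\<^sup>2" by (simp add: power2_diff)
    then have "x \<le> (x\<^sup>2 + (\<mu> * P)\<^sup>2) / (2 * (\<mu> * P))"
      using P \<mu> by (simp add: pos_le_divide_eq mult_ac)
    also have "\<dots> = 1 / (2 * \<mu>) * (x\<^sup>2 / P) + \<mu> / 2 * P"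
      using P \<mu> by (simp add: field_simps power2_eq_square)
    also have "\<dots> \<le> 1 / (2 * \<mu>) * (x\<^sup>2 / P) + \<mu> / 2 * r powr ?p"
      using P \<mu> by (intro add_left_mono mult_left_mono) auto
    finally show ?thesis by (simp add: P_def)
  qed
  have inner: "(\<integral>\<^sup>+b\<in>{u..u + r'}. ennreal (norm (f b - f a)) \<partial>lborel)
      \<le> ennreal (1 / (2 * \<mu>)) * gagliardo_density s f a + ennreal (\<mu> / 2 * r powr ?p * r')"
    if a: "a \<in> {u..u + r}" for a
  proof -
    have "(\<integral>\<^sup>+b\<in>{u..u + r'}. ennreal (norm (f b - f a)) \<partial>lborel)
        = (\<integral>\<^sup>+w. ennreal (norm (f (a + w) - f a)) * indicator {u..u + r'} (a + w) \<partial>lborel)"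
      using nn_integral_real_affine[of "\<lambda>b. ennreal (norm (f b - f a)) * indicator {u..u + r'} b" 1 a] by simp
    also have "\<dots> \<le> (\<integral>\<^sup>+w. ennreal (1 / (2 * \<mu>)) * (ennreal ((norm (f (a + w) - f a))\<^sup>2 / \<bar>w\<bar> powr ?p) * indicator {-1/2..1/2} w)
        + ennreal (\<mu> / 2 * r powr ?p) * indicator {u..u + r'} (a + w) \<partial>lborel)"
    proof (rule nn_integral_mono)
      fix w
      show "ennreal (norm (f (a + w) - f a)) * indicator {u..u + r'} (a + w)
        \<le> ennreal (1 / (2 * \<mu>)) * (ennreal ((norm (f (a + w) - f a))\<^sup>2 / \<bar>w\<bar> powr ?p) * indicator {-1/2..1/2} w)
          + ennreal (\<mu> / 2 * r powr ?p) * indicator {u..u + r'} (a + w)"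
      \<comment> \<open>At \<open>w = 0\<close> the left-hand side is \<open>0\<close>.\<close>
      proof (cases "a + w \<in> {u..u + r'} \<and> w \<noteq> 0")
        case True
        then have w: "\<bar>w\<bar> \<le> r" "w \<in> {-1/2..1/2}" using a r by auto
        have "ennreal (norm (f (a + w) - f a))
            \<le> ennreal (1 / (2 * \<mu>) * ((norm (f (a + w) - f a))\<^sup>2 / \<bar>w\<bar> powr ?p) + \<mu> / 2 * r powr ?p)"
          using am_gm[of "norm (f (a + w) - f a)" w] True w by (intro ennreal_leI) auto
        also have "\<dots> = ennreal (1 / (2 * \<mu>)) * ennreal ((norm (f (a + w) - f a))\<^sup>2 / \<bar>w\<bar> powr ?p) + ennreal (\<mu> / 2 * r powr ?p)"
          using \<mu> by (subst ennreal_plus) (auto simp: ennreal_mult'[symmetric])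
        finally show ?thesis using True w by simp
      next
        case False
        then show ?thesis by (cases "w = 0") auto
      qed
    qed
    also have "\<dots> = (\<integral>\<^sup>+w. ennreal (1 / (2 * \<mu>)) * (ennreal ((norm (f (a + w) - f a))\<^sup>2 / \<bar>w\<bar> powr ?p) * indicator {-1/2..1/2} w) \<partial>lborel)
        + (\<integral>\<^sup>+w. ennreal (\<mu> / 2 * r powr ?p) * indicator {u..u + r'} (a + w) \<partial>lborel)"
      by (rule nn_integral_add) measurable
    also have "(\<integral>\<^sup>+w. ennreal (1 / (2 * \<mu>)) * (ennreal ((norm (f (a + w) - f a))\<^sup>2 / \<bar>w\<bar> powr ?p) * indicator {-1/2..1/2} w) \<partial>lborel)
        = ennreal (1 / (2 * \<mu>)) * gagliardo_density s f a"
      unfolding gagliardo_density_def by (rule nn_integral_cmult) measurable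
    also have "(\<integral>\<^sup>+w. ennreal (\<mu> / 2 * r powr ?p) * indicator {u..u + r'} (a + w) \<partial>lborel)
        = (\<integral>\<^sup>+w. ennreal (\<mu> / 2 * r powr ?p) * indicator {u..u + r'} w \<partial>lborel)"
      using nn_integral_real_affine[of "\<lambda>w. ennreal (\<mu> / 2 * r powr ?p) * indicator {u..u + r'} w" 1 a] by simp
    also have "\<dots> = ennreal (\<mu> / 2 * r powr ?p * r')"
      using nn_integral_const_Icc[of "\<mu> / 2 * r powr ?p" u "u + r'"] r \<mu> by simp
    finally show ?thesis .
  qed
  have "(\<integral>\<^sup>+a\<in>{u..u + r}. (\<integral>\<^sup>+b\<in>{u..u + r'}. ennreal (norm (f b - f a)) \<partial>lborel) \<partial>lborel)
      \<le> (\<integral>\<^sup>+a. ennreal (1 / (2 * \<mu>)) * (gagliardo_density s f a * indicator {u..u + r} a)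
          + ennreal (\<mu> / 2 * r powr ?p * r') * indicator {u..u + r} a \<partial>lborel)"
  proof (rule nn_integral_mono)
    fix a
    show "(\<integral>\<^sup>+b\<in>{u..u + r'}. ennreal (norm (f b - f a)) \<partial>lborel) * indicator {u..u + r} a
      \<le> ennreal (1 / (2 * \<mu>)) * (gagliardo_density s f a * indicator {u..u + r} a)
          + ennreal (\<mu> / 2 * r powr ?p * r') * indicator {u..u + r} a"
      using inner[of a] by (cases "a \<in> {u..u + r}") auto
  qed
  also have "\<dots> = (\<integral>\<^sup>+a. ennreal (1 / (2 * \<mu>)) * (gagliardo_density s f a * indicator {u..u + r} a) \<partial>lborel)
      + (\<integral>\<^sup>+a. ennreal (\<mu> / 2 * r powr ?p * r') * indicator {u..u + r} a \<partial>lborel)"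
    by (rule nn_integral_add) measurable
  also have "(\<integral>\<^sup>+a. ennreal (1 / (2 * \<mu>)) * (gagliardo_density s f a * indicator {u..u + r} a) \<partial>lborel)
      = ennreal (1 / (2 * \<mu>)) * (\<integral>\<^sup>+a\<in>{u..u + r}. gagliardo_density s f a \<partial>lborel)"
    by (rule nn_integral_cmult) measurable
  also have "\<dots> \<le> ennreal (1 / (2 * \<mu>)) * gagliardo_sq s f"
    unfolding gagliardo_sq_density
    using periodic1_gagliardo_density[OF p] u r by (intro mult_left_mono nn_integral_window_le_period) auto
  also have "(\<integral>\<^sup>+a. ennreal (\<mu> / 2 * r powr ?p * r') * indicator {u..u + r} a \<partial>lborel)
      = ennreal (\<mu> / 2 * r powr ?p * r' * r)"
    using nn_integral_const_Icc[of "\<mu> / 2 * r powr ?p * r'" u "u + r"] r \<mu> by simp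
  finally show ?thesis by (simp add: add_right_mono)
qed

lemma ennreal_nested_lincomb:
  "0 \<le> a \<Longrightarrow> 0 \<le> b \<Longrightarrow> 0 \<le> c \<Longrightarrow> 0 \<le> g \<Longrightarrow> 0 \<le> d \<Longrightarrow>
    ennreal a * (ennreal b * (ennreal c * ennreal g + ennreal d)) = ennreal (a * (b * (c * g + d)))"
  by (simp add: ennreal_mult)

text \<open>
  The difference of two averages is at most the average of the differences over pairs of
  points of the window. The normalization by \<open>1/(r r')\<close> costs \<open>r powr (-2)\<close>, and \<open>\<mu>\<close> is
  chosen such that the two terms of the previous bound both become \<open>r powr (s - 1/2)\<close>. For
  \<open>s > 1/2\<close> this decays geometrically under repeated halving.
\<close>

lemma average_halving:
  fixes f :: "real \<Rightarrow> 'b::euclidean_space"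
  assumes f: "loc_integrable f" and p: "periodic1 f" and s: "0 \<le> s"
    and fin: "gagliardo_sq s f < \<infinity>" and u: "0 \<le> u" "u < 1" and r: "0 < r" "r \<le> 1/2"
  shows "norm ((1 / r) *\<^sub>R (LINT x:{u..u + r}|lborel. f x) - (1 / (r / 2)) *\<^sub>R (LINT x:{u..u + r / 2}|lborel. f x))
    \<le> (enn2real (gagliardo_sq s f) + 1) * r powr (s - 1/2)"
proof -
  note [measurable] = loc_integrable_measurable[OF f]
  define G where "G = enn2real (gagliardo_sq s f)"
  have G: "gagliardo_sq s f = ennreal G" "0 \<le> G" using fin by (auto simp: G_def less_top)
  define \<mu> where "\<mu> = r powr (- (3/2 + s))"
  have \<mu>: "0 < \<mu>" using r by (simp add: \<mu>_def)
  have "\<mu> * r\<^sup>2 = r powr (- (s - 1/2))"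
    unfolding \<mu>_def powr_numeral[OF less_imp_le[OF r(1)], symmetric] powr_add[symmetric] by simp
  then have scale: "1 / (\<mu> * r\<^sup>2) = r powr (s - 1/2)"
    by (simp only: powr_minus divide_inverse inverse_inverse_eq mult_1)
  let ?q = "(1 / (r / 2)) *\<^sub>R (LINT x:{u..u + r / 2}|lborel. f x)"
  have "ennreal (norm ((1 / r) *\<^sub>R (LINT x:{u..u + r}|lborel. f x) - ?q))
      \<le> ennreal (1 / r) * (\<integral>\<^sup>+a\<in>{u..u + r}. ennreal (norm (f a - ?q)) \<partial>lborel)"
    using norm_average_le[OF f, of u "u + r" ?q] r by simp
  also have "\<dots> \<le> ennreal (1 / r) * (\<integral>\<^sup>+a\<in>{u..u + r}. ennreal (1 / (r / 2)) *
      (\<integral>\<^sup>+b\<in>{u..u + r / 2}. ennreal (norm (f b - f a)) \<partial>lborel) \<partial>lborel)"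
  proof (intro mult_left_mono nn_integral_mono mult_right_mono)
    fix a
    show "ennreal (norm (f a - ?q)) \<le> ennreal (1 / (r / 2)) * (\<integral>\<^sup>+b\<in>{u..u + r / 2}. ennreal (norm (f b - f a)) \<partial>lborel)"
      using norm_average_le[OF f, of u "u + r / 2" "f a"] r by (simp add: norm_minus_commute)
  qed auto
  also have "\<dots> = ennreal (1 / r) * (ennreal (1 / (r / 2)) * (\<integral>\<^sup>+a\<in>{u..u + r}.
      (\<integral>\<^sup>+b\<in>{u..u + r / 2}. ennreal (norm (f b - f a)) \<partial>lborel) \<partial>lborel))"
    by (subst nn_integral_cmult[symmetric]) (auto simp: mult.assoc)
  also have "\<dots> \<le> ennreal (1 / r) * (ennreal (1 / (r / 2)) *
      (ennreal (1 / (2 * \<mu>)) * gagliardo_sq s f + ennreal (\<mu> / 2 * r powr (1 + 2 * s) * (r / 2) * r)))"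
    using r s u \<mu> p by (intro mult_left_mono gagliardo_window_pair) auto
  also have "\<dots> = ennreal (1 / r * (1 / (r / 2) * (1 / (2 * \<mu>) * G + \<mu> / 2 * r powr (1 + 2 * s) * (r / 2) * r)))"
    unfolding G(1) by (rule ennreal_nested_lincomb) (use r \<mu> G(2) in auto)
  also have "1 / r * (1 / (r / 2) * (1 / (2 * \<mu>) * G + \<mu> / 2 * r powr (1 + 2 * s) * (r / 2) * r))
      = G * (1 / (\<mu> * r\<^sup>2)) + 1/2 * (\<mu> * r powr (1 + 2 * s))"
    using r \<mu> by (simp add: field_simps power2_eq_square)
  also have "1 / (\<mu> * r\<^sup>2) = r powr (s - 1/2)" by (rule scale)
  also have "\<mu> * r powr (1 + 2 * s) = r powr (s - 1/2)"
    unfolding \<mu>_def by (simp flip: powr_add)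
  finally have "norm ((1 / r) *\<^sub>R (LINT x:{u..u + r}|lborel. f x) - ?q) \<le> G * r powr (s - 1/2) + 1/2 * r powr (s - 1/2)"
    by (subst (asm) ennreal_le_iff) (use G(2) in auto)
  also have "\<dots> \<le> (G + 1) * r powr (s - 1/2)"
    by (simp add: distrib_right)
  finally show ?thesis by (simp add: G_def)
qed

lemma power_powr: "0 \<le> x \<Longrightarrow> (x ^ n) powr a = (x powr a) ^ n" for x a :: real
  by (induction n) (auto simp: powr_mult)

lemma has_vector_derivative_uniform_limit:
  fixes F q :: "nat \<Rightarrow> real \<Rightarrow> 'b::banach"
  assumes d: "\<And>n t. (F n has_vector_derivative q n t) (at t)" and ul: "uniform_limit UNIV q v sequentially"
    and lim: "\<And>t. (\<lambda>n. F n t) \<longlonglongrightarrow> f t"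
  shows "(f has_vector_derivative v t) (at t)"
proof -
  have "\<exists>g. \<forall>x\<in>UNIV. (\<lambda>n. F n x) \<longlonglongrightarrow> g x \<and> (g has_derivative (\<lambda>h. h *\<^sub>R v x)) (at x within UNIV)"
  proof (rule has_derivative_sequence)
    show "(F n has_derivative (\<lambda>h. h *\<^sub>R q n x)) (at x within UNIV)" for n x
      using d by (simp add: has_vector_derivative_def)
    show "\<forall>\<^sub>F n in sequentially. \<forall>x\<in>UNIV. \<forall>h. norm (h *\<^sub>R q n x - h *\<^sub>R v x) \<le> e * norm h" if "0 < e" for e
      using uniform_limitD[OF ul that]
    proof eventually_elim
      case (elim n)
      show ?case
      proof (intro ballI allI)
        fix x h
        have "norm (h *\<^sub>R q n x - h *\<^sub>R v x) = \<bar>h\<bar> * dist (q n x) (v x)"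
          by (simp add: dist_norm flip: scaleR_diff_right)
        also have "\<dots> \<le> \<bar>h\<bar> * e" using elim by (intro mult_left_mono) (auto simp: less_imp_le)
        finally show "norm (h *\<^sub>R q n x - h *\<^sub>R v x) \<le> e * norm h" by (simp add: mult.commute)
      qed
    qed
    show "(\<lambda>n. F n 0) \<longlonglongrightarrow> f 0" by (rule lim)
  qed auto
  then obtain g where g: "\<And>x. (\<lambda>n. F n x) \<longlonglongrightarrow> g x" "\<And>x. (g has_derivative (\<lambda>h. h *\<^sub>R v x)) (at x)" by auto
  have "g x = f x" for x by (rule LIMSEQ_unique[OF g(1) lim])
  then have "g = f" by (rule ext)
  then show ?thesis using g(2) by (simp add: has_vector_derivative_def)
qed

text \<open>
  The Sobolev embedding. The difference quotients of \<open>\<gamma>\<close> with dyadic steps are averages of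
  \<open>f\<close>; successive ones differ by at most a geometric sequence, uniformly in the base
  point, so that they converge uniformly to a continuous function \<open>v\<close>.

  To see that \<open>v\<close> is the derivative of \<open>\<gamma>\<close>, let \<open>\<Gamma>\<close> be a primitive of \<open>\<gamma>\<close>. The difference
  quotients \<open>F k\<close> of \<open>\<Gamma>\<close> are differentiable with derivative the difference quotients of
  \<open>\<gamma>\<close>, and they converge to \<open>\<gamma>\<close> pointwise.
\<close>

lemma gagliardo_embedding:
  fixes \<gamma> f :: "real \<Rightarrow> 'b::euclidean_space"
  assumes \<gamma>: "continuous_on UNIV \<gamma>" and f: "loc_integrable f" "periodic1 f"
    and prim: "\<And>t. \<gamma> t = \<gamma> 0 + prim f t" and s: "1/2 < s" and fin: "gagliardo_sq s f < \<infinity>"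
  obtains v where "continuous_on UNIV v" "\<And>t. (\<gamma> has_vector_derivative v t) (at t)"
    "\<And>t. norm (v t) \<le> norm (2 *\<^sub>R (\<gamma> (t + 1/2) - \<gamma> t)) + (enn2real (gagliardo_sq s f) + 1) * (1 / (1 - (1/2) powr (s - 1/2)))"
proof -
  define G where "G = enn2real (gagliardo_sq s f) + 1"
  define \<rho> where "\<rho> = (1/2::real) powr (s - 1/2)"
  have G: "0 \<le> G" by (simp add: G_def)
  have "\<rho> < (1/2) powr 0" unfolding \<rho>_def using s by (intro powr_less_mono') auto
  then have \<rho>: "0 < \<rho>" "\<rho> < 1" by (auto simp: \<rho>_def)
  define d where "d k = (1/2::real) ^ Suc k" for k
  have d: "0 < d k" "d k \<le> 1/2" "d (Suc k) = d k / 2" for k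
    using power_le_one[of "1/2::real" k] by (auto simp: d_def)
  define q where "q k u = (1 / d k) *\<^sub>R (\<gamma> (u + d k) - \<gamma> u)" for k u
  have eq: "q k u = (1 / d k) *\<^sub>R (LINT x:{u..u + d k}|lborel. f x)" for k u
    using prim_diff[OF f(1), of u "u + d k"] prim[of u] prim[of "u + d k"] d(1)[of k] by (simp add: q_def)
  have pq: "periodic1 (q k)" for k
    unfolding periodic1_def eq
  proof
    fix t
    have e: "t + 1 + d k = (t + d k) + 1" by simp
    show "(1 / d k) *\<^sub>R (LINT x:{t + 1..t + 1 + d k}|lborel. f x) = (1 / d k) *\<^sub>R (LINT x:{t..t + d k}|lborel. f x)"
      unfolding e set_integral_shift[OF f(2)] ..
  qed
  have cq: "continuous_on UNIV (q k)" for k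
    unfolding q_def by (intro continuous_intros continuous_on_compose2[OF \<gamma>]) auto
  have step01: "norm (q (Suc k) u - q k u) \<le> G * \<rho> ^ k" if "0 \<le> u" "u < 1" for k u
  proof -
    have "norm (q k u - q (Suc k) u) \<le> G * d k powr (s - 1/2)"
      using average_halving[OF f _ fin that d(1,2)[of k]] s unfolding eq d(3)[symmetric] G_def by simp
    also have "d k powr (s - 1/2) = \<rho> ^ Suc k"
      unfolding d_def \<rho>_def by (rule power_powr) simp
    also have "G * \<rho> ^ Suc k \<le> G * \<rho> ^ k"
      using \<rho> G by (intro mult_left_mono power_decreasing) auto
    finally show ?thesis by (simp add: norm_minus_commute)
  qed
  have step: "norm (q (Suc k) u - q k u) \<le> G * \<rho> ^ k" for k u
    using step01[of "frac u" k] frac_lt_1[of u] frac_ge_0[of u] periodic1_frac[OF pq, of _ u] by simp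
  have sm: "summable (\<lambda>k. G * \<rho> ^ k)" using \<rho> by (intro summable_mult summable_geometric) auto
  define v where "v u = q 0 u + (\<Sum>k. q (Suc k) u - q k u)" for u
  have tele: "q 0 u + (\<Sum>k<n. q (Suc k) u - q k u) = q n u" for n u
    using sum_lessThan_telescope[of "\<lambda>k. q k u" n] by simp
  have "uniform_limit UNIV (\<lambda>n u. \<Sum>k<n. q (Suc k) u - q k u) (\<lambda>u. \<Sum>k. q (Suc k) u - q k u) sequentially"
    by (rule Weierstrass_m_test[OF step sm])
  then have "uniform_limit UNIV (\<lambda>n u. q 0 u + (\<Sum>k<n. q (Suc k) u - q k u)) v sequentially"
    unfolding v_def by (intro uniform_limit_add uniform_limit_const) auto
  then have ul: "uniform_limit UNIV q v sequentially" by (simp only: tele)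
  then have cv: "continuous_on UNIV v"
    by (rule uniform_limit_theorem[OF always_eventually[OF allI[OF cq]]]) simp
  have bound: "norm (v u) \<le> norm (2 *\<^sub>R (\<gamma> (u + 1/2) - \<gamma> u)) + G * (1 / (1 - \<rho>))" for u
  proof -
    have "norm (\<Sum>k. q (Suc k) u - q k u) \<le> (\<Sum>k. G * \<rho> ^ k)"
      by (rule norm_suminf_le[OF step sm])
    also have "\<dots> = G * (1 / (1 - \<rho>))" using \<rho> by (simp add: suminf_mult suminf_geometric)
    finally have "norm (\<Sum>k. q (Suc k) u - q k u) \<le> G * (1 / (1 - \<rho>))" .
    moreover have "q 0 u = 2 *\<^sub>R (\<gamma> (u + 1/2) - \<gamma> u)" by (simp add: q_def d_def)
    ultimately show ?thesis
      using norm_triangle_ineq[of "q 0 u" "\<Sum>k. q (Suc k) u - q k u"] unfolding v_def by simp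
  qed
  let ?\<Gamma> = "prim \<gamma>"
  define F where "F k u = (1 / d k) *\<^sub>R (?\<Gamma> (u + d k) - ?\<Gamma> u)" for k u
  have dG: "(?\<Gamma> has_vector_derivative \<gamma> t) (at t)" for t by (rule prim_has_vector_derivative[OF \<gamma>])
  have dF: "(F k has_vector_derivative q k u) (at u)" for k u
  proof -
    have "((\<lambda>u. ?\<Gamma> (u + d k)) has_vector_derivative 1 *\<^sub>R \<gamma> (u + d k)) (at u)"
      by (rule vector_diff_chain_at[of "\<lambda>u. u + d k" 1 u ?\<Gamma>, unfolded o_def])
         (auto intro!: derivative_eq_intros dG)
    then show ?thesis
      unfolding F_def q_def by (auto intro!: derivative_eq_intros dG)
  qed
  have lim_F: "(\<lambda>k. F k u) \<longlonglongrightarrow> \<gamma> u" for u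
  proof -
    have "((\<lambda>y. norm (?\<Gamma> y - ?\<Gamma> u - (y - u) *\<^sub>R \<gamma> u) / norm (y - u)) \<longlongrightarrow> 0) (at u)"
      using dG[of u] unfolding has_vector_derivative_def has_derivative_iff_norm by simp
    moreover have "filterlim (\<lambda>k. u + d k) (at u) sequentially"
    proof -
      have "(\<lambda>k. u + d k) \<longlonglongrightarrow> u + 0" unfolding d_def
        by (intro tendsto_add tendsto_const LIMSEQ_Suc LIMSEQ_power_zero) auto
      then show ?thesis using d(1) by (auto simp: filterlim_at less_imp_neq[symmetric])
    qed
    ultimately have "(\<lambda>k. norm (?\<Gamma> (u + d k) - ?\<Gamma> u - ((u + d k) - u) *\<^sub>R \<gamma> u) / norm ((u + d k) - u)) \<longlonglongrightarrow> 0"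
      by (rule filterlim_compose)
    moreover have "norm (?\<Gamma> (u + d k) - ?\<Gamma> u - ((u + d k) - u) *\<^sub>R \<gamma> u) / norm ((u + d k) - u) = norm (F k u - \<gamma> u)" for k
    proof -
      have "F k u - \<gamma> u = (1 / d k) *\<^sub>R (?\<Gamma> (u + d k) - ?\<Gamma> u - d k *\<^sub>R \<gamma> u)"
        using d(1)[of k] by (simp add: F_def scaleR_diff_right)
      then show ?thesis using d(1)[of k] by simp
    qed
    ultimately have "(\<lambda>k. norm (F k u - \<gamma> u)) \<longlonglongrightarrow> 0" by simp
    then show ?thesis by (simp only: tendsto_norm_zero_iff LIM_zero_iff)
  qed
  have "(\<gamma> has_vector_derivative v t) (at t)" for t by (rule has_vector_derivative_uniform_limit[OF dF ul lim_F])
  with cv bound show ?thesis unfolding G_def \<rho>_def by (intro that)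
qed

section \<open>The quadratic seminorms\<close>

text \<open>
  A pointwise inequality between squared differences carries over to the seminorms. Sums,
  multiples and products of functions are all treated by it.
\<close>

lemma gagliardo_combine:
  fixes f :: "real \<Rightarrow> 'a::euclidean_space" and g :: "real \<Rightarrow> 'b::euclidean_space" and h :: "real \<Rightarrow> 'c::euclidean_space"
  assumes [measurable]: "f \<in> borel_measurable borel" "g \<in> borel_measurable borel" and A: "0 \<le> A" and B: "0 \<le> B"
    and le: "\<And>x y. (norm (h x - h y))\<^sup>2 \<le> A * (norm (f x - f y))\<^sup>2 + B * (norm (g x - g y))\<^sup>2"
  shows "gagliardo_sq s h \<le> ennreal A * gagliardo_sq s f + ennreal B * gagliardo_sq s g"
proof -
  have dens: "gagliardo_density s h u \<le> ennreal A * gagliardo_density s f u + ennreal B * gagliardo_density s g u" for u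
  proof -
    have "gagliardo_density s h u \<le> (\<integral>\<^sup>+w. ennreal A * (ennreal ((norm (f (u + w) - f u))\<^sup>2 / \<bar>w\<bar> powr (1 + 2 * s)) * indicator {-1/2..1/2} w)
        + ennreal B * (ennreal ((norm (g (u + w) - g u))\<^sup>2 / \<bar>w\<bar> powr (1 + 2 * s)) * indicator {-1/2..1/2} w) \<partial>lborel)"
      unfolding gagliardo_density_def
    proof (rule nn_integral_mono)
      fix w :: real
      let ?P = "\<bar>w\<bar> powr (1 + 2 * s)"
      have "(norm (h (u + w) - h u))\<^sup>2 / ?P \<le> (A * (norm (f (u + w) - f u))\<^sup>2 + B * (norm (g (u + w) - g u))\<^sup>2) / ?P"
        by (intro divide_right_mono le) auto
      also have "\<dots> = A * ((norm (f (u + w) - f u))\<^sup>2 / ?P) + B * ((norm (g (u + w) - g u))\<^sup>2 / ?P)"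
        by (simp add: add_divide_distrib)
      finally have "ennreal ((norm (h (u + w) - h u))\<^sup>2 / ?P)
          \<le> ennreal (A * ((norm (f (u + w) - f u))\<^sup>2 / ?P) + B * ((norm (g (u + w) - g u))\<^sup>2 / ?P))"
        by (rule ennreal_leI)
      also have "\<dots> = ennreal A * ennreal ((norm (f (u + w) - f u))\<^sup>2 / ?P) + ennreal B * ennreal ((norm (g (u + w) - g u))\<^sup>2 / ?P)"
        using A B by (simp only: ennreal_plus ennreal_mult' mult_nonneg_nonneg divide_nonneg_nonneg zero_le_power2 powr_ge_zero)
      finally show "ennreal ((norm (h (u + w) - h u))\<^sup>2 / ?P) * indicator {-1/2..1/2} w
        \<le> ennreal A * (ennreal ((norm (f (u + w) - f u))\<^sup>2 / ?P) * indicator {-1/2..1/2} w)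
          + ennreal B * (ennreal ((norm (g (u + w) - g u))\<^sup>2 / ?P) * indicator {-1/2..1/2} w)"
        by (cases "w \<in> {-1/2..1/2}") auto
    qed
    also have "\<dots> = ennreal A * gagliardo_density s f u + ennreal B * gagliardo_density s g u"
      unfolding gagliardo_density_def by (subst nn_integral_add) (auto simp: nn_integral_cmult)
    finally show ?thesis .
  qed
  have "gagliardo_sq s h \<le> (\<integral>\<^sup>+u. ennreal A * (gagliardo_density s f u * indicator {0..1} u)
      + ennreal B * (gagliardo_density s g u * indicator {0..1} u) \<partial>lborel)"
    unfolding gagliardo_sq_density
    by (rule nn_integral_mono) (use dens in \<open>auto simp: indicator_def\<close>)
  also have "\<dots> = ennreal A * gagliardo_sq s f + ennreal B * gagliardo_sq s g"
    unfolding gagliardo_sq_density by (subst nn_integral_add) (auto simp: nn_integral_cmult)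
  finally show ?thesis .
qed

lemma gagliardo_cong_AE:
  fixes f g :: "real \<Rightarrow> 'b::euclidean_space"
  assumes [measurable]: "f \<in> borel_measurable borel" "g \<in> borel_measurable borel" and ae: "AE x in lborel. f x = g x"
  shows "gagliardo_sq s f = gagliardo_sq s g"
proof -
  have shift: "AE w in lborel. f (u + w) = g (u + w)" for u
    using AE_borel_affine[of 1 "\<lambda>x. f x = g x" u] ae by (simp add: add.commute) 
  have "gagliardo_density s f u = gagliardo_density s g u" if "f u = g u" for u
    unfolding gagliardo_density_def
    by (rule nn_integral_cong_AE) (use shift[of u] in \<open>eventually_elim, simp add: that\<close>)
  then show ?thesis
    unfolding gagliardo_sq_density
    by (intro nn_integral_cong_AE) (use ae in \<open>eventually_elim, simp\<close>)
qed

text \<open>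
  Fatou's lemma, in the inner and in the outer integral.
\<close>

lemma gagliardo_lsc:
  fixes f :: "nat \<Rightarrow> real \<Rightarrow> 'b::euclidean_space"
  assumes [measurable]: "\<And>n. f n \<in> borel_measurable borel" and lim: "\<And>x. (\<lambda>n. f n x) \<longlonglongrightarrow> g x"
  shows "gagliardo_sq s g \<le> liminf (\<lambda>n. gagliardo_sq s (f n))"
proof -
  have dens: "gagliardo_density s g u \<le> liminf (\<lambda>n. gagliardo_density s (f n) u)" for u
  proof -
    have "(\<lambda>n. ennreal ((norm (f n (u + w) - f n u))\<^sup>2 / \<bar>w\<bar> powr (1 + 2 * s)) * indicator {-1/2..1/2} w)
        \<longlonglongrightarrow> ennreal ((norm (g (u + w) - g u))\<^sup>2 / \<bar>w\<bar> powr (1 + 2 * s)) * indicator {-1/2..1/2} w" for w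
    proof (cases "w \<in> {-1/2..1/2} \<and> w \<noteq> 0")
      case True
      then have "(\<lambda>n. ennreal ((norm (f n (u + w) - f n u))\<^sup>2 / \<bar>w\<bar> powr (1 + 2 * s)))
          \<longlonglongrightarrow> ennreal ((norm (g (u + w) - g u))\<^sup>2 / \<bar>w\<bar> powr (1 + 2 * s))"
        by (intro tendsto_ennrealI tendsto_divide tendsto_power tendsto_norm tendsto_diff lim tendsto_const) auto
      then show ?thesis using True by simp
    next
      case False
      then show ?thesis by (cases "w = 0") auto
    qed
    then have "gagliardo_density s g u = (\<integral>\<^sup>+w. liminf (\<lambda>n. ennreal ((norm (f n (u + w) - f n u))\<^sup>2 / \<bar>w\<bar> powr (1 + 2 * s)) * indicator {-1/2..1/2} w) \<partial>lborel)"
      unfolding gagliardo_density_def by (intro nn_integral_cong lim_imp_Liminf[symmetric]) auto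
    also have "\<dots> \<le> liminf (\<lambda>n. gagliardo_density s (f n) u)"
      unfolding gagliardo_density_def by (rule nn_integral_liminf) measurable
    finally show ?thesis .
  qed
  have "gagliardo_sq s g \<le> (\<integral>\<^sup>+u. liminf (\<lambda>n. gagliardo_density s (f n) u * indicator {0..1} u) \<partial>lborel)"
    unfolding gagliardo_sq_density
  proof (rule nn_integral_mono)
    fix u :: real
    show "gagliardo_density s g u * indicator {0..1} u \<le> liminf (\<lambda>n. gagliardo_density s (f n) u * indicator {0..1} u)"
      using dens[of u] by (cases "u \<in> {0..1}") auto
  qed
  also have "\<dots> \<le> liminf (\<lambda>n. gagliardo_sq s (f n))"
    unfolding gagliardo_sq_density by (rule nn_integral_liminf) measurable
  finally show ?thesis .
qed

lemma ennreal_L2_norm_sq: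
  assumes "g \<in> L2_periodic"
  shows "(\<integral>\<^sup>+x\<in>{0..1}. ennreal ((norm (g x))\<^sup>2) \<partial>lborel) = ennreal (L2_norm_sq g)"
proof -
  have "(\<integral>\<^sup>+x. ennreal (indicator {0..1} x *\<^sub>R (norm (g x))\<^sup>2) \<partial>lborel) = ennreal (L2_norm_sq g)"
    unfolding L2_norm_sq_def set_lebesgue_integral_def
    using L2_periodicD(3)[OF assms, of 0 1] by (intro nn_integral_eq_integral) (auto simp: set_integrable_def)
  moreover have "(\<integral>\<^sup>+x\<in>{0..1}. ennreal ((norm (g x))\<^sup>2) \<partial>lborel) = (\<integral>\<^sup>+x. ennreal (indicator {0..1} x *\<^sub>R (norm (g x))\<^sup>2) \<partial>lborel)"
    by (intro nn_integral_cong) (auto simp: indicator_def)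
  ultimately show ?thesis by simp
qed

lemma L2_norm_sq_nonneg [simp]: "0 \<le> L2_norm_sq g"
  unfolding L2_norm_sq_def set_lebesgue_integral_def by (intro integral_nonneg_AE) auto

lemma L2_periodic_of_nn_integral:
  assumes "periodic1 g" and [measurable]: "g \<in> borel_measurable borel"
    and le: "(\<integral>\<^sup>+x\<in>{0..1}. ennreal ((norm (g x))\<^sup>2) \<partial>lborel) \<le> ennreal c" and c: "0 \<le> c"
  shows "g \<in> L2_periodic" "L2_norm_sq g \<le> c"
proof -
  have eq: "(\<integral>\<^sup>+x\<in>{0..1}. ennreal ((norm (g x))\<^sup>2) \<partial>lborel) = (\<integral>\<^sup>+x. ennreal (norm (indicator {0..1} x *\<^sub>R (norm (g x))\<^sup>2)) \<partial>lborel)"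
    by (intro nn_integral_cong) (auto simp: indicator_def)
  have "integrable lborel (\<lambda>x. indicator {0..1} x *\<^sub>R (norm (g x))\<^sup>2)"
    by (rule integrableI_bounded) (use le eq in \<open>auto intro: le_less_trans\<close>)
  then show g: "g \<in> L2_periodic"
    using assms(1,2) by (intro L2_periodicI) (auto simp: set_integrable_def)
  show "L2_norm_sq g \<le> c"
    using le c by (subst (asm) ennreal_L2_norm_sq[OF g]) simp
qed

lemma L2_combine:
  fixes f :: "real \<Rightarrow> 'a::euclidean_space" and g :: "real \<Rightarrow> 'b::euclidean_space" and h :: "real \<Rightarrow> 'c::euclidean_space"
  assumes f: "f \<in> L2_periodic" and g: "g \<in> L2_periodic" and h: "periodic1 h" "h \<in> borel_measurable borel"
    and A: "0 \<le> A" and B: "0 \<le> B"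
    and le: "\<And>x. (norm (h x))\<^sup>2 \<le> A * (norm (f x))\<^sup>2 + B * (norm (g x))\<^sup>2"
  shows "h \<in> L2_periodic" "L2_norm_sq h \<le> A * L2_norm_sq f + B * L2_norm_sq g"
proof -
  note [measurable] = L2_periodicD(4)[OF f] L2_periodicD(4)[OF g] h(2)
  have "(\<integral>\<^sup>+x\<in>{0..1}. ennreal ((norm (h x))\<^sup>2) \<partial>lborel)
      \<le> (\<integral>\<^sup>+x. ennreal A * (ennreal ((norm (f x))\<^sup>2) * indicator {0..1} x) + ennreal B * (ennreal ((norm (g x))\<^sup>2) * indicator {0..1} x) \<partial>lborel)"
  proof (rule nn_integral_mono)
    fix x :: real
    have "ennreal ((norm (h x))\<^sup>2) \<le> ennreal A * ennreal ((norm (f x))\<^sup>2) + ennreal B * ennreal ((norm (g x))\<^sup>2)"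
      using ennreal_leI[OF le[of x]] A B by (simp add: ennreal_mult')
    then show "ennreal ((norm (h x))\<^sup>2) * indicator {0..1} x
      \<le> ennreal A * (ennreal ((norm (f x))\<^sup>2) * indicator {0..1} x) + ennreal B * (ennreal ((norm (g x))\<^sup>2) * indicator {0..1} x)"
      by (cases "x \<in> {0..1}") auto
  qed
  also have "\<dots> = ennreal A * ennreal (L2_norm_sq f) + ennreal B * ennreal (L2_norm_sq g)"
    unfolding ennreal_L2_norm_sq[OF f, symmetric] ennreal_L2_norm_sq[OF g, symmetric]
    by (subst nn_integral_add) (auto simp: nn_integral_cmult)
  also have "\<dots> = ennreal (A * L2_norm_sq f + B * L2_norm_sq g)"
    using A B by (simp add: ennreal_mult')
  finally have *: "(\<integral>\<^sup>+x\<in>{0..1}. ennreal ((norm (h x))\<^sup>2) \<partial>lborel) \<le> ennreal (A * L2_norm_sq f + B * L2_norm_sq g)" .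
  have "0 \<le> A * L2_norm_sq f + B * L2_norm_sq g" using A B by simp
  from L2_periodic_of_nn_integral[OF h * this]
  show "h \<in> L2_periodic" "L2_norm_sq h \<le> A * L2_norm_sq f + B * L2_norm_sq g" by auto
qed

lemma L2_norm_sq_cong_AE:
  assumes "AE x in lborel. f x = g x" "f \<in> borel_measurable borel" "g \<in> borel_measurable borel"
  shows "L2_norm_sq f = L2_norm_sq g"
  unfolding L2_norm_sq_def using assms by (intro set_lebesgue_integral_cong_AE) auto

text \<open>
  A triangle inequality for squares. It can be integrated term by term, and the infimum
  over \<open>t\<close> gives back the triangle inequality for the square roots.
\<close>

lemma norm_sum_sq_le:
  fixes x y :: "'a::real_normed_vector"
  assumes "0 < t" shows "(norm (x + y))\<^sup>2 \<le> (1 + t) * (norm x)\<^sup>2 + (1 + 1 / t) * (norm y)\<^sup>2"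
proof -
  let ?a = "norm x" and ?b = "norm y"
  have "(norm (x + y))\<^sup>2 \<le> (?a + ?b)\<^sup>2" by (intro power_mono norm_triangle_ineq) auto
  also have "\<dots> \<le> (1 + t) * ?a\<^sup>2 + (1 + 1 / t) * ?b\<^sup>2"
  proof -
    have "0 \<le> (t * ?a - ?b)\<^sup>2 / t" using assms by simp
    also have "\<dots> = t * ?a\<^sup>2 - 2 * ?a * ?b + ?b\<^sup>2 / t"
      using assms by (simp add: power2_eq_square field_simps)
    finally show ?thesis by (simp add: power2_sum algebra_simps)
  qed
  finally show ?thesis .
qed

text \<open>
  The second bound again replaces the Cauchy-Schwarz inequality, here by
  \<open>y \<le> \<delta>/2 + y\<^sup>2/(2 \<delta>)\<close>.
\<close>

lemma periodic_mean_L2: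
  assumes g: "g \<in> L2_periodic"
  shows "(LINT x:{t..t + 1}|lborel. (norm (g x))\<^sup>2) = L2_norm_sq g"
    and "0 < \<delta> \<Longrightarrow> (LINT x:{t..t + 1}|lborel. norm (g x)) \<le> \<delta> / 2 + L2_norm_sq g / (2 * \<delta>)"
proof -
  let ?n = "\<lambda>x. (norm (g x))\<^sup>2"
  have l: "loc_integrable ?n" "periodic1 ?n"
    using L2_periodicD[OF g] by (auto simp: loc_integrable_def periodic1_def)
  show eq: "(LINT x:{t..t + 1}|lborel. ?n x) = L2_norm_sq g"
    using prim_diff[OF l(1), of t "t + 1"] prim_shift[OF l, of t] by (simp add: prim_1 L2_norm_sq_def)
  assume \<delta>: "0 < \<delta>"
  have lc: "loc_integrable (\<lambda>_::real. \<delta> / 2)" by (intro loc_integrable_continuous) auto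
  have ln: "set_integrable lborel {t..t + 1} (\<lambda>x. norm (g x))"
    using loc_integrable_set[OF L2_periodicD(2)[OF g]] by (rule set_integrable_norm)
  have ls: "set_integrable lborel {t..t + 1} (\<lambda>x. (1 / (2 * \<delta>)) * ?n x)"
    using loc_integrable_set[OF l(1)] by simp
  have am: "y \<le> \<delta> / 2 + (1 / (2 * \<delta>)) * y\<^sup>2" for y
  proof -
    have "0 \<le> (y - \<delta>)\<^sup>2 / (2 * \<delta>)" using \<delta> by simp
    also have "\<dots> = \<delta> / 2 + (1 / (2 * \<delta>)) * y\<^sup>2 - y" using \<delta> by (simp add: power2_eq_square field_simps)
    finally show ?thesis by simp
  qed
  have "(LINT x:{t..t + 1}|lborel. norm (g x)) \<le> (LINT x:{t..t + 1}|lborel. \<delta> / 2 + (1 / (2 * \<delta>)) * ?n x)"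
    by (intro set_integral_mono ln set_integral_add(1) loc_integrable_set[OF lc] ls am)
  also have "\<dots> = (LINT x:{t..t + 1}|lborel. \<delta> / 2) + (LINT x:{t..t + 1}|lborel. (1 / (2 * \<delta>)) * ?n x)"
    by (intro set_integral_add(2) loc_integrable_set[OF lc] ls)
  also have "(LINT x:{t..t + 1}|lborel. \<delta> / 2) = \<delta> / 2"
    using prim_diff[OF lc, of t "t + 1"] by (simp add: prim_const algebra_simps)
  also have "(LINT x:{t..t + 1}|lborel. (1 / (2 * \<delta>)) * ?n x) = L2_norm_sq g / (2 * \<delta>)"
    unfolding set_integral_mult_right eq by simp
  finally show "(LINT x:{t..t + 1}|lborel. norm (g x)) \<le> \<delta> / 2 + L2_norm_sq g / (2 * \<delta>)" .
qed

lemma norm_prim_diff_le: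
  assumes g: "g \<in> L2_periodic" and ab: "a \<le> b" "b \<le> a + 1" and \<delta>: "0 < \<delta>"
  shows "norm (prim g b - prim g a) \<le> \<delta> / 2 + L2_norm_sq g / (2 * \<delta>)"
proof -
  have ln: "set_integrable lborel {c..d} (\<lambda>x. norm (g x))" for c d
    using loc_integrable_set[OF L2_periodicD(2)[OF g]] by (rule set_integrable_norm)
  have "norm (prim g b - prim g a) = norm (LINT x:{a..b}|lborel. g x)"
    using prim_diff[OF L2_periodicD(2)[OF g] ab(1)] by simp
  also have "\<dots> \<le> (LINT x:{a..b}|lborel. norm (g x))"
    using loc_integrable_set[OF L2_periodicD(2)[OF g], of a b]
    unfolding set_lebesgue_integral_def set_integrable_def
    by (intro order_trans[OF integral_norm_bound]) (simp add: indicator_def of_bool_def)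
  also have "\<dots> \<le> (LINT x:{a..a + 1}|lborel. norm (g x))"
    unfolding set_lebesgue_integral_def
    by (intro integral_mono) (use ln ab in \<open>auto simp: set_integrable_def indicator_def\<close>)
  also have "\<dots> \<le> \<delta> / 2 + L2_norm_sq g / (2 * \<delta>)" by (rule periodic_mean_L2(2)[OF g \<delta>])
  finally show ?thesis .
qed

section \<open>The energy of order s\<close>

text \<open>
  The square of the seminorm of order \<open>s\<close> on \<open>H\<^sup>s\<close>. For \<open>s = 1\<close>, the set over which the
  infimum is taken consists of the square integrable derivatives of \<open>v\<close>. They agree almost
  everywhere, so the infimum is the common value of their norms, and it is \<open>\<infinity>\<close> if no such
  derivative exists.
\<close>

definition energy :: "real \<Rightarrow> (real \<Rightarrow> 'b::euclidean_space) \<Rightarrow> ennreal" where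
  "energy s v = (if s = 1 then INF h \<in> {h \<in> L2_periodic. \<forall>t. v t = v 0 + prim h t}. ennreal (L2_norm_sq h)
     else gagliardo_sq s v)"

lemma energy_1_le:
  assumes "h \<in> L2_periodic" "\<And>t. v t = v 0 + prim h t"
  shows "energy 1 v \<le> ennreal (L2_norm_sq h)"
  unfolding energy_def if_P[OF refl]
  by (rule INF_lower, rule CollectI, rule conjI, rule assms(1), rule allI, rule assms(2))

lemma energy_1_eq:
  assumes h: "h \<in> L2_periodic" and v: "\<And>t. v t = v 0 + prim h t"
  shows "energy 1 v = ennreal (L2_norm_sq h)"
proof (rule antisym)
  show "energy 1 v \<le> ennreal (L2_norm_sq h)" using h v by (rule energy_1_le)
  have eq: "L2_norm_sq h = L2_norm_sq k" if k: "k \<in> L2_periodic" "\<forall>t. v t = v 0 + prim k t" for k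
  proof (rule L2_norm_sq_cong_AE)
    have "prim h t = prim k t" for t
    proof -
      have "v 0 + prim h t = v t" by (rule v[symmetric])
      also have "\<dots> = v 0 + prim k t" using k(2) by (rule spec)
      finally show ?thesis by (rule add_left_imp_eq)
    qed
    then show "AE x in lborel. h x = k x"
      by (intro AE_eq_of_prim_eq L2_periodicD(2) h k(1) ext)
  qed (use L2_periodicD(4)[OF h] L2_periodicD(4)[OF k(1)] in auto)
  show "ennreal (L2_norm_sq h) \<le> energy 1 v"
    unfolding energy_def if_P[OF refl]
  proof (rule INF_greatest)
    fix k assume "k \<in> {h \<in> L2_periodic. \<forall>t. v t = v 0 + prim h t}"
    then have "k \<in> L2_periodic \<and> (\<forall>t. v t = v 0 + prim k t)" by (rule CollectD)
    then have "L2_norm_sq h = L2_norm_sq k" by (elim conjE) (rule eq)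
    then show "ennreal (L2_norm_sq h) \<le> ennreal (L2_norm_sq k)" by (rule eq_refl[OF arg_cong])
  qed
qed

lemma energy_1_finite:
  assumes "energy 1 v < \<infinity>"
  obtains h where "h \<in> L2_periodic" "\<And>t. v t = v 0 + prim h t" "energy 1 v = ennreal (L2_norm_sq h)"
proof -
  have "{h \<in> L2_periodic. \<forall>t. v t = v 0 + prim h t} \<noteq> {}"
  proof
    assume "{h \<in> L2_periodic. \<forall>t. v t = v 0 + prim h t} = {}"
    then have "energy 1 v = \<infinity>" unfolding energy_def by (simp only: if_True refl image_empty Inf_empty) simp
    with assms show False by simp
  qed
  then obtain h where "h \<in> {h \<in> L2_periodic. \<forall>t. v t = v 0 + prim h t}" unfolding ex_in_conv[symmetric] by (rule exE)
  then have "h \<in> L2_periodic \<and> (\<forall>t. v t = v 0 + prim h t)" by (rule CollectD)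
  then have h: "h \<in> L2_periodic" "\<And>t. v t = v 0 + prim h t" by (rule conjunct1, rule spec[OF conjunct2])
  then show ?thesis by (rule that) (rule energy_1_eq[OF h])
qed

lemma energy_not_1: "s \<noteq> 1 \<Longrightarrow> energy s v = gagliardo_sq s v"
  by (simp add: energy_def)

lemma ennreal_lincomb:
  "0 \<le> a \<Longrightarrow> 0 \<le> b \<Longrightarrow> 0 \<le> x \<Longrightarrow> 0 \<le> y \<Longrightarrow> ennreal (a * x + b * y) = ennreal a * ennreal x + ennreal b * ennreal y"
  by (simp add: ennreal_mult)

lemma energy_add:
  fixes v w :: "real \<Rightarrow> 'b::euclidean_space"
  assumes v: "continuous_on UNIV v" "energy s v < \<infinity>" and w: "continuous_on UNIV w" "energy s w < \<infinity>" and t: "0 < t"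
  shows "energy s (\<lambda>x. v x + w x) \<le> ennreal (1 + t) * energy s v + ennreal (1 + 1 / t) * energy s w"
proof (cases "s = 1")
  case True
  obtain h where h: "h \<in> L2_periodic" "\<And>t. v t = v 0 + prim h t" "energy 1 v = ennreal (L2_norm_sq h)"
    using energy_1_finite[of v] v(2) True by metis
  obtain k where k: "k \<in> L2_periodic" "\<And>t. w t = w 0 + prim k t" "energy 1 w = ennreal (L2_norm_sq k)"
    using energy_1_finite[of w] w(2) True by metis
  have m: "(\<lambda>x. h x + k x) \<in> borel_measurable borel" "periodic1 (\<lambda>x. h x + k x)"
    using L2_periodicD(1,4)[OF h(1)] L2_periodicD(1,4)[OF k(1)] by (auto simp: periodic1_def)
  have nn: "0 \<le> 1 + t" "0 \<le> 1 + 1 / t" using t by auto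
  note hk = L2_combine[OF h(1) k(1) m(2,1) nn norm_sum_sq_le[OF t]]
  have "energy 1 (\<lambda>x. v x + w x) \<le> ennreal (L2_norm_sq (\<lambda>x. h x + k x))"
  proof (rule energy_1_le[OF hk(1)])
    fix t show "v t + w t = v 0 + w 0 + prim (\<lambda>x. h x + k x) t"
      using h(2)[of t] k(2)[of t] prim_add[OF L2_periodicD(2)[OF h(1)] L2_periodicD(2)[OF k(1)], of t] by simp
  qed
  also have "\<dots> \<le> ennreal ((1 + t) * L2_norm_sq h + (1 + 1 / t) * L2_norm_sq k)"
    by (rule ennreal_leI[OF hk(2)])
  also have "\<dots> = ennreal (1 + t) * energy s v + ennreal (1 + 1 / t) * energy s w"
    unfolding True h(3) k(3) by (rule ennreal_lincomb) (use t in auto)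
  finally show ?thesis using True by simp
next
  case False
  show ?thesis
    unfolding energy_not_1[OF False]
  proof (rule gagliardo_combine)
    fix x y
    have e: "v x + w x - (v y + w y) = (v x - v y) + (w x - w y)" by simp
    show "(norm (v x + w x - (v y + w y)))\<^sup>2 \<le> (1 + t) * (norm (v x - v y))\<^sup>2 + (1 + 1 / t) * (norm (w x - w y))\<^sup>2"
      unfolding e by (rule norm_sum_sq_le[OF t])
  qed (use v w t in \<open>auto intro: borel_measurable_continuous_onI\<close>)
qed

lemma energy_scaleR_le:
  fixes v :: "real \<Rightarrow> 'b::euclidean_space"
  assumes v: "continuous_on UNIV v" "energy s v < \<infinity>"
  shows "energy s (\<lambda>x. c *\<^sub>R v x) \<le> ennreal (c\<^sup>2) * energy s v"
proof (cases "s = 1")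
  case True
  obtain h where h: "h \<in> L2_periodic" "\<And>t. v t = v 0 + prim h t" "energy 1 v = ennreal (L2_norm_sq h)"
    using energy_1_finite[of v] v(2) True by metis
  have m: "periodic1 (\<lambda>x. c *\<^sub>R h x)" "(\<lambda>x. c *\<^sub>R h x) \<in> borel_measurable borel"
    using L2_periodicD(1,4)[OF h(1)] by (auto simp: periodic1_def)
  have ch: "(\<lambda>x. c *\<^sub>R h x) \<in> L2_periodic" "L2_norm_sq (\<lambda>x. c *\<^sub>R h x) \<le> c\<^sup>2 * L2_norm_sq h"
    using L2_combine[OF h(1) h(1) m, of "c\<^sup>2" 0] by (auto simp: power_mult_distrib)
  have "energy 1 (\<lambda>x. c *\<^sub>R v x) \<le> ennreal (L2_norm_sq (\<lambda>x. c *\<^sub>R h x))"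
  proof (rule energy_1_le[OF ch(1)])
    fix t show "c *\<^sub>R v t = c *\<^sub>R v 0 + prim (\<lambda>x. c *\<^sub>R h x) t"
      by (subst h(2)[of t]) (simp add: prim_scaleR scaleR_add_right)
  qed
  also have "\<dots> \<le> ennreal (c\<^sup>2) * energy s v"
    unfolding True h(3) ennreal_mult'[OF zero_le_power2, symmetric] by (rule ennreal_leI[OF ch(2)])
  finally show ?thesis using True by simp
next
  case False
  have [measurable]: "v \<in> borel_measurable borel" using v(1) by (rule borel_measurable_continuous_onI)
  have "(norm (c *\<^sub>R v x - c *\<^sub>R v y))\<^sup>2 \<le> c\<^sup>2 * (norm (v x - v y))\<^sup>2 + 0 * (norm (v x - v y))\<^sup>2" for x y
    by (simp add: power_mult_distrib flip: scaleR_diff_right)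
  then have "gagliardo_sq s (\<lambda>x. c *\<^sub>R v x) \<le> ennreal (c\<^sup>2) * gagliardo_sq s v + ennreal 0 * gagliardo_sq s v"
    by (intro gagliardo_combine) auto
  then show ?thesis unfolding energy_not_1[OF False] by simp
qed

lemma energy_const: "energy s (\<lambda>_. c :: 'b::euclidean_space) = 0"
proof (cases "s = 1")
  case True
  have "(\<lambda>_. 0 :: 'b) \<in> L2_periodic" by (intro L2_periodic_continuous) (auto simp: periodic1_def)
  then have "energy 1 (\<lambda>_. c) = ennreal (L2_norm_sq (\<lambda>_. 0 :: 'b))"
    by (rule energy_1_eq) (simp add: prim_const)
  then show ?thesis using True by (simp add: L2_norm_sq_def set_lebesgue_integral_def)
next
  case False
  then show ?thesis by (simp add: energy_not_1 gagliardo_sq_def)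
qed

text \<open>
  The product rule for absolutely continuous functions.
\<close>

lemma prim_product:
  fixes B :: "'a::euclidean_space \<Rightarrow> 'b::euclidean_space \<Rightarrow> 'c::euclidean_space"
  assumes B: "bounded_bilinear B" and h: "loc_integrable h" and k: "loc_integrable k"
    and v: "\<And>t. v t = v 0 + prim h t" and w: "\<And>t. w t = w 0 + prim k t" and t: "0 \<le> t"
    and lm: "loc_integrable (\<lambda>x. B (h x) (w x) + B (v x) (k x))"
  shows "B (v t) (w t) = B (v 0) (w 0) + prim (\<lambda>x. B (h x) (w x) + B (v x) (k x)) t"
proof -
  interpret B: bounded_bilinear B by fact
  note pb = prim_bilinear[OF B h k t]
  have l1: "loc_integrable (\<lambda>x. B (h x) (w 0))" "loc_integrable (\<lambda>x. B (v 0) (k x))"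
    by (rule loc_integrable_bounded_linear[OF B.bounded_linear_left h] loc_integrable_bounded_linear[OF B.bounded_linear_right k])+
  note i = loc_integrable_set[OF l1(1), of 0 t] loc_integrable_set[OF l1(2), of 0 t]
  have eq: "B (h x) (w x) + B (v x) (k x) = (B (h x) (w 0) + B (v 0) (k x)) + (B (h x) (prim k x) + B (prim h x) (k x))" for x
    by (subst v[of x], subst w[of x]) (simp add: B.add_left B.add_right)
  have "prim (\<lambda>x. B (h x) (w x) + B (v x) (k x)) t = (LINT x:{0..t}|lborel. B (h x) (w x) + B (v x) (k x))"
    using prim_diff[OF lm t] by simp
  also have "\<dots> = ((LINT x:{0..t}|lborel. B (h x) (w 0)) + (LINT x:{0..t}|lborel. B (v 0) (k x)))
      + ((LINT x:{0..t}|lborel. B (h x) (prim k x)) + (LINT x:{0..t}|lborel. B (prim h x) (k x)))"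
    unfolding eq using i pb(1,2) by (simp only: set_integral_add)
  also have "(LINT x:{0..t}|lborel. B (h x) (w 0)) = B (prim h t) (w 0)"
    using prim_diff[OF l1(1) t] prim_bounded_linear[OF B.bounded_linear_left h, of "w 0"] by (simp add: B.zero_left)
  also have "(LINT x:{0..t}|lborel. B (v 0) (k x)) = B (v 0) (prim k t)"
    using prim_diff[OF l1(2) t] prim_bounded_linear[OF B.bounded_linear_right k, of "v 0"] by (simp add: B.zero_right)
  also have "(LINT x:{0..t}|lborel. B (h x) (prim k x)) + (LINT x:{0..t}|lborel. B (prim h x) (k x)) = B (prim h t) (prim k t)"
    by (rule pb(3))
  finally show ?thesis
    by (subst v[of t], subst w[of t]) (simp add: B.add_left B.add_right)
qed

text \<open>
  The Leibniz rule: \<open>B (v x) (w x) - B (v y) (w y)\<close>, or the derivative of the product in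
  the case \<open>s = 1\<close>, is a sum of two terms in which one factor is bounded and the other one
  is a difference or a derivative.
\<close>

lemma energy_bilinear:
  fixes B :: "'a::euclidean_space \<Rightarrow> 'b::euclidean_space \<Rightarrow> 'c::euclidean_space"
  assumes B: "bounded_bilinear B" and K: "0 \<le> K" "\<And>x y. norm (B x y) \<le> norm x * norm y * K"
    and v: "continuous_on UNIV v" "periodic1 v" "energy s v < \<infinity>" "\<And>t. norm (v t) \<le> a"
    and w: "continuous_on UNIV w" "periodic1 w" "energy s w < \<infinity>" "\<And>t. norm (w t) \<le> b"
  shows "energy s (\<lambda>x. B (v x) (w x)) \<le> ennreal (2 * K\<^sup>2 * b\<^sup>2) * energy s v + ennreal (2 * K\<^sup>2 * a\<^sup>2) * energy s w"
proof -
  interpret B: bounded_bilinear B by fact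
  have ab: "0 \<le> a" "0 \<le> b" using v(4)[of 0] w(4)[of 0] by (auto intro: order_trans[OF norm_ge_zero])
  have est: "(norm (B x y + B x' y'))\<^sup>2 \<le> (2 * K\<^sup>2 * b\<^sup>2) * (norm x)\<^sup>2 + (2 * K\<^sup>2 * a\<^sup>2) * (norm y')\<^sup>2"
    if "norm y \<le> b" "norm x' \<le> a" for x x' y y'
  proof -
    have "(norm (B x y + B x' y'))\<^sup>2 \<le> 2 * (norm (B x y))\<^sup>2 + 2 * (norm (B x' y'))\<^sup>2"
      using norm_sum_sq_le[of 1 "B x y" "B x' y'"] by simp
    also have "norm (B x y) \<le> norm x * b * K"
      using that K(1) by (intro order_trans[OF K(2)] mult_right_mono mult_left_mono) auto
    then have "(norm (B x y))\<^sup>2 \<le> (norm x * b * K)\<^sup>2" by (rule power_mono) simp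
    also have "norm (B x' y') \<le> a * norm y' * K"
      using that K(1) by (intro order_trans[OF K(2)] mult_right_mono) auto
    then have "(norm (B x' y'))\<^sup>2 \<le> (a * norm y' * K)\<^sup>2" by (rule power_mono) simp
    finally show ?thesis by (simp add: power_mult_distrib mult_ac)
  qed
  show ?thesis
  proof (cases "s = 1")
    case True
    obtain h where h: "h \<in> L2_periodic" "\<And>t. v t = v 0 + prim h t" "energy 1 v = ennreal (L2_norm_sq h)"
      using energy_1_finite[of v] v(3) True by metis
    obtain k where k: "k \<in> L2_periodic" "\<And>t. w t = w 0 + prim k t" "energy 1 w = ennreal (L2_norm_sq k)"
      using energy_1_finite[of w] w(3) True by metis
    note [measurable] = L2_periodicD(4)[OF h(1)] L2_periodicD(4)[OF k(1)]
      borel_measurable_continuous_onI[OF v(1)] borel_measurable_continuous_onI[OF w(1)]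
    let ?m = "\<lambda>x. B (h x) (w x) + B (v x) (k x)"
    have pm: "periodic1 ?m"
      using L2_periodicD(1)[OF h(1)] L2_periodicD(1)[OF k(1)] v(2) w(2) by (simp add: periodic1_def)
    have mm: "?m \<in> borel_measurable borel"
      by (intro borel_measurable_add borel_measurable_bilinear[OF B]) measurable
    have nn: "0 \<le> 2 * K\<^sup>2 * b\<^sup>2" "0 \<le> 2 * K\<^sup>2 * a\<^sup>2" by auto
    note m = L2_combine[OF h(1) k(1) pm mm nn est[OF w(4) v(4)]]
    have lm: "loc_integrable ?m" by (rule L2_periodicD(2)[OF m(1)])
    have pos: "B (v t) (w t) = B (v 0) (w 0) + prim ?m t" if "0 \<le> t" for t
      by (rule prim_product[OF B L2_periodicD(2)[OF h(1)] L2_periodicD(2)[OF k(1)] h(2) k(2) that lm])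
    have "v 1 = v 0" "w 1 = w 0" using v(2) w(2) unfolding periodic1_def by (metis add_0)+
    then have "prim ?m 1 = 0" using pos[of 1] by simp
    then have pp: "periodic1 (prim ?m)" by (rule periodic1_prim[OF lm pm])
    have pl: "periodic1 (\<lambda>t. B (v t) (w t))" using v(2) w(2) by (simp add: periodic1_def)
    have pr: "periodic1 (\<lambda>t. B (v 0) (w 0) + prim ?m t)" using pp by (simp add: periodic1_def)
    have all: "B (v t) (w t) = B (v 0) (w 0) + prim ?m t" for t
      by (rule periodic1_eqI[OF pl pr pos])
    have "energy 1 (\<lambda>x. B (v x) (w x)) \<le> ennreal (L2_norm_sq ?m)"
      by (rule energy_1_le[OF m(1)]) (rule all)
    also have "\<dots> \<le> ennreal ((2 * K\<^sup>2 * b\<^sup>2) * L2_norm_sq h + (2 * K\<^sup>2 * a\<^sup>2) * L2_norm_sq k)"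
      by (rule ennreal_leI[OF m(2)])
    also have "\<dots> = ennreal (2 * K\<^sup>2 * b\<^sup>2) * energy 1 v + ennreal (2 * K\<^sup>2 * a\<^sup>2) * energy 1 w"
      unfolding h(3) k(3) by (rule ennreal_lincomb) auto
    finally show ?thesis using True by simp
  next
    case False
    show ?thesis
      unfolding energy_not_1[OF False]
    proof (rule gagliardo_combine)
      fix x y
      have "B (v x) (w x) - B (v y) (w y) = B (v x - v y) (w x) + B (v y) (w x - w y)"
        by (simp add: B.diff_left B.diff_right)
      then show "(norm (B (v x) (w x) - B (v y) (w y)))\<^sup>2
          \<le> 2 * K\<^sup>2 * b\<^sup>2 * (norm (v x - v y))\<^sup>2 + 2 * K\<^sup>2 * a\<^sup>2 * (norm (w x - w y))\<^sup>2"
        using est[OF w(4) v(4), of "v x - v y" x y "w x - w y"] by simp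
    qed (use v w in \<open>auto intro: borel_measurable_continuous_onI\<close>)
  qed
qed

lemma liminf_le_of_eventually:
  fixes X :: "nat \<Rightarrow> ennreal"
  assumes "eventually (\<lambda>n. X n \<le> c) sequentially" shows "liminf X \<le> c"
proof -
  have "liminf X \<le> limsup X" by (rule Liminf_le_Limsup) simp
  also have "\<dots> \<le> c" using assms by (rule Limsup_bounded)
  finally show ?thesis .
qed

text \<open>
  The Riesz-Fischer theorem in the form needed here. A Cauchy sequence in mean square is
  Cauchy in mean on \<open>[0,1]\<close>, a subsequence converges almost everywhere, and Fatou's lemma
  turns the Cauchy estimate into an estimate for the distance to the limit.
\<close>

lemma L2_complete:
  fixes h :: "nat \<Rightarrow> real \<Rightarrow> 'b::euclidean_space"
  assumes h: "\<And>n. h n \<in> L2_periodic"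
    and cauchy: "\<And>e. 0 < e \<Longrightarrow> \<exists>N. \<forall>m\<ge>N. \<forall>n\<ge>N. L2_norm_sq (\<lambda>x. h m x - h n x) \<le> e"
  obtains g where "g \<in> L2_periodic" "\<And>n. (\<lambda>x. h n x - g x) \<in> L2_periodic"
    "\<And>e N. 0 \<le> e \<Longrightarrow> \<forall>m\<ge>N. \<forall>n\<ge>N. L2_norm_sq (\<lambda>x. h m x - h n x) \<le> e \<Longrightarrow> \<forall>n\<ge>N. L2_norm_sq (\<lambda>x. h n x - g x) \<le> e"
proof -
  note hm [measurable] = L2_periodicD(4)[OF h]
  have diff: "(\<lambda>x. h m x - h n x) \<in> L2_periodic" for m n
    by (rule L2_combine(1)[OF h[of m] h[of n], where A = 2 and B = 2])
       (use L2_periodicD(1)[OF h] norm_sum_sq_le[of 1 "h m _" "- h n _"] in \<open>auto simp: periodic1_def\<close>)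
  let ?s = "\<lambda>n x. indicator {0..1} x *\<^sub>R h n x"
  have int: "integrable lborel (?s n)" for n
    using loc_integrable_set[OF L2_periodicD(2)[OF h]] by (simp add: set_integrable_def)
  have L1: "\<exists>N. \<forall>i\<ge>N. \<forall>j\<ge>N. LINT x|lborel. norm (?s i x - ?s j x) < e" if e0: "0 < e" for e
  proof -
    obtain N where N: "\<forall>m\<ge>N. \<forall>n\<ge>N. L2_norm_sq (\<lambda>x. h m x - h n x) \<le> e\<^sup>2 / 4"
      using cauchy[of "e\<^sup>2 / 4"] e0 by auto
    have "LINT x|lborel. norm (?s i x - ?s j x) < e" if "i \<ge> N" "j \<ge> N" for i j
    proof -
      have "(LINT x|lborel. norm (?s i x - ?s j x)) = (LINT x:{0..0 + 1}|lborel. norm (h i x - h j x))"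
        unfolding set_lebesgue_integral_def by (intro Bochner_Integration.integral_cong) (auto simp: indicator_def)
      also have "\<dots> \<le> e / 2 + L2_norm_sq (\<lambda>x. h i x - h j x) / (2 * e)"
        by (rule periodic_mean_L2(2)[OF diff e0])
      also have "\<dots> \<le> e / 2 + (e\<^sup>2 / 4) / (2 * e)"
        using N that e0 by (intro add_left_mono divide_right_mono) auto
      also have "\<dots> < e" using e0 by (simp add: power2_eq_square)
      finally show ?thesis .
    qed
    then show ?thesis by blast
  qed
  obtain r where r: "strict_mono r" "AE x in lborel. Cauchy (\<lambda>i. ?s (r i) x)"
    by (rule cauchy_L1_AE_cauchy_subseq[where s = ?s, OF int L1])
  define g where "g x = lim (\<lambda>i. h (r i) x)" for x
  have gm [measurable]: "g \<in> borel_measurable borel" unfolding g_def by measurable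
  have pg: "periodic1 g"
    using L2_periodicD(1)[OF h] by (simp add: periodic1_def g_def)
  have conv: "AE x in lborel. x \<in> {0..1} \<longrightarrow> (\<lambda>i. h (r i) x) \<longlonglongrightarrow> g x"
    using r(2)
  proof eventually_elim
    case (elim x)
    then show ?case
      by (auto simp: g_def convergent_LIMSEQ_iff[symmetric] Cauchy_convergent_iff)
  qed
  have est: "(\<integral>\<^sup>+x\<in>{0..1}. ennreal ((norm (h n x - g x))\<^sup>2) \<partial>lborel) \<le> ennreal e"
    if e: "0 \<le> e" and N: "\<forall>m\<ge>N. \<forall>n\<ge>N. L2_norm_sq (\<lambda>x. h m x - h n x) \<le> e" and n: "n \<ge> N" for e N n
  proof -
    have "(\<integral>\<^sup>+x\<in>{0..1}. ennreal ((norm (h n x - g x))\<^sup>2) \<partial>lborel)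
        \<le> (\<integral>\<^sup>+x. liminf (\<lambda>i. ennreal ((norm (h n x - h (r i) x))\<^sup>2) * indicator {0..1} x) \<partial>lborel)"
    proof (rule nn_integral_mono_AE)
      show "AE x in lborel. ennreal ((norm (h n x - g x))\<^sup>2) * indicator {0..1} x
          \<le> liminf (\<lambda>i. ennreal ((norm (h n x - h (r i) x))\<^sup>2) * indicator {0..1} x)"
        using conv
      proof eventually_elim
        case (elim x)
        show ?case
        proof (cases "x \<in> {0..1}")
          case True
          then have "(\<lambda>i. ennreal ((norm (h n x - h (r i) x))\<^sup>2)) \<longlonglongrightarrow> ennreal ((norm (h n x - g x))\<^sup>2)"
            using elim by (intro tendsto_ennrealI tendsto_power tendsto_norm tendsto_diff tendsto_const) auto
          then have "liminf (\<lambda>i. ennreal ((norm (h n x - h (r i) x))\<^sup>2)) = ennreal ((norm (h n x - g x))\<^sup>2)"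
            by (intro lim_imp_Liminf) auto
          then show ?thesis using True by simp
        qed simp
      qed
    qed
    also have "\<dots> \<le> liminf (\<lambda>i. \<integral>\<^sup>+x. ennreal ((norm (h n x - h (r i) x))\<^sup>2) * indicator {0..1} x \<partial>lborel)"
      by (rule nn_integral_liminf) measurable
    also have "\<dots> \<le> ennreal e"
    proof (rule liminf_le_of_eventually)
      have "ennreal (L2_norm_sq (\<lambda>x. h n x - h (r i) x)) \<le> ennreal e" if "i \<ge> N" for i
        using N n that seq_suble[OF r(1), of i] by (intro ennreal_leI) auto
      then show "\<forall>\<^sub>F i in sequentially. (\<integral>\<^sup>+x. ennreal ((norm (h n x - h (r i) x))\<^sup>2) * indicator {0..1} x \<partial>lborel) \<le> ennreal e"
        unfolding ennreal_L2_norm_sq[OF diff] eventually_sequentially by blast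
    qed
    finally show ?thesis .
  qed
  have pd: "periodic1 (\<lambda>x. h n x - g x)" for n
    using pg L2_periodicD(1)[OF h] by (simp add: periodic1_def)
  have md: "(\<lambda>x. h n x - g x) \<in> borel_measurable borel" for n by measurable
  have concl: "\<forall>n\<ge>N. L2_norm_sq (\<lambda>x. h n x - g x) \<le> e"
    if "0 \<le> e" "\<forall>m\<ge>N. \<forall>n\<ge>N. L2_norm_sq (\<lambda>x. h m x - h n x) \<le> e" for e N
    using L2_periodic_of_nn_integral(2)[OF pd md est[OF that]] that(1) by blast
  obtain N where N: "\<forall>m\<ge>N. \<forall>n\<ge>N. L2_norm_sq (\<lambda>x. h m x - h n x) \<le> 1" using cauchy[of 1] by auto
  have hNg: "(\<lambda>x. h N x - g x) \<in> L2_periodic"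
    by (rule L2_periodic_of_nn_integral(1)[OF pd md est[OF _ N]]) auto
  have "(norm (g x))\<^sup>2 \<le> 2 * (norm (h N x))\<^sup>2 + 2 * (norm (h N x - g x))\<^sup>2" for x
    using norm_sum_sq_le[of 1 "h N x" "g x - h N x"] by (simp add: norm_minus_commute)
  then have g: "g \<in> L2_periodic"
    by (intro L2_combine(1)[OF h[of N] hNg pg gm, where A = 2 and B = 2]) auto
  have "(norm (h n x - g x))\<^sup>2 \<le> 2 * (norm (h n x))\<^sup>2 + 2 * (norm (g x))\<^sup>2" for n x
    using norm_sum_sq_le[of 1 "h n x" "- g x"] by simp
  then have "(\<lambda>x. h n x - g x) \<in> L2_periodic" for n
    by (intro L2_combine(1)[OF h[of n] g pd md, where A = 2 and B = 2]) auto
  then show ?thesis by (rule that[OF g _ concl])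
qed

text \<open>
  A pointwise limit of an energy-Cauchy sequence is also its limit in energy. For \<open>s \<noteq> 1\<close>
  this is lower semicontinuity. For \<open>s = 1\<close> the derivatives converge in mean square, and
  the limit is identified as the derivative of \<open>g\<close> by passing to the limit in
  \<open>v n t = v n 0 + prim (h n) t\<close> on one period.
\<close>

lemma energy_complete:
  fixes v :: "nat \<Rightarrow> real \<Rightarrow> 'b::euclidean_space"
  assumes v: "\<And>n. continuous_on UNIV (v n)" "\<And>n. periodic1 (v n)" "\<And>n. energy s (v n) < \<infinity>"
    and g: "continuous_on UNIV g" and lim: "\<And>x. (\<lambda>n. v n x) \<longlonglongrightarrow> g x"
    and cauchy: "\<And>e. 0 < e \<Longrightarrow> \<exists>N. \<forall>m\<ge>N. \<forall>n\<ge>N. energy s (\<lambda>x. v m x - v n x) \<le> ennreal e"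
    and e: "0 < e"
  shows "\<exists>N. \<forall>n\<ge>N. energy s (\<lambda>x. v n x - g x) \<le> ennreal e"
proof (cases "s = 1")
  case False
  obtain N where N: "\<forall>m\<ge>N. \<forall>n\<ge>N. energy s (\<lambda>x. v m x - v n x) \<le> ennreal e" using cauchy[OF e] by blast
  have "energy s (\<lambda>x. v n x - g x) \<le> ennreal e" if n: "n \<ge> N" for n
  proof -
    have "gagliardo_sq s (\<lambda>x. v n x - g x) \<le> liminf (\<lambda>m. gagliardo_sq s (\<lambda>x. v n x - v m x))"
      by (rule gagliardo_lsc)
         (use v(1) lim in \<open>auto intro!: borel_measurable_continuous_onI continuous_intros tendsto_intros\<close>)
    also have "\<dots> \<le> ennreal e"
      by (rule liminf_le_of_eventually)
         (use N n in \<open>auto simp: eventually_sequentially energy_not_1[OF False] intro!: exI[of _ N]\<close>)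
    finally show ?thesis by (simp add: energy_not_1[OF False])
  qed
  then show ?thesis by blast
next
  case True
  have "\<exists>h. h \<in> L2_periodic \<and> (\<forall>t. v n t = v n 0 + prim h t)" for n
  proof -
    have "energy 1 (v n) < \<infinity>" using v(3)[of n] True by simp
    then show ?thesis by (rule energy_1_finite) (intro exI conjI allI)
  qed
  then obtain h where hh: "\<forall>n. h n \<in> L2_periodic \<and> (\<forall>t. v n t = v n 0 + prim (h n) t)" by metis
  have h1: "h n \<in> L2_periodic" for n by (rule spec[OF hh, THEN conjunct1])
  have h2: "v n t = v n 0 + prim (h n) t" for n t by (rule spec[OF spec[OF hh, THEN conjunct2]])
  note h = h1 h2
  note lh = L2_periodicD(2)[OF h(1)]
  have dL2: "(\<lambda>x. h m x - h n x) \<in> L2_periodic" for m n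
  proof -
    have "(norm (h m x - h n x))\<^sup>2 \<le> 2 * (norm (h m x))\<^sup>2 + 2 * (norm (h n x))\<^sup>2" for x
      using norm_sum_sq_le[of 1 "h m x" "- h n x"] by simp
    then show ?thesis
      using L2_periodicD(1,4)[OF h(1)[of m]] L2_periodicD(1,4)[OF h(1)[of n]]
      by (intro L2_combine(1)[OF h(1)[of m] h(1)[of n], where A = 2 and B = 2]) (auto simp: periodic1_def)
  qed
  have en: "energy 1 (\<lambda>x. v m x - v n x) = ennreal (L2_norm_sq (\<lambda>x. h m x - h n x))" for m n
  proof (rule energy_1_eq[OF dL2])
    fix t
    have "v m t - v n t = (v m 0 + prim (h m) t) - (v n 0 + prim (h n) t)"
      unfolding h(2)[symmetric] ..
    then show "v m t - v n t = v m 0 - v n 0 + prim (\<lambda>x. h m x - h n x) t"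
      using prim_minus[OF lh lh] by simp
  qed
  have L2c: "\<exists>N. \<forall>m\<ge>N. \<forall>n\<ge>N. L2_norm_sq (\<lambda>x. h m x - h n x) \<le> e" if "0 < e" for e
    using cauchy[OF that] that unfolding True en by (simp add: ennreal_le_iff)
  obtain k where k: "k \<in> L2_periodic" "\<And>n. (\<lambda>x. h n x - k x) \<in> L2_periodic"
    "\<And>e N. 0 \<le> e \<Longrightarrow> \<forall>m\<ge>N. \<forall>n\<ge>N. L2_norm_sq (\<lambda>x. h m x - h n x) \<le> e \<Longrightarrow> \<forall>n\<ge>N. L2_norm_sq (\<lambda>x. h n x - k x) \<le> e"
    using L2_complete[of h, OF h(1) L2c] by blast
  note lk = L2_periodicD(2)[OF k(1)]
  have pk01: "g t = g 0 + prim k t" if t: "0 \<le> t" "t \<le> 1" for t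
  proof -
    have "(\<lambda>n. prim (h n) t) \<longlonglongrightarrow> prim k t"
    proof (rule LIMSEQ_I)
      fix \<delta> :: real assume \<delta>: "0 < \<delta>"
      have "0 < \<delta>\<^sup>2 / 4" using \<delta> by simp
      obtain N where "\<forall>m\<ge>N. \<forall>n\<ge>N. L2_norm_sq (\<lambda>x. h m x - h n x) \<le> \<delta>\<^sup>2 / 4" using L2c[OF \<open>0 < \<delta>\<^sup>2 / 4\<close>] by blast
      with k(3)[of "\<delta>\<^sup>2 / 4" N] have N: "\<forall>n\<ge>N. L2_norm_sq (\<lambda>x. h n x - k x) \<le> \<delta>\<^sup>2 / 4" by simp
      have "norm (prim (h n) t - prim k t) < \<delta>" if n: "n \<ge> N" for n
      proof -
        have "norm (prim (h n) t - prim k t) = norm (prim (\<lambda>x. h n x - k x) t - prim (\<lambda>x. h n x - k x) 0)"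
          using prim_minus[OF lh lk] by simp
        also have "\<dots> \<le> \<delta> / 2 + L2_norm_sq (\<lambda>x. h n x - k x) / (2 * \<delta>)"
          using t by (intro norm_prim_diff_le k(2) \<delta>) auto
        also have "\<dots> \<le> \<delta> / 2 + (\<delta>\<^sup>2 / 4) / (2 * \<delta>)"
          using N n \<delta> by (intro add_left_mono divide_right_mono) auto
        also have "\<dots> < \<delta>" using \<delta> by (simp add: power2_eq_square)
        finally show ?thesis .
      qed
      then show "\<exists>N. \<forall>n\<ge>N. norm (prim (h n) t - prim k t) < \<delta>" by (intro exI allI impI)
    qed
    then have "(\<lambda>n. v n 0 + prim (h n) t) \<longlonglongrightarrow> g 0 + prim k t" by (intro tendsto_add lim)
    then have "(\<lambda>n. v n t) \<longlonglongrightarrow> g 0 + prim k t" unfolding h(2)[symmetric] .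
    with lim[of t] show ?thesis by (rule LIMSEQ_unique)
  qed
  have pg: "periodic1 g"
    unfolding periodic1_def
  proof
    fix t
    have "(\<lambda>n. v n (t + 1)) = (\<lambda>n. v n t)" using v(2) by (simp add: periodic1_def)
    with lim[of "t + 1"] have "(\<lambda>n. v n t) \<longlonglongrightarrow> g (t + 1)" by simp
    then show "g (t + 1) = g t" using lim[of t] by (rule LIMSEQ_unique)
  qed
  have "g 1 = g 0" using pg unfolding periodic1_def by (metis add_0)
  then have "prim k 1 = 0" using pk01[of 1] by simp
  then have "periodic1 (prim k)" by (rule periodic1_prim[OF lk L2_periodicD(1)[OF k(1)]])
  then have pr: "periodic1 (\<lambda>t. g 0 + prim k t)" by (simp add: periodic1_def)
  have pk: "g t = g 0 + prim k t" for t by (rule periodic1_eqI[OF pg pr pk01])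
  obtain N where "\<forall>m\<ge>N. \<forall>n\<ge>N. L2_norm_sq (\<lambda>x. h m x - h n x) \<le> e" using L2c[OF e] by blast
  with k(3)[of e N] e have N: "\<forall>n\<ge>N. L2_norm_sq (\<lambda>x. h n x - k x) \<le> e" by simp
  have "energy 1 (\<lambda>x. v n x - g x) \<le> ennreal e" if n: "n \<ge> N" for n
  proof -
    have "energy 1 (\<lambda>x. v n x - g x) \<le> ennreal (L2_norm_sq (\<lambda>x. h n x - k x))"
    proof (rule energy_1_le[OF k(2)])
      fix t
      have "v n t - g t = (v n 0 + prim (h n) t) - (g 0 + prim k t)"
        unfolding h(2)[symmetric] pk[symmetric] ..
      then show "v n t - g t = v n 0 - g 0 + prim (\<lambda>x. h n x - k x) t"
        using prim_minus[OF lh lk] by simp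
    qed
    also have "\<dots> \<le> ennreal e" using N n by (intro ennreal_leI) auto
    finally show ?thesis .
  qed
  then show ?thesis unfolding True by (intro exI allI impI)
qed

lemma L2_norm_sq_le_sup:
  assumes "continuous_on UNIV v" "periodic1 v" and "\<And>t. norm (v t) \<le> a"
  shows "L2_norm_sq v \<le> a\<^sup>2"
proof -
  have a: "0 \<le> a" using assms(3)[of 0] by (rule order_trans[OF norm_ge_zero])
  have "(\<integral>\<^sup>+x\<in>{0..1}. ennreal ((norm (v x))\<^sup>2) \<partial>lborel) \<le> (\<integral>\<^sup>+x. ennreal (a\<^sup>2) * indicator {0..1::real} x \<partial>lborel)"
    using assms(3) a by (intro nn_integral_mono mult_right_mono ennreal_leI power_mono) auto
  also have "\<dots> = ennreal (a\<^sup>2)" using nn_integral_const_Icc[of "a\<^sup>2" 0 1] by simp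
  finally show ?thesis
    using assms(1,2) by (intro L2_periodic_of_nn_integral(2)) (auto intro: borel_measurable_continuous_onI)
qed

lemma norm_prim_continuous_le:
  assumes "continuous_on UNIV v" "\<And>t. norm (v t) \<le> a" "0 \<le> t"
  shows "norm (prim v t) \<le> a * t"
proof -
  have "norm (integral {0..t} v) \<le> a * (t - 0)"
    using assms by (intro integral_bound) (auto intro: continuous_on_subset)
  then show ?thesis using prim_eq_integral[OF loc_integrable_continuous[OF assms(1)] assms(3)] by simp
qed

section \<open>The sup bound\<close>

text \<open>
  For \<open>s = 1\<close>, \<open>v\<close> differs from its values in a unit interval by at most the integral of
  \<open>\<bar>h\<bar>\<close>, and it remains to take the mean. For \<open>s \<noteq> 1\<close>, the embedding is applied to
  \<open>prim v\<close>, whose derivative is \<open>v\<close>.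
\<close>

lemma sup_bound_affine:
  assumes s: "1/2 < s"
  obtains K where "0 < K" "\<And>(v :: real \<Rightarrow> 'b::euclidean_space) t. continuous_on UNIV v \<Longrightarrow> periodic1 v \<Longrightarrow> energy s v < \<infinity> \<Longrightarrow>
    norm (v t) \<le> K * (1 + L2_norm_sq v + enn2real (energy s v))"
proof (cases "s = 1")
  case True
  have "norm (v t) \<le> 1 * (1 + L2_norm_sq v + enn2real (energy s v))"
    if v: "continuous_on UNIV v" "periodic1 v" "energy s v < \<infinity>" for v :: "real \<Rightarrow> 'b" and t
  proof -
    obtain h where h: "h \<in> L2_periodic" "\<And>t. v t = v 0 + prim h t" "energy 1 v = ennreal (L2_norm_sq h)"
      using energy_1_finite[of v] v(3) True by metis
    have vL2: "v \<in> L2_periodic" using v by (intro L2_periodic_continuous)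
    define c where "c = 1/2 + L2_norm_sq h / 2"
    have lc: "loc_integrable (\<lambda>_::real. a)" for a :: real by (intro loc_integrable_continuous) auto
    have "norm (v t) \<le> norm (v x) + c" if x: "x \<in> {t..t + 1}" for x
    proof -
      have "v x - v t = (v 0 + prim h x) - (v 0 + prim h t)" unfolding h(2)[symmetric] ..
      also have "\<dots> = prim h x - prim h t" by simp
      finally have "norm (v x - v t) \<le> c"
        using norm_prim_diff_le[OF h(1), of t x 1] x by (simp add: c_def)
      then show ?thesis using norm_triangle_ineq2[of "v t" "v x"] by (simp add: norm_minus_commute)
    qed
    moreover have ln: "set_integrable lborel {t..t + 1} (\<lambda>x. norm (v x))"
      using loc_integrable_set[OF L2_periodicD(2)[OF vL2]] by (rule set_integrable_norm)
    ultimately have "(LINT x:{t..t + 1}|lborel. norm (v t)) \<le> (LINT x:{t..t + 1}|lborel. norm (v x) + c)"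
      by (intro set_integral_mono loc_integrable_set[OF lc] set_integral_add(1)) auto
    also have "\<dots> = (LINT x:{t..t + 1}|lborel. norm (v x)) + (LINT x:{t..t + 1}|lborel. c)"
      by (intro set_integral_add(2) ln loc_integrable_set[OF lc])
    also have const: "(LINT x:{t..t + 1}|lborel. a) = a" for a :: real
      using prim_diff[OF lc, of t "t + 1" a] by (simp add: prim_const algebra_simps)
    also have "(LINT x:{t..t + 1}|lborel. norm (v x)) \<le> 1/2 + L2_norm_sq v / 2"
      using periodic_mean_L2(2)[OF vL2, of 1 t] by simp
    finally have "norm (v t) \<le> 1/2 + L2_norm_sq v / 2 + c" unfolding const by simp
    also have "\<dots> \<le> 1 + L2_norm_sq v + L2_norm_sq h"
      unfolding c_def using L2_norm_sq_nonneg[of v] L2_norm_sq_nonneg[of h] by linarith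
    also have "L2_norm_sq h = enn2real (energy s v)" using h(3) True by simp
    finally show ?thesis by simp
  qed
  then show ?thesis by (rule that[OF zero_less_one])
next
  case False
  define A where "A = 1 / (1 - (1/2::real) powr (s - 1/2))"
  have "(1/2::real) powr (s - 1/2) < (1/2) powr 0" using s by (intro powr_less_mono') auto
  then have A: "0 < A" by (simp add: A_def)
  have "norm (v t) \<le> (A + 1) * (1 + L2_norm_sq v + enn2real (energy s v))"
    if v: "continuous_on UNIV v" "periodic1 v" "energy s v < \<infinity>" for v :: "real \<Rightarrow> 'b" and t
  proof -
    have vL2: "v \<in> L2_periodic" using v by (intro L2_periodic_continuous)
    have lv: "loc_integrable v" using v(1) by (rule loc_integrable_continuous)
    define G where "G = enn2real (energy s v)"
    have "0 \<le> G" by (simp add: G_def)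
    have fin: "gagliardo_sq s v < \<infinity>" using v(3) by (simp add: energy_not_1[OF False])
    have pv: "continuous_on UNIV (prim v)" by (rule continuous_on_prim[OF lv])
    have triv: "prim v t = prim v 0 + prim v t" for t by simp
    obtain w where w0: "continuous_on UNIV w" and w: "\<And>t. (prim v has_vector_derivative w t) (at t)"
      "\<And>t. norm (w t) \<le> norm (2 *\<^sub>R (prim v (t + 1/2) - prim v t))
        + (enn2real (gagliardo_sq s v) + 1) * (1 / (1 - (1/2) powr (s - 1/2)))"
      by (rule gagliardo_embedding[OF pv lv v(2) triv s fin]) (rule that; blast)
    have "w t = v t"
      using w(1)[of t] prim_has_vector_derivative[OF v(1), of t] by (rule vector_derivative_unique_at)
    then have "norm (v t) \<le> norm (2 *\<^sub>R (prim v (t + 1/2) - prim v t)) + (G + 1) * A"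
      using w(2)[of t] unfolding G_def energy_not_1[OF False] A_def[symmetric] by simp
    also have "norm (2 *\<^sub>R (prim v (t + 1/2) - prim v t)) \<le> 2 * (1/2 + L2_norm_sq v / 2)"
      using norm_prim_diff_le[OF vL2, of t "t + 1/2" 1] by simp
    also have "2 * (1/2 + L2_norm_sq v / 2) + (G + 1) * A \<le> (A + 1) * (1 + L2_norm_sq v + G)"
      using A \<open>0 \<le> G\<close> mult_nonneg_nonneg[of A "L2_norm_sq v"] by (simp add: algebra_simps)
    finally show ?thesis by (simp add: G_def)
  qed
  then show ?thesis using A by (intro that[of "A + 1"]) auto
qed

lemma L2_norm_sq_scaleR: "L2_norm_sq (\<lambda>x. c *\<^sub>R v x) = c\<^sup>2 * L2_norm_sq v"
  by (simp add: L2_norm_sq_def power_mult_distrib)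

text \<open>
  Homogeneity turns the affine bound into a norm bound: it is applied to multiples \<open>c v\<close>,
  where \<open>c\<close> is the inverse of the norm of \<open>v\<close>, or arbitrarily large if this norm is \<open>0\<close>.
\<close>

lemma sup_bound:
  assumes s: "1/2 < s"
  obtains K where "0 < K" "\<And>(v :: real \<Rightarrow> 'b::euclidean_space) t. continuous_on UNIV v \<Longrightarrow> periodic1 v \<Longrightarrow> energy s v < \<infinity> \<Longrightarrow>
    norm (v t) \<le> K * sqrt (L2_norm_sq v + enn2real (energy s v))"
proof -
  obtain K where K: "0 < K" "\<And>(v :: real \<Rightarrow> 'b) t. continuous_on UNIV v \<Longrightarrow> periodic1 v \<Longrightarrow> energy s v < \<infinity> \<Longrightarrow>
    norm (v t) \<le> K * (1 + L2_norm_sq v + enn2real (energy s v))"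
    by (rule sup_bound_affine[OF s, where 'b = 'b]) (rule that; blast)
  have "norm (v t) \<le> (2 * K) * sqrt (L2_norm_sq v + enn2real (energy s v))"
    if v: "continuous_on UNIV v" "periodic1 v" "energy s v < \<infinity>" for v :: "real \<Rightarrow> 'b" and t
  proof -
    define N where "N = L2_norm_sq v + enn2real (energy s v)"
    have N: "0 \<le> N" by (simp add: N_def)
    have scaled: "c * norm (v t) \<le> K * (1 + c\<^sup>2 * N)" if c: "0 \<le> c" for c
    proof -
      let ?w = "\<lambda>x. c *\<^sub>R v x"
      have e: "energy s ?w \<le> ennreal (c\<^sup>2) * energy s v" by (rule energy_scaleR_le[OF v(1,3)])
      also have "\<dots> = ennreal (c\<^sup>2 * enn2real (energy s v))"
        using v(3) by (simp add: ennreal_mult' less_top)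
      finally have e': "energy s ?w \<le> ennreal (c\<^sup>2 * enn2real (energy s v))" .
      then have fin: "energy s ?w < \<infinity>" by (rule le_less_trans) simp
      have "enn2real (energy s ?w) \<le> c\<^sup>2 * enn2real (energy s v)"
        using enn2real_mono[OF e'] by simp
      moreover have "norm (?w t) \<le> K * (1 + L2_norm_sq ?w + enn2real (energy s ?w))"
        using v by (intro K(2) fin continuous_intros) (auto simp: periodic1_def)
      moreover have "K * (1 + L2_norm_sq ?w + enn2real (energy s ?w)) \<le> K * (1 + L2_norm_sq ?w + c\<^sup>2 * enn2real (energy s v))"
        using K(1) calculation(1) by (intro mult_left_mono) auto
      ultimately show ?thesis using c by (simp add: N_def L2_norm_sq_scaleR distrib_left add.assoc)
    qed
    show ?thesis
    proof (cases "N = 0")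
      case True
      have "norm (v t) \<le> 0"
      proof (rule ccontr)
        assume "\<not> norm (v t) \<le> 0"
        then have pos: "norm (v t) > 0" by simp
        \<comment> \<open>Here \<open>N = 0\<close>, so that \<open>c \<bar>v t\<bar> \<le> K\<close> for every \<open>c\<close>.\<close>
        have "(2 * K / norm (v t)) * norm (v t) \<le> K" using scaled[of "2 * K / norm (v t)"] K(1) True by simp
        then show False using pos K(1) by simp
      qed
      then show ?thesis using K(1) N by (simp add: N_def[symmetric] True)
    next
      case False
      then have pos: "0 < sqrt N" using N by simp
      have "(1 / sqrt N) * norm (v t) \<le> K * (1 + (1 / sqrt N)\<^sup>2 * N)" using pos by (intro scaled) auto
      also have "\<dots> = 2 * K" using N False by (simp add: power_divide)
      finally show ?thesis using pos by (simp add: N_def[symmetric] field_simps)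
    qed
  qed
  then show ?thesis using K(1) by (intro that[of "2 * K"]) auto
qed

section \<open>The Sobolev space in terms of classical velocities\<close>

lemma continuous_of_derivative:
  fixes \<psi> :: "real \<Rightarrow> real"
  assumes "\<And>t. (\<psi> has_real_derivative \<psi>' t) (at t)" shows "continuous_on UNIV \<psi>"
  using assms by (meson DERIV_isCont continuous_at_imp_continuous_on)

text \<open>
  The difference of two weak derivatives is a weak derivative of the continuous function
  \<open>0\<close>, hence has primitive \<open>0\<close>.
\<close>

lemma has_weak_derivative_unique:
  assumes g: "g \<in> L2_periodic" "has_weak_derivative f g" and h: "h \<in> L2_periodic" "has_weak_derivative f h"
  shows "AE x in lborel. g x = h x"
proof -
  note lg = L2_periodicD(2)[OF g(1)] and lh = L2_periodicD(2)[OF h(1)]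
  have "has_weak_derivative (\<lambda>_. 0) (\<lambda>x. g x - h x)"
    unfolding has_weak_derivative_def
  proof (intro allI impI)
    fix \<psi> \<psi>' :: "real \<Rightarrow> real"
    assume \<psi>: "periodic1 \<psi> \<and> (\<forall>t. (\<psi> has_real_derivative \<psi>' t) (at t)) \<and> continuous_on UNIV \<psi>'"
    then have c: "continuous_on UNIV \<psi>" by (intro continuous_of_derivative[of \<psi> \<psi>']) auto
    have "(LINT t:{0..1}|lborel. \<psi> t *\<^sub>R (g t - h t)) = (LINT t:{0..1}|lborel. \<psi> t *\<^sub>R g t) - (LINT t:{0..1}|lborel. \<psi> t *\<^sub>R h t)"
      unfolding scaleR_diff_right
      by (intro set_integral_diff(2) set_integrable_scaleR_continuous c lg lh)
    also have "\<dots> = 0"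
      using g(2)[unfolded has_weak_derivative_def, rule_format, OF \<psi>]
        h(2)[unfolded has_weak_derivative_def, rule_format, OF \<psi>] by simp
    finally show "(LINT t:{0..1}|lborel. \<psi>' t *\<^sub>R 0) = - (LINT t:{0..1}|lborel. \<psi> t *\<^sub>R (g t - h t))"
      by (simp add: set_lebesgue_integral_def)
  qed
  moreover have "periodic1 (\<lambda>x. g x - h x)"
    using L2_periodicD(1)[OF g(1)] L2_periodicD(1)[OF h(1)] by (simp add: periodic1_def)
  ultimately have "0 = 0 + prim (\<lambda>x. g x - h x) t" for t
    using du_Bois_Reymond_continuous[of "\<lambda>_. 0" "\<lambda>x. g x - h x" t] loc_integrable_diff[OF lg lh]
    by (simp add: periodic1_def)
  then have "prim g t = prim h t" for t using prim_minus[OF lg lh, of t] by simp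
  then show ?thesis by (intro AE_eq_of_prim_eq lg lh ext)
qed

lemma has_weak_derivative_cong_AE:
  assumes ae: "AE x in lborel. f x = f' x" and m: "f \<in> borel_measurable borel" "f' \<in> borel_measurable borel"
  shows "has_weak_derivative f g \<longleftrightarrow> has_weak_derivative f' g"
proof -
  have "(LINT t:{0..1}|lborel. \<psi>' t *\<^sub>R f t) = (LINT t:{0..1}|lborel. \<psi>' t *\<^sub>R f' t)"
    if "continuous_on UNIV \<psi>'" for \<psi>' :: "real \<Rightarrow> real"
  proof -
    have [measurable]: "\<psi>' \<in> borel_measurable borel" using that by (rule borel_measurable_continuous_onI)
    note m [measurable]
    show ?thesis by (intro set_lebesgue_integral_cong_AE) (use ae in \<open>auto elim: eventually_mono\<close>)
  qed
  then show ?thesis unfolding has_weak_derivative_def by (intro all_cong1 imp_cong refl) auto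
qed

lemma weak_deriv:
  assumes "weakly_differentiable f"
  shows "weak_deriv f \<in> L2_periodic" "has_weak_derivative f (weak_deriv f)"
proof -
  have "\<exists>g. g \<in> L2_periodic \<and> has_weak_derivative f g"
    using assms by (auto simp: weakly_differentiable_def)
  then have "weak_deriv f \<in> L2_periodic \<and> has_weak_derivative f (weak_deriv f)"
    unfolding weak_deriv_def by (rule someI_ex)
  then show "weak_deriv f \<in> L2_periodic" "has_weak_derivative f (weak_deriv f)" by auto
qed

lemma weak_deriv_AE:
  assumes "g \<in> L2_periodic" "has_weak_derivative f g"
  shows "weakly_differentiable f" "AE x in lborel. weak_deriv f x = g x"
proof -
  show w: "weakly_differentiable f" using assms by (auto simp: weakly_differentiable_def)
  show "AE x in lborel. weak_deriv f x = g x"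
    by (rule has_weak_derivative_unique[OF weak_deriv[OF w] assms])
qed

lemma has_weak_derivative_primitive:
  fixes u h :: "real \<Rightarrow> 'b::euclidean_space"
  assumes h: "loc_integrable h" and u: "\<And>t. u t = u 0 + prim h t" and p: "periodic1 u"
  shows "has_weak_derivative u h"
  unfolding has_weak_derivative_def
proof (intro allI impI)
  fix \<psi> \<psi>' :: "real \<Rightarrow> real"
  assume "periodic1 \<psi> \<and> (\<forall>t. (\<psi> has_real_derivative \<psi>' t) (at t)) \<and> continuous_on UNIV \<psi>'"
  then have \<psi>: "periodic1 \<psi>" "\<And>t. (\<psi> has_real_derivative \<psi>' t) (at t)" "continuous_on UNIV \<psi>'" by auto
  have "u 1 = u 0" using p unfolding periodic1_def by (metis add_0)
  then have h1: "prim h 1 = 0" using u[of 1] by simp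
  have l: "loc_integrable \<psi>'" by (rule loc_integrable_continuous[OF \<psi>(3)])
  have "\<psi> 1 = \<psi> 0" using \<psi>(1) unfolding periodic1_def by (metis add_0)
  then have "prim \<psi>' 1 = 0"
    using prim_of_derivative[of \<psi> \<psi>' 1] \<psi>(2,3) by (simp add: has_real_derivative_iff_has_vector_derivative)
  then have c: "(LINT t:{0..1}|lborel. \<psi>' t *\<^sub>R u 0) = 0"
    using prim_bounded_linear[OF bounded_linear_scaleR_left l, of "u 0" 1] by (simp add: prim_1)
  have "(LINT t:{0..1}|lborel. \<psi>' t *\<^sub>R u t) = (LINT t:{0..1}|lborel. \<psi>' t *\<^sub>R u 0 + \<psi>' t *\<^sub>R prim h t)"
    by (simp only: scaleR_add_right[symmetric] u[symmetric])
  also have "\<dots> = (LINT t:{0..1}|lborel. \<psi>' t *\<^sub>R u 0) + (LINT t:{0..1}|lborel. \<psi>' t *\<^sub>R prim h t)"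
    by (intro set_integral_add(2) set_integrable_scaleR_continuous \<psi>(3) loc_integrable_continuous
        continuous_on_prim h continuous_on_const)
  also have "\<dots> = - (LINT t:{0..1}|lborel. \<psi> t *\<^sub>R h t)"
    using weak_product_rule[OF h h1 \<psi>] c by simp
  finally show "(LINT t:{0..1}|lborel. \<psi>' t *\<^sub>R u t) = - (LINT t:{0..1}|lborel. \<psi> t *\<^sub>R h t)" .
qed

lemma has_weak_derivative_uminus:
  fixes f g :: "real \<Rightarrow> 'a::euclidean_space"
  shows "has_weak_derivative (\<lambda>x. - f x) (\<lambda>x. - g x) \<longleftrightarrow> has_weak_derivative f g"
proof -
  have neg: "(LINT t:{0..1}|lborel. c t *\<^sub>R - k t) = - (LINT t:{0..1}|lborel. c t *\<^sub>R k t)" for c and k :: "real \<Rightarrow> 'a"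
    by (simp add: set_lebesgue_integral_def)
  show ?thesis unfolding has_weak_derivative_def neg neg_equal_iff_equal ..
qed

lemma L2_periodic_uminus: "g \<in> L2_periodic \<Longrightarrow> (\<lambda>x. - g x) \<in> L2_periodic"
  by (auto simp: L2_periodic_def periodic1_def)

lemma weakly_differentiable_uminus: "weakly_differentiable (\<lambda>x. - f x) \<longleftrightarrow> weakly_differentiable f"
proof -
  have "weakly_differentiable (\<lambda>x. - f x)" if "weakly_differentiable f" for f :: "real \<Rightarrow> 'a"
    using weak_deriv_AE(1)[OF L2_periodic_uminus[OF weak_deriv(1)[OF that]], of "\<lambda>x. - f x"]
      weak_deriv(2)[OF that] by (simp add: has_weak_derivative_uminus)
  from this[of f] this[of "\<lambda>x. - f x"] show ?thesis by auto
qed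

lemma weak_deriv_undefined:
  assumes "\<not> weakly_differentiable f" "\<not> weakly_differentiable g"
  shows "weak_deriv f = weak_deriv g"
proof -
  have "(\<lambda>h. h \<in> L2_periodic \<and> has_weak_derivative f h) = (\<lambda>h. h \<in> L2_periodic \<and> has_weak_derivative g h)"
    using assms by (auto simp: weakly_differentiable_def fun_eq_iff)
  then show ?thesis unfolding weak_deriv_def by simp
qed

lemma weak_deriv_uminus_AE:
  assumes w: "weakly_differentiable f"
  shows "AE x in lborel. weak_deriv (\<lambda>x. - f x) x = - weak_deriv f x"
  using weak_deriv_AE(2)[OF L2_periodic_uminus[OF weak_deriv(1)[OF w]], of "\<lambda>x. - f x"]
    weak_deriv(2)[OF w] by (simp add: has_weak_derivative_uminus)

lemma L2_norm_sq_uminus: "L2_norm_sq (\<lambda>x. - f x) = L2_norm_sq f"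
  by (simp add: L2_norm_sq_def)

lemma L2_norm_sq_weak_deriv_uminus: "L2_norm_sq (weak_deriv (\<lambda>x. - f x)) = L2_norm_sq (weak_deriv f)"
proof (cases "weakly_differentiable f")
  case True
  then have "L2_norm_sq (weak_deriv (\<lambda>x. - f x)) = L2_norm_sq (\<lambda>x. - weak_deriv f x)"
    using L2_periodicD(4)[OF weak_deriv(1)] weakly_differentiable_uminus[of f]
    by (intro L2_norm_sq_cong_AE weak_deriv_uminus_AE) auto
  then show ?thesis by (simp add: L2_norm_sq_uminus)
next
  case False
  then show ?thesis using weak_deriv_undefined[of f "\<lambda>x. - f x"] weakly_differentiable_uminus[of f] by simp
qed

lemma weak_deriv_cong:
  assumes "\<And>g. has_weak_derivative f g \<longleftrightarrow> has_weak_derivative f' g"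
  shows "weak_deriv f = weak_deriv f'" "weakly_differentiable f \<longleftrightarrow> weakly_differentiable f'"
  unfolding weak_deriv_def weakly_differentiable_def assms by auto

text \<open>
  The identity is needed also outside of the Sobolev space. Where a function has no weak
  derivative, \<open>weak_deriv\<close> is an unspecified value, but one that is the same for \<open>\<gamma>\<close> and
  \<open>- \<gamma>\<close>.
\<close>

lemma sobolev_norm_uminus: "sobolev_norm s (- \<gamma>) = sobolev_norm s \<gamma>"
proof -
  let ?g = "apply_bcontfun \<gamma>"
  let ?f = "weak_deriv ?g" and ?f' = "weak_deriv (\<lambda>x. - ?g x)"
  have g: "apply_bcontfun (- \<gamma>) = (\<lambda>x. - ?g x)" by (simp add: fun_eq_iff)
  have third: "L2_norm_sq (weak_deriv ?f') = L2_norm_sq (weak_deriv ?f) \<and> gagliardo_sq s ?f' = gagliardo_sq s ?f"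
  proof (cases "weakly_differentiable ?g")
    case True
    then have w': "weakly_differentiable (\<lambda>x. - ?g x)" by (simp add: weakly_differentiable_uminus)
    have m: "?f \<in> borel_measurable borel" "?f' \<in> borel_measurable borel" "(\<lambda>x. - ?f x) \<in> borel_measurable borel"
      using L2_periodicD(4)[OF weak_deriv(1)[OF True]] L2_periodicD(4)[OF weak_deriv(1)[OF w']] by auto
    note ae = weak_deriv_uminus_AE[OF True]
    have "weak_deriv ?f' = weak_deriv (\<lambda>x. - ?f x)"
      by (intro weak_deriv_cong has_weak_derivative_cong_AE ae m)
    then have 1: "L2_norm_sq (weak_deriv ?f') = L2_norm_sq (weak_deriv ?f)"
      by (simp add: L2_norm_sq_weak_deriv_uminus)
    have "gagliardo_sq s ?f' = gagliardo_sq s (\<lambda>x. - ?f x)" by (intro gagliardo_cong_AE ae m)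
    also have "\<dots> = gagliardo_sq s ?f" by (simp add: gagliardo_sq_def norm_minus_commute)
    finally show ?thesis using 1 by simp
  next
    case False
    then show ?thesis using weak_deriv_undefined[of ?g "\<lambda>x. - ?g x"] by (simp add: weakly_differentiable_uminus)
  qed
  then show ?thesis
    unfolding sobolev_norm_def g by (simp add: L2_norm_sq_uminus L2_norm_sq_weak_deriv_uminus)
qed

lemma sobolev_norm_nonneg: "0 \<le> sobolev_norm s \<gamma>"
  unfolding sobolev_norm_def by (intro real_sqrt_ge_zero add_nonneg_nonneg) auto

text \<open>
  The space \<open>H\<^sup>s\<close> of continuous representatives, to which the velocities of curves in
  \<open>H\<^sup>1\<^sup>+\<^sup>s\<close> belong when \<open>s > 1/2\<close>.
\<close>

definition sobolev_fun :: "real \<Rightarrow> (real \<Rightarrow> 'b::euclidean_space) set" where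
  "sobolev_fun s = {v. continuous_on UNIV v \<and> periodic1 v \<and> energy s v < \<infinity>}"

lemma sobolev_funD:
  assumes "v \<in> sobolev_fun s"
  shows "continuous_on UNIV v" "periodic1 v" "energy s v < \<infinity>" "v \<in> L2_periodic"
  using assms L2_periodic_continuous unfolding sobolev_fun_def by auto

lemma periodic1_derivative:
  assumes "periodic1 \<gamma>" "\<And>t. (\<gamma> has_vector_derivative v t) (at t)" shows "periodic1 v"
  unfolding periodic1_def
proof
  fix t
  have "((\<lambda>x. \<gamma> (x + 1)) has_vector_derivative 1 *\<^sub>R v (t + 1)) (at t)"
    by (rule vector_diff_chain_at[of "\<lambda>x. x + 1" 1 t \<gamma>, unfolded o_def])
       (auto intro!: derivative_eq_intros assms(2))
  moreover have "(\<lambda>x. \<gamma> (x + 1)) = \<gamma>" using assms(1) by (simp add: periodic1_def)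
  ultimately have "(\<gamma> has_vector_derivative v (t + 1)) (at t)" by simp
  then show "v (t + 1) = v t" using assms(2)[of t] by (rule vector_derivative_unique_at)
qed

lemma continuous_on_bcontfun: "continuous_on A (apply_bcontfun \<gamma>)"
  using apply_bcontfun[of \<gamma>] by (auto simp: bcontfun_def intro: continuous_on_subset)

lemma weak_deriv_of_derivative:
  assumes \<gamma>: "periodic1 \<gamma>" and d: "\<And>t. (\<gamma> has_vector_derivative v t) (at t)" and v: "continuous_on UNIV v"
  shows "weakly_differentiable \<gamma>" "AE x in lborel. weak_deriv \<gamma> x = v x"
proof -
  have "\<gamma> t = \<gamma> 0 + prim v t" for t using prim_of_derivative[OF d v, of t] by simp
  then have "has_weak_derivative \<gamma> v"
    by (rule has_weak_derivative_primitive[OF loc_integrable_continuous[OF v] _ \<gamma>])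
  then show "weakly_differentiable \<gamma>" "AE x in lborel. weak_deriv \<gamma> x = v x"
    using weak_deriv_AE[of v \<gamma>] L2_periodic_continuous[OF periodic1_derivative[OF \<gamma> d] v] by auto
qed

text \<open>
  The elements of \<open>sobolev s\<close> are continuously differentiable with velocity in \<open>H\<^sup>s\<close>. For
  \<open>s \<noteq> 1\<close> this is the embedding applied to the weak derivative; for \<open>s = 1\<close> the weak
  derivative agrees almost everywhere with a primitive of the second weak derivative.
\<close>

lemma sobolevD:
  assumes s: "1/2 < s" and \<gamma>: "\<gamma> \<in> sobolev s"
  obtains v where "v \<in> sobolev_fun s" "\<And>t. (apply_bcontfun \<gamma> has_vector_derivative v t) (at t)"
proof -
  let ?g = "apply_bcontfun \<gamma>"
  have p: "periodic1 ?g" and w: "weakly_differentiable ?g"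
    and w2: "if s = 1 then weakly_differentiable (weak_deriv ?g) else gagliardo_sq s (weak_deriv ?g) < \<infinity>"
    using \<gamma> by (auto simp: sobolev_def)
  define f where "f = weak_deriv ?g"
  have f: "f \<in> L2_periodic" "has_weak_derivative ?g f" using weak_deriv[OF w] by (auto simp: f_def)
  note lf = L2_periodicD(2)[OF f(1)] and pf = L2_periodicD(1)[OF f(1)] and mf = L2_periodicD(4)[OF f(1)]
  have pr: "?g t = ?g 0 + prim f t" for t
    by (rule du_Bois_Reymond_continuous[OF continuous_on_bcontfun p lf pf f(2)])
  show ?thesis
  proof (cases "s = 1")
    case False
    have fin: "gagliardo_sq s f < \<infinity>" using w2 False by (simp add: f_def)
    obtain v where v: "continuous_on UNIV v" "\<And>t. (?g has_vector_derivative v t) (at t)"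
      by (rule gagliardo_embedding[OF continuous_on_bcontfun lf pf pr s fin]) (rule that; blast)
    have "prim f t = prim v t" for t
    proof -
      have "prim v t = ?g t - ?g 0" by (rule prim_of_derivative[OF v(2,1)])
      then show ?thesis using pr[of t] by (simp add: algebra_simps)
    qed
    then have "AE x in lborel. f x = v x"
      by (intro AE_eq_of_prim_eq lf loc_integrable_continuous v ext)
    then have "gagliardo_sq s f = gagliardo_sq s v"
      by (intro gagliardo_cong_AE mf borel_measurable_continuous_onI v)
    then have "v \<in> sobolev_fun s"
      using fin v(1) periodic1_derivative[OF p v(2)] by (simp add: sobolev_fun_def energy_not_1[OF False])
    then show ?thesis using v(2) by (rule that)
  next
    case True
    then have "weakly_differentiable f" using w2 by (simp add: f_def)
    then obtain h where h: "h \<in> L2_periodic" "has_weak_derivative f h" by (auto simp: weakly_differentiable_def)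
    note lh = L2_periodicD(2)[OF h(1)]
    obtain c where c: "AE x in lborel. f x = c + prim h x"
      by (rule du_Bois_Reymond[OF lf pf lh L2_periodicD(1)[OF h(1)] h(2)])
    define v where "v x = c + prim h x" for x
    have cv: "continuous_on UNIV v" unfolding v_def by (intro continuous_intros continuous_on_prim lh)
    have "prim f = prim v"
      using c unfolding v_def[symmetric] by (rule prim_cong_AE) (intro mf borel_measurable_continuous_onI cv)+
    then have g: "?g = (\<lambda>t. ?g 0 + prim v t)" by (intro ext trans[OF pr]) simp
    have "((\<lambda>t. ?g 0 + prim v t) has_vector_derivative 0 + v t) (at t)" for t
      by (intro has_vector_derivative_add has_vector_derivative_const prim_has_vector_derivative[OF cv])
    then have d: "(?g has_vector_derivative v t) (at t)" for t
      unfolding g[symmetric] by simp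
    have "v t = v 0 + prim h t" for t by (simp add: v_def)
    then have "energy 1 v \<le> ennreal (L2_norm_sq h)" by (rule energy_1_le[OF h(1)])
    then have "energy s v < \<infinity>" using True by (simp add: le_less_trans)
    then have "v \<in> sobolev_fun s" using cv periodic1_derivative[OF p d] by (simp add: sobolev_fun_def)
    then show ?thesis using d by (rule that)
  qed
qed

text \<open>
  Conversely, a continuously differentiable curve with velocity in \<open>H\<^sup>s\<close> belongs to the
  Sobolev space, and its norm is computed from the classical velocity in place of the
  unspecified weak derivatives.
\<close>

lemma sobolev_of_derivative:
  assumes p: "periodic1 (apply_bcontfun \<gamma>)" and v: "v \<in> sobolev_fun s"
    and d: "\<And>t. (apply_bcontfun \<gamma> has_vector_derivative v t) (at t)"
  shows "\<gamma> \<in> sobolev s"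
    "sobolev_norm s \<gamma> = sqrt (L2_norm_sq (apply_bcontfun \<gamma>) + L2_norm_sq v + enn2real (energy s v))"
proof -
  let ?g = "apply_bcontfun \<gamma>"
  note cv = sobolev_funD(1)[OF v] and pv = sobolev_funD(2)[OF v]
  define f where "f = weak_deriv ?g"
  note wd = weak_deriv_of_derivative[OF p d cv]
  have fL2: "f \<in> L2_periodic" using weak_deriv(1)[OF wd(1)] by (simp add: f_def)
  have ae: "AE x in lborel. f x = v x" using wd(2) by (simp add: f_def)
  have m: "f \<in> borel_measurable borel" "v \<in> borel_measurable borel"
    using L2_periodicD(4)[OF fL2] borel_measurable_continuous_onI[OF cv] by auto
  have L2: "L2_norm_sq f = L2_norm_sq v" by (rule L2_norm_sq_cong_AE[OF ae m])
  have "(if s = 1 then weakly_differentiable f else gagliardo_sq s f < \<infinity>) \<and>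
     (if s = 1 then L2_norm_sq (weak_deriv f) else enn2real (gagliardo_sq s f)) = enn2real (energy s v)"
  proof (cases "s = 1")
    case False
    then show ?thesis using gagliardo_cong_AE[OF m ae] sobolev_funD(3)[OF v] by (simp add: energy_not_1)
  next
    case True
    obtain h where h: "h \<in> L2_periodic" "\<And>t. v t = v 0 + prim h t" "energy 1 v = ennreal (L2_norm_sq h)"
      using energy_1_finite[of v] sobolev_funD(3)[OF v] True by metis
    have "has_weak_derivative v h"
      by (rule has_weak_derivative_primitive[OF L2_periodicD(2)[OF h(1)] h(2) pv])
    then have "has_weak_derivative f h" using has_weak_derivative_cong_AE[OF ae m] by blast
    note fh = weak_deriv_AE[OF h(1) this]
    have "L2_norm_sq (weak_deriv f) = L2_norm_sq h"
      by (rule L2_norm_sq_cong_AE[OF fh(2) L2_periodicD(4)[OF weak_deriv(1)[OF fh(1)]] L2_periodicD(4)[OF h(1)]])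
    then show ?thesis using True fh(1) h(3) by simp
  qed
  then show "\<gamma> \<in> sobolev s"
    "sobolev_norm s \<gamma> = sqrt (L2_norm_sq (apply_bcontfun \<gamma>) + L2_norm_sq v + enn2real (energy s v))"
    using p wd(1) L2 by (auto simp: sobolev_def sobolev_norm_def f_def split: if_splits)
qed

section \<open>The algebra of velocities\<close>

lemma sobolev_fun_add:
  assumes v: "v \<in> sobolev_fun s" and w: "w \<in> sobolev_fun s"
  shows "(\<lambda>x. v x + w x) \<in> sobolev_fun s"
proof -
  have "energy s (\<lambda>x. v x + w x) \<le> ennreal (1 + 1) * energy s v + ennreal (1 + 1 / 1) * energy s w"
    by (rule energy_add) (use sobolev_funD[OF v] sobolev_funD[OF w] in auto)
  also have "\<dots> < \<infinity>" using sobolev_funD(3)[OF v] sobolev_funD(3)[OF w] by (simp add: ennreal_mult_less_top)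
  finally show ?thesis
    using sobolev_funD(1,2)[OF v] sobolev_funD(1,2)[OF w]
    by (auto simp: sobolev_fun_def periodic1_def intro!: continuous_intros)
qed

lemma sobolev_fun_scaleR:
  assumes v: "v \<in> sobolev_fun s" shows "(\<lambda>x. c *\<^sub>R v x) \<in> sobolev_fun s"
proof -
  have "energy s (\<lambda>x. c *\<^sub>R v x) \<le> ennreal (c\<^sup>2) * energy s v"
    by (rule energy_scaleR_le[OF sobolev_funD(1,3)[OF v]])
  also have "\<dots> < \<infinity>" using sobolev_funD(3)[OF v] by (simp add: ennreal_mult_less_top)
  finally show ?thesis
    using sobolev_funD(1,2)[OF v] by (auto simp: sobolev_fun_def periodic1_def intro!: continuous_intros)
qed

lemma sobolev_fun_diff:
  assumes "v \<in> sobolev_fun s" "w \<in> sobolev_fun s" shows "(\<lambda>x. v x - w x) \<in> sobolev_fun s"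
  using sobolev_fun_add[OF assms(1) sobolev_fun_scaleR[OF assms(2), of "-1"]] by simp

lemma sobolev_fun_const: "(\<lambda>_. c) \<in> sobolev_fun s"
  by (simp add: sobolev_fun_def energy_const periodic1_def)

definition Hs_norm :: "real \<Rightarrow> (real \<Rightarrow> 'b::euclidean_space) \<Rightarrow> real" where
  "Hs_norm s v = sqrt (L2_norm_sq v + enn2real (energy s v))"

lemma Hs_norm_nonneg [simp]: "0 \<le> Hs_norm s v"
  by (simp add: Hs_norm_def)

lemma Hs_norm_sq: "(Hs_norm s v)\<^sup>2 = L2_norm_sq v + enn2real (energy s v)"
  by (simp add: Hs_norm_def)

text \<open>
  The right-hand side is smallest at \<open>t = b / a\<close>, where it equals \<open>(a + b)\<^sup>2\<close>.
\<close>

lemma triangle_of_quadratic: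
  fixes a b c :: real
  assumes "0 \<le> a" "0 \<le> b" "0 \<le> c" and le: "\<And>t. 0 < t \<Longrightarrow> c\<^sup>2 \<le> (1 + t) * a\<^sup>2 + (1 + 1 / t) * b\<^sup>2"
  shows "c \<le> a + b"
proof (rule field_le_epsilon)
  fix e :: real assume "0 < e"
  \<comment> \<open>Enlarging \<open>a\<close> and \<open>b\<close> makes the quotient positive and finite.\<close>
  define a' b' where "a' = a + e / 2" and "b' = b + e / 2"
  have pos: "0 < a'" "0 < b'" "a \<le> a'" "b \<le> b'" using assms \<open>0 < e\<close> by (auto simp: a'_def b'_def)
  have "c\<^sup>2 \<le> (1 + b' / a') * a\<^sup>2 + (1 + 1 / (b' / a')) * b\<^sup>2" by (rule le) (use pos in simp)
  also have "\<dots> \<le> (1 + b' / a') * a'\<^sup>2 + (1 + 1 / (b' / a')) * b'\<^sup>2"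
    using pos assms by (intro add_mono mult_left_mono power_mono) auto
  also have "\<dots> = (a' + b')\<^sup>2" using pos by (simp add: power2_eq_square field_simps)
  finally have "c \<le> a' + b'" by (rule power2_le_imp_le) (use pos in simp)
  then show "c \<le> a + b + e" by (simp add: a'_def b'_def)
qed

lemma L2_norm_sq_add_le:
  assumes "v \<in> L2_periodic" "w \<in> L2_periodic" "0 < t"
  shows "L2_norm_sq (\<lambda>x. v x + w x) \<le> (1 + t) * L2_norm_sq v + (1 + 1 / t) * L2_norm_sq w"
  using L2_periodicD(1,4)[OF assms(1)] L2_periodicD(1,4)[OF assms(2)] \<open>0 < t\<close>
  by (intro L2_combine(2)[OF assms(1,2)] norm_sum_sq_le) (auto simp: periodic1_def)

lemma energy_add_real:
  assumes v: "v \<in> sobolev_fun s" and w: "w \<in> sobolev_fun s" and t: "0 < t"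
  shows "enn2real (energy s (\<lambda>x. v x + w x)) \<le> (1 + t) * enn2real (energy s v) + (1 + 1 / t) * enn2real (energy s w)"
proof -
  have "energy s (\<lambda>x. v x + w x) \<le> ennreal (1 + t) * energy s v + ennreal (1 + 1 / t) * energy s w"
    by (rule energy_add[OF sobolev_funD(1,3)[OF v] sobolev_funD(1,3)[OF w] t])
  also have "\<dots> = ennreal (1 + t) * ennreal (enn2real (energy s v)) + ennreal (1 + 1 / t) * ennreal (enn2real (energy s w))"
    using sobolev_funD(3)[OF v] sobolev_funD(3)[OF w] by (simp add: less_top)
  also have "\<dots> = ennreal ((1 + t) * enn2real (energy s v) + (1 + 1 / t) * enn2real (energy s w))"
    by (rule ennreal_lincomb[symmetric]) (use t in auto)
  finally show ?thesis by (rule enn2real_leI[rotated]) (use t in \<open>auto intro!: add_nonneg_nonneg mult_nonneg_nonneg\<close>)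
qed

lemma Hs_norm_add:
  assumes v: "v \<in> sobolev_fun s" and w: "w \<in> sobolev_fun s"
  shows "Hs_norm s (\<lambda>x. v x + w x) \<le> Hs_norm s v + Hs_norm s w"
proof (rule triangle_of_quadratic)
  fix t :: real assume t: "0 < t"
  show "(Hs_norm s (\<lambda>x. v x + w x))\<^sup>2 \<le> (1 + t) * (Hs_norm s v)\<^sup>2 + (1 + 1 / t) * (Hs_norm s w)\<^sup>2"
    unfolding Hs_norm_sq distrib_left
    using L2_norm_sq_add_le[OF sobolev_funD(4)[OF v] sobolev_funD(4)[OF w] t] energy_add_real[OF v w t] by linarith
qed auto

lemma energy_scaleR:
  assumes v: "v \<in> sobolev_fun s"
  shows "enn2real (energy s (\<lambda>x. c *\<^sub>R v x)) = c\<^sup>2 * enn2real (energy s v)"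
proof -
  have le: "enn2real (energy s (\<lambda>x. c *\<^sub>R v x)) \<le> c\<^sup>2 * enn2real (energy s v)" if v: "v \<in> sobolev_fun s" for v :: "real \<Rightarrow> 'a" and c
  proof -
    have "energy s (\<lambda>x. c *\<^sub>R v x) \<le> ennreal (c\<^sup>2) * energy s v"
      by (rule energy_scaleR_le[OF sobolev_funD(1,3)[OF v]])
    also have "\<dots> = ennreal (c\<^sup>2 * enn2real (energy s v))"
      using sobolev_funD(3)[OF v] by (simp add: ennreal_mult' less_top)
    finally show ?thesis by (rule enn2real_leI[rotated]) simp
  qed
  show ?thesis
  proof (cases "c = 0")
    case True
    then show ?thesis by (simp add: energy_const)
  next
    case False
    have "enn2real (energy s v) \<le> (1 / c)\<^sup>2 * enn2real (energy s (\<lambda>x. c *\<^sub>R v x))"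
      using le[OF sobolev_fun_scaleR[OF v, of c], of "1 / c"] False by simp
    then have "c\<^sup>2 * enn2real (energy s v) \<le> c\<^sup>2 * ((1 / c)\<^sup>2 * enn2real (energy s (\<lambda>x. c *\<^sub>R v x)))"
      by (rule mult_left_mono) simp
    also have "\<dots> = enn2real (energy s (\<lambda>x. c *\<^sub>R v x))" using False by (simp add: power_divide)
    finally show ?thesis using le[OF v, of c] by simp
  qed
qed

lemma Hs_norm_scaleR:
  assumes v: "v \<in> sobolev_fun s" shows "Hs_norm s (\<lambda>x. c *\<^sub>R v x) = \<bar>c\<bar> * Hs_norm s v"
  unfolding Hs_norm_def energy_scaleR[OF v] L2_norm_sq_scaleR distrib_left[symmetric]
  by (simp add: real_sqrt_mult)

lemma Hs_norm_diff:
  assumes "v \<in> sobolev_fun s" "w \<in> sobolev_fun s"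
  shows "Hs_norm s (\<lambda>x. v x - w x) \<le> Hs_norm s v + Hs_norm s w"
  using Hs_norm_add[OF assms(1) sobolev_fun_scaleR[OF assms(2), of "-1"]] Hs_norm_scaleR[OF assms(2), of "-1"] by simp

lemma Hs_norm_const: "Hs_norm s (\<lambda>_. c) = norm c"
proof -
  have "L2_norm_sq (\<lambda>_. c) = (norm c)\<^sup>2"
    using prim_const[of "(norm c)\<^sup>2" 1] by (simp add: L2_norm_sq_def prim_1)
  then show ?thesis by (simp add: Hs_norm_def energy_const)
qed

lemma Hs_norm_sup:
  assumes "1/2 < s"
  obtains K where "0 < K" "\<And>(v :: real \<Rightarrow> 'b::euclidean_space) t. v \<in> sobolev_fun s \<Longrightarrow> norm (v t) \<le> K * Hs_norm s v"
proof (rule sup_bound[OF assms, where 'b = 'b])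
  fix K :: real
  assume K: "0 < K" "\<And>(v :: real \<Rightarrow> 'b) t. continuous_on UNIV v \<Longrightarrow> periodic1 v \<Longrightarrow> energy s v < \<infinity> \<Longrightarrow>
    norm (v t) \<le> K * sqrt (L2_norm_sq v + enn2real (energy s v))"
  show ?thesis
    by (rule that[OF K(1)]) (unfold Hs_norm_def, rule K(2), (erule sobolev_funD)+)
qed

text \<open>
  \<open>H\<^sup>s\<close> is an algebra: the sup norms in the Leibniz rule for the energy are bounded by the
  norm of \<open>H\<^sup>s\<close>.
\<close>

lemma Hs_norm_bilinear:
  fixes B :: "'a::euclidean_space \<Rightarrow> 'b::euclidean_space \<Rightarrow> 'c::euclidean_space"
  assumes B: "bounded_bilinear B" and s: "1/2 < s"
  obtains K where "0 \<le> K" "\<And>v w. v \<in> sobolev_fun s \<Longrightarrow> w \<in> sobolev_fun s \<Longrightarrow> (\<lambda>x. B (v x) (w x)) \<in> sobolev_fun s"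
    "\<And>v w. v \<in> sobolev_fun s \<Longrightarrow> w \<in> sobolev_fun s \<Longrightarrow> Hs_norm s (\<lambda>x. B (v x) (w x)) \<le> K * Hs_norm s v * Hs_norm s w"
proof -
  interpret B: bounded_bilinear B by fact
  obtain K where K: "0 \<le> K" "\<And>a b. norm (B a b) \<le> norm a * norm b * K" using B.nonneg_bounded by auto
  obtain K1 where K1: "0 < K1" "\<And>(v :: real \<Rightarrow> 'a) t. v \<in> sobolev_fun s \<Longrightarrow> norm (v t) \<le> K1 * Hs_norm s v"
    by (rule Hs_norm_sup[OF s, where 'b = 'a]) (rule that; blast)
  obtain K2 where K2: "0 < K2" "\<And>(v :: real \<Rightarrow> 'b) t. v \<in> sobolev_fun s \<Longrightarrow> norm (v t) \<le> K2 * Hs_norm s v"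
    by (rule Hs_norm_sup[OF s, where 'b = 'b]) (rule that; blast)
  define M where "M = K\<^sup>2 * K1\<^sup>2 * K2\<^sup>2 + 2 * K\<^sup>2 * K2\<^sup>2 + 2 * K\<^sup>2 * K1\<^sup>2"
  have M: "0 \<le> M" by (simp add: M_def)
  have main: "(\<lambda>x. B (v x) (w x)) \<in> sobolev_fun s \<and> Hs_norm s (\<lambda>x. B (v x) (w x)) \<le> sqrt M * Hs_norm s v * Hs_norm s w"
    if v: "v \<in> sobolev_fun s" and w: "w \<in> sobolev_fun s" for v w
  proof -
    let ?a = "K1 * Hs_norm s v" and ?b = "K2 * Hs_norm s w"
    have sup: "norm (v t) \<le> ?a" "norm (w t) \<le> ?b" for t using K1(2)[OF v] K2(2)[OF w] by auto
    note velocity = sobolev_funD[OF v] and wd = sobolev_funD[OF w]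
    have e: "energy s (\<lambda>x. B (v x) (w x)) \<le> ennreal (2 * K\<^sup>2 * ?b\<^sup>2) * energy s v + ennreal (2 * K\<^sup>2 * ?a\<^sup>2) * energy s w"
      by (rule energy_bilinear[OF B K velocity(1-3) sup(1) wd(1-3) sup(2)])
    also have "\<dots> = ennreal (2 * K\<^sup>2 * ?b\<^sup>2) * ennreal (enn2real (energy s v)) + ennreal (2 * K\<^sup>2 * ?a\<^sup>2) * ennreal (enn2real (energy s w))"
      using velocity(3) wd(3) by (simp add: less_top)
    also have "\<dots> = ennreal (2 * K\<^sup>2 * ?b\<^sup>2 * enn2real (energy s v) + 2 * K\<^sup>2 * ?a\<^sup>2 * enn2real (energy s w))"
      by (rule ennreal_lincomb[symmetric]) auto
    finally have e: "energy s (\<lambda>x. B (v x) (w x)) \<le> ennreal (2 * K\<^sup>2 * ?b\<^sup>2 * enn2real (energy s v) + 2 * K\<^sup>2 * ?a\<^sup>2 * enn2real (energy s w))" .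
    have c: "continuous_on UNIV (\<lambda>x. B (v x) (w x))" by (intro B.continuous_on velocity(1) wd(1))
    have p: "periodic1 (\<lambda>x. B (v x) (w x))" using velocity(2) wd(2) by (simp add: periodic1_def)
    have mem: "(\<lambda>x. B (v x) (w x)) \<in> sobolev_fun s"
      using c p le_less_trans[OF e ennreal_less_top] by (simp add: sobolev_fun_def)
    have "norm (B (v t) (w t)) \<le> ?a * ?b * K" for t
      using K(1) sup order_trans[OF norm_ge_zero sup(1)]
      by (intro order_trans[OF K(2)] mult_right_mono mult_mono) auto
    then have l2: "L2_norm_sq (\<lambda>x. B (v x) (w x)) \<le> (?a * ?b * K)\<^sup>2"
      by (rule L2_norm_sq_le_sup[OF c p])
    have le1: "enn2real (energy s v) \<le> (Hs_norm s v)\<^sup>2" "enn2real (energy s w) \<le> (Hs_norm s w)\<^sup>2" by (auto simp: Hs_norm_sq)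
    have "enn2real (energy s (\<lambda>x. B (v x) (w x))) \<le> 2 * K\<^sup>2 * ?b\<^sup>2 * enn2real (energy s v) + 2 * K\<^sup>2 * ?a\<^sup>2 * enn2real (energy s w)"
      by (rule enn2real_leI[OF _ e]) (auto intro!: add_nonneg_nonneg mult_nonneg_nonneg)
    also have "\<dots> \<le> 2 * K\<^sup>2 * ?b\<^sup>2 * (Hs_norm s v)\<^sup>2 + 2 * K\<^sup>2 * ?a\<^sup>2 * (Hs_norm s w)\<^sup>2"
      by (intro add_mono mult_left_mono le1) auto
    finally have "(Hs_norm s (\<lambda>x. B (v x) (w x)))\<^sup>2 \<le> (?a * ?b * K)\<^sup>2 + (2 * K\<^sup>2 * ?b\<^sup>2 * (Hs_norm s v)\<^sup>2 + 2 * K\<^sup>2 * ?a\<^sup>2 * (Hs_norm s w)\<^sup>2)"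
      unfolding Hs_norm_sq[of s "\<lambda>x. B (v x) (w x)"] using l2 by linarith
    also have "\<dots> = M * (Hs_norm s v * Hs_norm s w)\<^sup>2"
      by (simp add: M_def power_mult_distrib algebra_simps)
    also have "\<dots> = (sqrt M * Hs_norm s v * Hs_norm s w)\<^sup>2"
      using M by (simp add: power_mult_distrib)
    finally have "Hs_norm s (\<lambda>x. B (v x) (w x)) \<le> sqrt M * Hs_norm s v * Hs_norm s w"
      by (rule power2_le_imp_le) (use M in simp)
    with mem show ?thesis by blast
  qed
  show ?thesis
    by (rule that[of "sqrt M"]) (use main M in auto)
qed

section \<open>The Sobolev space as a Banach space\<close>

definition velocity :: "(real \<Rightarrow>\<^sub>C 'b::euclidean_space) \<Rightarrow> real \<Rightarrow> 'b" where
  "velocity \<gamma> t = vector_derivative (apply_bcontfun \<gamma>) (at t)"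

lemma velocity_eqI: "(\<And>t. (apply_bcontfun \<gamma> has_vector_derivative v t) (at t)) \<Longrightarrow> velocity \<gamma> = v"
  by (auto simp: velocity_def fun_eq_iff intro: vector_derivative_at)

lemma sobolev_periodic: "\<gamma> \<in> sobolev s \<Longrightarrow> periodic1 (apply_bcontfun \<gamma>)"
  by (simp add: sobolev_def)

lemma sobolev_velocity:
  assumes s: "1/2 < s" and \<gamma>: "\<gamma> \<in> sobolev s"
  shows "velocity \<gamma> \<in> sobolev_fun s" "(apply_bcontfun \<gamma> has_vector_derivative velocity \<gamma> t) (at t)"
    "sobolev_norm s \<gamma> = sqrt (L2_norm_sq (apply_bcontfun \<gamma>) + (Hs_norm s (velocity \<gamma>))\<^sup>2)"
    "apply_bcontfun \<gamma> \<in> L2_periodic"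
proof -
  obtain v where v: "v \<in> sobolev_fun s" "\<And>t. (apply_bcontfun \<gamma> has_vector_derivative v t) (at t)"
    by (rule sobolevD[OF s \<gamma>]) (rule that; blast)
  have eq: "velocity \<gamma> = v" by (rule velocity_eqI[OF v(2)])
  show "velocity \<gamma> \<in> sobolev_fun s" "(apply_bcontfun \<gamma> has_vector_derivative velocity \<gamma> t) (at t)"
    using v by (auto simp: eq)
  show "sobolev_norm s \<gamma> = sqrt (L2_norm_sq (apply_bcontfun \<gamma>) + (Hs_norm s (velocity \<gamma>))\<^sup>2)"
    using sobolev_of_derivative(2)[OF sobolev_periodic[OF \<gamma>] v] by (simp add: eq Hs_norm_sq)
  show "apply_bcontfun \<gamma> \<in> L2_periodic"
    by (intro L2_periodic_continuous sobolev_periodic[OF \<gamma>] continuous_on_bcontfun)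
qed

lemma sobolevI:
  assumes "periodic1 (apply_bcontfun \<gamma>)" "v \<in> sobolev_fun s"
    "\<And>t. (apply_bcontfun \<gamma> has_vector_derivative v t) (at t)"
  shows "\<gamma> \<in> sobolev s" "velocity \<gamma> = v"
  using sobolev_of_derivative(1)[OF assms] velocity_eqI[OF assms(3)] by auto

lemma sobolev_norm_bounds:
  assumes s: "1/2 < s" and \<gamma>: "\<gamma> \<in> sobolev s"
  shows "Hs_norm s (velocity \<gamma>) \<le> sobolev_norm s \<gamma>" "L2_norm_sq (apply_bcontfun \<gamma>) \<le> (sobolev_norm s \<gamma>)\<^sup>2"
  unfolding sobolev_velocity(3)[OF s \<gamma>] by (auto intro: real_le_rsqrt)

lemma sobolev_add:
  assumes s: "1/2 < s" and g: "\<gamma> \<in> sobolev s" and h: "\<eta> \<in> sobolev s"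
  shows "\<gamma> + \<eta> \<in> sobolev s" "velocity (\<gamma> + \<eta>) = (\<lambda>x. velocity \<gamma> x + velocity \<eta> x)"
proof -
  have p: "periodic1 (apply_bcontfun (\<gamma> + \<eta>))"
    using sobolev_periodic[OF g] sobolev_periodic[OF h] by (simp add: periodic1_def)
  have d: "(apply_bcontfun (\<gamma> + \<eta>) has_vector_derivative velocity \<gamma> t + velocity \<eta> t) (at t)" for t
    using has_vector_derivative_add[OF sobolev_velocity(2)[OF s g] sobolev_velocity(2)[OF s h], of t]
    by (simp add: plus_bcontfun.rep_eq)
  show "\<gamma> + \<eta> \<in> sobolev s" "velocity (\<gamma> + \<eta>) = (\<lambda>x. velocity \<gamma> x + velocity \<eta> x)"
    using sobolevI[OF p sobolev_fun_add[OF sobolev_velocity(1)[OF s g] sobolev_velocity(1)[OF s h]] d] by auto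
qed

lemma sobolev_scaleR:
  assumes s: "1/2 < s" and g: "\<gamma> \<in> sobolev s"
  shows "c *\<^sub>R \<gamma> \<in> sobolev s" "velocity (c *\<^sub>R \<gamma>) = (\<lambda>x. c *\<^sub>R velocity \<gamma> x)"
proof -
  have p: "periodic1 (apply_bcontfun (c *\<^sub>R \<gamma>))"
    using sobolev_periodic[OF g] by (simp add: periodic1_def)
  have d: "(apply_bcontfun (c *\<^sub>R \<gamma>) has_vector_derivative c *\<^sub>R velocity \<gamma> t) (at t)" for t
    using has_vector_derivative_scaleR[OF DERIV_const sobolev_velocity(2)[OF s g], of c t]
    by (simp add: scaleR_bcontfun.rep_eq)
  show "c *\<^sub>R \<gamma> \<in> sobolev s" "velocity (c *\<^sub>R \<gamma>) = (\<lambda>x. c *\<^sub>R velocity \<gamma> x)"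
    using sobolevI[OF p sobolev_fun_scaleR[OF sobolev_velocity(1)[OF s g]] d] by auto
qed

lemma sobolev_diff:
  assumes s: "1/2 < s" and g: "\<gamma> \<in> sobolev s" and h: "\<eta> \<in> sobolev s"
  shows "\<gamma> - \<eta> \<in> sobolev s" "velocity (\<gamma> - \<eta>) = (\<lambda>x. velocity \<gamma> x - velocity \<eta> x)"
  using sobolev_add[OF s g sobolev_scaleR(1)[OF s h, of "-1"]] sobolev_scaleR(2)[OF s h, of "-1"]
  by (simp_all)

lemma half_less_one: "1/2 < (1::real)" by simp

text \<open>
  The bound for the curve itself holds because a \<open>C\<^sup>1\<close> curve belongs to \<open>H\<^sup>1\<close>, with norm
  at most that of \<open>H\<^sup>1\<^sup>+\<^sup>s\<close>.
\<close>

lemma sobolev_sup: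
  assumes s: "1/2 < s"
  obtains K where "0 < K" "\<And>(\<gamma> :: real \<Rightarrow>\<^sub>C 'b::euclidean_space) t. \<gamma> \<in> sobolev s \<Longrightarrow> norm (velocity \<gamma> t) \<le> K * sobolev_norm s \<gamma>"
    "\<And>(\<gamma> :: real \<Rightarrow>\<^sub>C 'b) t. \<gamma> \<in> sobolev s \<Longrightarrow> norm (apply_bcontfun \<gamma> t) \<le> K * sobolev_norm s \<gamma>"
proof -
  obtain K1 where K1: "0 < K1" "\<And>(v :: real \<Rightarrow> 'b) t. v \<in> sobolev_fun s \<Longrightarrow> norm (v t) \<le> K1 * Hs_norm s v"
    by (rule Hs_norm_sup[OF s, where 'b = 'b]) (rule that; blast)
  obtain K2 where K2: "0 < K2" "\<And>(v :: real \<Rightarrow> 'b) t. v \<in> sobolev_fun 1 \<Longrightarrow> norm (v t) \<le> K2 * Hs_norm 1 v"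
    by (rule Hs_norm_sup[OF half_less_one, where 'b = 'b]) (rule that; blast)
  show ?thesis
  proof (rule that[of "K1 + K2"])
    show "0 < K1 + K2" using K1(1) K2(1) by simp
    fix \<gamma> :: "real \<Rightarrow>\<^sub>C 'b" and t assume g: "\<gamma> \<in> sobolev s"
    note v = sobolev_velocity[OF s g]
    have N: "0 \<le> sobolev_norm s \<gamma>" by (rule sobolev_norm_nonneg)
    have "norm (velocity \<gamma> t) \<le> K1 * Hs_norm s (velocity \<gamma>)" by (rule K1(2)[OF v(1)])
    also have "\<dots> \<le> (K1 + K2) * sobolev_norm s \<gamma>"
      using sobolev_norm_bounds(1)[OF s g] K1(1) K2(1) N by (intro mult_mono) auto
    finally show "norm (velocity \<gamma> t) \<le> (K1 + K2) * sobolev_norm s \<gamma>" .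
    have pr: "apply_bcontfun \<gamma> t = apply_bcontfun \<gamma> 0 + prim (velocity \<gamma>) t" for t
      using prim_of_derivative[OF v(2) sobolev_funD(1)[OF v(1)], of t] by simp
    have e: "energy 1 (apply_bcontfun \<gamma>) = ennreal (L2_norm_sq (velocity \<gamma>))"
      by (rule energy_1_eq[OF sobolev_funD(4)[OF v(1)] pr])
    then have "apply_bcontfun \<gamma> \<in> sobolev_fun 1"
      using sobolev_periodic[OF g] continuous_on_bcontfun by (simp add: sobolev_fun_def)
    then have "norm (apply_bcontfun \<gamma> t) \<le> K2 * Hs_norm 1 (apply_bcontfun \<gamma>)" by (rule K2(2))
    also have "Hs_norm 1 (apply_bcontfun \<gamma>) \<le> sobolev_norm s \<gamma>"
      unfolding v(3) Hs_norm_def[of 1] Hs_norm_sq e by (intro real_sqrt_le_mono) simp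
    also have "K2 * sobolev_norm s \<gamma> \<le> (K1 + K2) * sobolev_norm s \<gamma>"
      using K1(1) N by (intro mult_right_mono) auto
    finally show "norm (apply_bcontfun \<gamma> t) \<le> (K1 + K2) * sobolev_norm s \<gamma>"
      using K2(1) by simp
  qed
qed

lemma sobolev_norm_add:
  assumes s: "1/2 < s" and g: "\<gamma> \<in> sobolev s" and h: "\<eta> \<in> sobolev s"
  shows "sobolev_norm s (\<gamma> + \<eta>) \<le> sobolev_norm s \<gamma> + sobolev_norm s \<eta>"
proof (rule triangle_of_quadratic)
  fix t :: real assume t: "0 < t"
  note vg = sobolev_velocity[OF s g] and vh = sobolev_velocity[OF s h]
  have sq: "(sobolev_norm s \<gamma>)\<^sup>2 = L2_norm_sq (apply_bcontfun \<gamma>) + L2_norm_sq (velocity \<gamma>) + enn2real (energy s (velocity \<gamma>))"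
    if "\<gamma> \<in> sobolev s" for \<gamma> :: "real \<Rightarrow>\<^sub>C 'a"
    unfolding sobolev_velocity(3)[OF s that] Hs_norm_sq by simp
  have ap: "apply_bcontfun (\<gamma> + \<eta>) = (\<lambda>x. apply_bcontfun \<gamma> x + apply_bcontfun \<eta> x)" by (simp add: fun_eq_iff)
  show "(sobolev_norm s (\<gamma> + \<eta>))\<^sup>2 \<le> (1 + t) * (sobolev_norm s \<gamma>)\<^sup>2 + (1 + 1 / t) * (sobolev_norm s \<eta>)\<^sup>2"
    unfolding sq[OF g] sq[OF h] sq[OF sobolev_add(1)[OF s g h]] sobolev_add(2)[OF s g h] ap distrib_left
    using L2_norm_sq_add_le[OF vg(4) vh(4) t] L2_norm_sq_add_le[OF sobolev_funD(4)[OF vg(1)] sobolev_funD(4)[OF vh(1)] t]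
      energy_add_real[OF vg(1) vh(1) t] by linarith
qed (auto simp: sobolev_norm_nonneg)

lemma sobolev_norm_scaleR:
  assumes s: "1/2 < s" and g: "\<gamma> \<in> sobolev s"
  shows "sobolev_norm s (c *\<^sub>R \<gamma>) = \<bar>c\<bar> * sobolev_norm s \<gamma>"
proof -
  have ap: "apply_bcontfun (c *\<^sub>R \<gamma>) = (\<lambda>x. c *\<^sub>R apply_bcontfun \<gamma> x)" by (simp add: fun_eq_iff)
  show ?thesis
    unfolding sobolev_velocity(3)[OF s g] sobolev_velocity(3)[OF s sobolev_scaleR(1)[OF s g]] sobolev_scaleR(2)[OF s g] ap
      L2_norm_sq_scaleR Hs_norm_scaleR[OF sobolev_velocity(1)[OF s g]] power_mult_distrib power2_abs distrib_left[symmetric]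
    by (simp add: real_sqrt_mult)
qed

lemma uniform_limit_of_cauchy:
  fixes f :: "nat \<Rightarrow> real \<Rightarrow> 'b::euclidean_space"
  assumes "\<And>e. 0 < e \<Longrightarrow> \<exists>N. \<forall>m\<ge>N. \<forall>n\<ge>N. \<forall>x. dist (f m x) (f n x) < e"
  obtains g where "uniform_limit UNIV f g sequentially"
proof -
  have "uniformly_Cauchy_on UNIV f"
    unfolding uniformly_Cauchy_on_def
  proof (intro allI impI)
    fix e :: real assume "0 < e"
    from assms[OF this] show "\<exists>M. \<forall>x\<in>UNIV. \<forall>m\<ge>M. \<forall>n\<ge>M. dist (f m x) (f n x) < e" by blast
  qed
  then have "uniformly_convergent_on UNIV f" by (rule Cauchy_uniformly_convergent)
  then obtain g where "uniform_limit UNIV f g sequentially" unfolding uniformly_convergent_on_def by blast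
  then show ?thesis by (rule that)
qed

text \<open>
  A Cauchy sequence converges in \<open>C\<^sup>1\<close> by the sup bounds. The velocities also converge in
  energy, which shows that the limit belongs to the space and that the convergence takes
  place in its norm.
\<close>

lemma sobolev_complete:
  fixes \<sigma> :: "nat \<Rightarrow> (real \<Rightarrow>\<^sub>C 'b::euclidean_space)"
  assumes s: "1/2 < s" and \<sigma>: "\<And>n. \<sigma> n \<in> sobolev s"
    and cauchy: "\<And>e. 0 < e \<Longrightarrow> \<exists>N. \<forall>m\<ge>N. \<forall>n\<ge>N. sobolev_norm s (\<sigma> m - \<sigma> n) < e"
  shows "\<exists>\<gamma>\<in>sobolev s. (\<lambda>n. sobolev_norm s (\<sigma> n - \<gamma>)) \<longlonglongrightarrow> 0"
proof -
  obtain K where K: "0 < K" "\<And>(\<gamma> :: real \<Rightarrow>\<^sub>C 'b) t. \<gamma> \<in> sobolev s \<Longrightarrow> norm (velocity \<gamma> t) \<le> K * sobolev_norm s \<gamma>"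
    "\<And>(\<gamma> :: real \<Rightarrow>\<^sub>C 'b) t. \<gamma> \<in> sobolev s \<Longrightarrow> norm (apply_bcontfun \<gamma> t) \<le> K * sobolev_norm s \<gamma>"
    by (rule sobolev_sup[OF s, where 'b = 'b]) (rule that; blast)
  note d = sobolev_diff[OF s \<sigma> \<sigma>]
  have small: "\<exists>N. \<forall>m\<ge>N. \<forall>n\<ge>N. \<forall>x. dist (apply_bcontfun (\<sigma> m) x) (apply_bcontfun (\<sigma> n) x) < e \<and> dist (velocity (\<sigma> m) x) (velocity (\<sigma> n) x) < e"
    if e0: "0 < e" for e
  proof -
    obtain N where N: "\<forall>m\<ge>N. \<forall>n\<ge>N. sobolev_norm s (\<sigma> m - \<sigma> n) < e / K"
      using cauchy[of "e / K"] e0 K(1) by auto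
    have "dist (apply_bcontfun (\<sigma> m) x) (apply_bcontfun (\<sigma> n) x) < e \<and> dist (velocity (\<sigma> m) x) (velocity (\<sigma> n) x) < e" if "m \<ge> N" "n \<ge> N" for m n x
    proof -
      have "K * sobolev_norm s (\<sigma> m - \<sigma> n) < e" using N that K(1) by (simp add: pos_less_divide_eq mult.commute)
      then show ?thesis using K(2)[OF d(1), of m n x] K(3)[OF d(1), of m n x] by (simp add: d(2) dist_norm)
    qed
    then show ?thesis by blast
  qed
  have "Cauchy \<sigma>"
  proof (rule metric_CauchyI)
    fix e :: real assume e: "0 < e"
    then obtain N where N: "\<forall>m\<ge>N. \<forall>n\<ge>N. \<forall>x. dist (apply_bcontfun (\<sigma> m) x) (apply_bcontfun (\<sigma> n) x) < e/2 \<and> dist (velocity (\<sigma> m) x) (velocity (\<sigma> n) x) < e/2"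
      using small[of "e/2"] by auto
    have "dist (\<sigma> m) (\<sigma> n) < e" if "m \<ge> N" "n \<ge> N" for m n
    proof -
      have "dist (\<sigma> m) (\<sigma> n) \<le> e/2" by (rule dist_bound) (use N that in \<open>auto simp: less_imp_le\<close>)
      then show ?thesis using e by simp
    qed
    then show "\<exists>M. \<forall>m\<ge>M. \<forall>n\<ge>M. dist (\<sigma> m) (\<sigma> n) < e" by blast
  qed
  then have "convergent \<sigma>" by (rule Cauchy_convergent)
  then obtain \<gamma> where "\<sigma> \<longlonglongrightarrow> \<gamma>" unfolding convergent_def by (rule exE)
  then have dg: "\<exists>N. \<forall>n\<ge>N. dist (\<sigma> n) \<gamma> < e" if "0 < e" for e
    by (rule metric_LIMSEQ_D) (rule that)
  have lim: "(\<lambda>n. apply_bcontfun (\<sigma> n) x) \<longlonglongrightarrow> apply_bcontfun \<gamma> x" for x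
  proof (rule metric_LIMSEQ_I)
    fix e :: real assume "0 < e"
    then obtain N where N: "\<forall>n\<ge>N. dist (\<sigma> n) \<gamma> < e" using dg by blast
    have "dist (apply_bcontfun (\<sigma> n) x) (apply_bcontfun \<gamma> x) < e" if "n \<ge> N" for n
      using dist_bounded[of "\<sigma> n" x \<gamma>] N that by (meson le_less_trans)
    then show "\<exists>N. \<forall>n\<ge>N. dist (apply_bcontfun (\<sigma> n) x) (apply_bcontfun \<gamma> x) < e" by blast
  qed
  have "\<exists>N. \<forall>m\<ge>N. \<forall>n\<ge>N. \<forall>x. dist (velocity (\<sigma> m) x) (velocity (\<sigma> n) x) < e" if "0 < e" for e
    using small[OF that] by blast
  then obtain v where ul: "uniform_limit UNIV (\<lambda>n. velocity (\<sigma> n)) v sequentially"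
    by (rule uniform_limit_of_cauchy)
  note sv = sobolev_velocity[OF s \<sigma>]
  have cv: "continuous_on UNIV v"
    by (rule uniform_limit_theorem[OF always_eventually[OF allI] ul]) (simp_all add: sobolev_funD(1)[OF sv(1)])
  have limv: "(\<lambda>n. velocity (\<sigma> n) x) \<longlonglongrightarrow> v x" for x by (rule tendsto_uniform_limitI[OF ul]) simp
  have p: "periodic1 (apply_bcontfun \<gamma>)"
    unfolding periodic1_def
  proof
    fix t
    have "(\<lambda>n. apply_bcontfun (\<sigma> n) (t + 1)) = (\<lambda>n. apply_bcontfun (\<sigma> n) t)"
      using sobolev_periodic[OF \<sigma>] by (simp add: periodic1_def)
    with lim[of "t + 1"] have "(\<lambda>n. apply_bcontfun (\<sigma> n) t) \<longlonglongrightarrow> apply_bcontfun \<gamma> (t + 1)" by simp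
    then show "apply_bcontfun \<gamma> (t + 1) = apply_bcontfun \<gamma> t" using lim[of t] by (rule LIMSEQ_unique)
  qed
  note der = has_vector_derivative_uniform_limit[OF sv(2) ul lim]
  have ec: "\<exists>N. \<forall>m\<ge>N. \<forall>n\<ge>N. energy s (\<lambda>x. velocity (\<sigma> m) x - velocity (\<sigma> n) x) \<le> ennreal e" if e0: "0 < e" for e
  proof -
    obtain N where N: "\<forall>m\<ge>N. \<forall>n\<ge>N. sobolev_norm s (\<sigma> m - \<sigma> n) < sqrt e" using cauchy[of "sqrt e"] e0 by auto
    have "energy s (\<lambda>x. velocity (\<sigma> m) x - velocity (\<sigma> n) x) \<le> ennreal e" if "m \<ge> N" "n \<ge> N" for m n
    proof -
      have "Hs_norm s (\<lambda>x. velocity (\<sigma> m) x - velocity (\<sigma> n) x) \<le> sobolev_norm s (\<sigma> m - \<sigma> n)"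
        using sobolev_norm_bounds(1)[OF s d(1), of m n] by (simp add: d(2))
      also have "\<dots> \<le> sqrt e" using N that by (simp add: less_imp_le)
      finally have "(Hs_norm s (\<lambda>x. velocity (\<sigma> m) x - velocity (\<sigma> n) x))\<^sup>2 \<le> (sqrt e)\<^sup>2" by (rule power_mono) simp
      moreover have "(sqrt e)\<^sup>2 = e" using e0 by simp
      ultimately have le: "enn2real (energy s (\<lambda>x. velocity (\<sigma> m) x - velocity (\<sigma> n) x)) \<le> e"
        unfolding Hs_norm_sq using L2_norm_sq_nonneg[of "\<lambda>x. velocity (\<sigma> m) x - velocity (\<sigma> n) x"] by linarith
      have "energy s (\<lambda>x. velocity (\<sigma> m) x - velocity (\<sigma> n) x) < \<infinity>"
        by (rule sobolev_funD(3)[OF sobolev_fun_diff[OF sv(1) sv(1)]])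
      then have "energy s (\<lambda>x. velocity (\<sigma> m) x - velocity (\<sigma> n) x) = ennreal (enn2real (energy s (\<lambda>x. velocity (\<sigma> m) x - velocity (\<sigma> n) x)))"
        by (simp add: less_top)
      also have "\<dots> \<le> ennreal e" by (rule ennreal_leI[OF le])
      finally show ?thesis .
    qed
    then show ?thesis by blast
  qed
  have jet_val: "\<exists>N. \<forall>n\<ge>N. energy s (\<lambda>x. velocity (\<sigma> n) x - v x) \<le> ennreal e" if "0 < e" for e
    by (rule energy_complete[OF sobolev_funD(1-3)[OF sv(1)] cv limv ec that])
  obtain N1 where "\<forall>n\<ge>N1. energy s (\<lambda>x. velocity (\<sigma> n) x - v x) \<le> ennreal 1" using jet_val[of 1] by auto
  then have "energy s (\<lambda>x. velocity (\<sigma> N1) x - v x) \<le> ennreal 1" by simp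
  then have fin: "energy s (\<lambda>x. velocity (\<sigma> N1) x - v x) < \<infinity>" by (rule le_less_trans) simp
  have pv: "periodic1 v" by (rule periodic1_derivative[OF p der])
  have dmem: "(\<lambda>x. velocity (\<sigma> N1) x - v x) \<in> sobolev_fun s"
    using fin pv sobolev_funD(1,2)[OF sv(1)[of N1]] cv
    by (auto simp: sobolev_fun_def periodic1_def intro!: continuous_intros)
  have vmem: "v \<in> sobolev_fun s" using sobolev_fun_diff[OF sv(1)[of N1] dmem] by simp
  note \<gamma> = sobolevI[OF p vmem der]
  have "(\<lambda>n. sobolev_norm s (\<sigma> n - \<gamma>)) \<longlonglongrightarrow> 0"
  proof (rule LIMSEQ_I)
    fix e :: real assume e: "0 < e"
    define \<delta> where "\<delta> = e / 2"
    have \<delta>: "0 < \<delta>" using e by (simp add: \<delta>_def)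
    obtain A where A: "\<forall>n\<ge>A. energy s (\<lambda>x. velocity (\<sigma> n) x - v x) \<le> ennreal (\<delta>\<^sup>2)" using jet_val[of "\<delta>\<^sup>2"] \<delta> by auto
    obtain B where B: "\<forall>n\<ge>B. dist (\<sigma> n) \<gamma> < \<delta>" using dg[OF \<delta>] by blast
    obtain D where D: "\<forall>n\<ge>D. \<forall>x\<in>UNIV. dist (velocity (\<sigma> n) x) (v x) < \<delta>"
      using uniform_limitD[OF ul \<delta>] by (auto simp: eventually_sequentially)
    have "norm (sobolev_norm s (\<sigma> n - \<gamma>) - 0) < e" if n: "n \<ge> max A (max B D)" for n
    proof -
      note dn = sobolev_diff[OF s \<sigma>[of n] \<gamma>(1)]
      have mem: "(\<lambda>x. velocity (\<sigma> n) x - v x) \<in> sobolev_fun s" by (rule sobolev_fun_diff[OF sv(1) vmem])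
      have ap: "apply_bcontfun (\<sigma> n - \<gamma>) = (\<lambda>x. apply_bcontfun (\<sigma> n) x - apply_bcontfun \<gamma> x)" by (simp add: fun_eq_iff)
      have "norm (apply_bcontfun (\<sigma> n - \<gamma>) x) \<le> \<delta>" for x
      proof -
        have "dist (apply_bcontfun (\<sigma> n) x) (apply_bcontfun \<gamma> x) \<le> dist (\<sigma> n) \<gamma>" by (rule dist_bounded)
        also have "\<dots> \<le> \<delta>" using B n by (simp add: less_imp_le)
        finally show ?thesis by (simp add: ap dist_norm)
      qed
      then have 1: "L2_norm_sq (apply_bcontfun (\<sigma> n - \<gamma>)) \<le> \<delta>\<^sup>2"
        by (intro L2_norm_sq_le_sup continuous_on_bcontfun sobolev_periodic[OF dn(1)])
      have "norm (velocity (\<sigma> n) x - v x) \<le> \<delta>" for x using D n by (simp add: dist_norm less_imp_le)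
      then have 2: "L2_norm_sq (\<lambda>x. velocity (\<sigma> n) x - v x) \<le> \<delta>\<^sup>2"
        by (intro L2_norm_sq_le_sup sobolev_funD(1,2)[OF mem])
      have 3: "enn2real (energy s (\<lambda>x. velocity (\<sigma> n) x - v x)) \<le> \<delta>\<^sup>2"
        using A n by (intro enn2real_leI) auto
      have "sobolev_norm s (\<sigma> n - \<gamma>) \<le> sqrt (\<delta>\<^sup>2 + (\<delta>\<^sup>2 + \<delta>\<^sup>2))"
        unfolding sobolev_velocity(3)[OF s dn(1)] Hs_norm_sq dn(2) \<gamma>(2) using 1 2 3 by (intro real_sqrt_le_mono add_mono)
      also have "\<dots> < sqrt (e\<^sup>2)" using e by (intro real_sqrt_less_mono) (simp add: \<delta>_def power2_eq_square)
      also have "\<dots> = e" using e by simp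
      finally show ?thesis using sobolev_norm_nonneg[of s "\<sigma> n - \<gamma>"] by simp
    qed
    then show "\<exists>no. \<forall>n\<ge>no. norm (sobolev_norm s (\<sigma> n - \<gamma>) - 0) < e" by blast
  qed
  then show ?thesis using \<gamma>(1) by blast
qed

lemma banach_carrier_sobolev:
  assumes s: "1/2 < s"
  shows "banach_carrier (sobolev s :: (real \<Rightarrow>\<^sub>C 'b::euclidean_space) set) (sobolev_norm s)"
proof
  have z: "0 \<in> (sobolev s :: (real \<Rightarrow>\<^sub>C 'b) set)"
    using sobolevI(1)[of "0 :: real \<Rightarrow>\<^sub>C 'b" "\<lambda>_. 0" s] sobolev_fun_const[of 0 s]
    by (simp add: periodic1_def zero_bcontfun.rep_eq)
  then show "subspace (sobolev s :: (real \<Rightarrow>\<^sub>C 'b) set)"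
    by (auto simp: subspace_def sobolev_add[OF s] sobolev_scaleR[OF s])
  fix \<gamma> \<eta> :: "real \<Rightarrow>\<^sub>C 'b" and c :: real
  show "0 \<le> sobolev_norm s \<gamma>" by (rule sobolev_norm_nonneg)
  show "sobolev_norm s (- \<gamma>) = sobolev_norm s \<gamma>" by (rule sobolev_norm_uminus)
  assume \<gamma>: "\<gamma> \<in> sobolev s"
  show "sobolev_norm s (c *\<^sub>R \<gamma>) = \<bar>c\<bar> * sobolev_norm s \<gamma>" by (rule sobolev_norm_scaleR[OF s \<gamma>])
  show "sobolev_norm s (\<gamma> + \<eta>) \<le> sobolev_norm s \<gamma> + sobolev_norm s \<eta>" if "\<eta> \<in> sobolev s"
    by (rule sobolev_norm_add[OF s \<gamma> that])
  show "\<gamma> = 0" if "sobolev_norm s \<gamma> = 0"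
  proof (rule bcontfun_eqI)
    obtain K where "\<And>(\<gamma> :: real \<Rightarrow>\<^sub>C 'b) t. \<gamma> \<in> sobolev s \<Longrightarrow> norm (apply_bcontfun \<gamma> t) \<le> K * sobolev_norm s \<gamma>"
      by (rule sobolev_sup[OF s, where 'b = 'b]) (rule that; blast)
    from this[OF \<gamma>] that show "apply_bcontfun \<gamma> x = apply_bcontfun 0 x" for x by simp
  qed
next
  fix \<sigma> :: "nat \<Rightarrow> (real \<Rightarrow>\<^sub>C 'b)"
  assume "\<And>n. \<sigma> n \<in> sobolev s" "\<And>e. 0 < e \<Longrightarrow> \<exists>N. \<forall>m\<ge>N. \<forall>n\<ge>N. sobolev_norm s (\<sigma> m - \<sigma> n) < e"
  then show "\<exists>x\<in>sobolev s. (\<lambda>n. sobolev_norm s (\<sigma> n - x)) \<longlonglongrightarrow> 0"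
    by (rule sobolev_complete[OF s])
qed

section \<open>Closed curves with prescribed tangential component of the velocity\<close>

text \<open>
  The mean \<open>M b\<close> of the components of \<open>b\<close> normal to a closed unit speed curve depends
  linearly on \<open>b\<close>, and \<open>b \<bullet> M b\<close> is the integral of \<open>\<bar>b\<bar>\<^sup>2 - (b \<bullet> u)\<^sup>2 \<ge> 0\<close>. If \<open>M b = 0\<close>,
  then \<open>b \<bullet> u\<close> takes only the values \<open>\<plusminus> \<bar>b\<bar>\<close> and is constant by continuity. Its mean is
  \<open>0\<close> because the curve with velocity \<open>u\<close> is closed, so \<open>b = 0\<close>. Hence \<open>M\<close> is injective,
  and bijective by finite dimension; \<open>A\<close> is its inverse.
\<close>

lemma mean_normal_part_surjective:
  fixes u :: "real \<Rightarrow> 'b::euclidean_space"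
  assumes u: "continuous_on UNIV u" and unit: "\<And>t. norm (u t) = 1" and mean: "prim u 1 = 0"
  obtains A where "bounded_linear A" "\<And>y. prim (\<lambda>t. A y - (A y \<bullet> u t) *\<^sub>R u t) 1 = y"
proof -
  define M where "M b = prim (\<lambda>t. b - (b \<bullet> u t) *\<^sub>R u t) 1" for b
  have c: "continuous_on UNIV (\<lambda>t. b - (b \<bullet> u t) *\<^sub>R u t)" for b by (intro continuous_intros u)
  have l: "loc_integrable (\<lambda>t. b - (b \<bullet> u t) *\<^sub>R u t)" for b by (rule loc_integrable_continuous[OF c])
  have "linear M"
  proof
    fix b b' and r :: real
    have "(\<lambda>t. (b + b') - ((b + b') \<bullet> u t) *\<^sub>R u t) = (\<lambda>t. (b - (b \<bullet> u t) *\<^sub>R u t) + (b' - (b' \<bullet> u t) *\<^sub>R u t))"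
      by (simp add: fun_eq_iff inner_add_left scaleR_add_left)
    then show "M (b + b') = M b + M b'" by (simp only: M_def prim_add[OF l l])
    have "(\<lambda>t. (r *\<^sub>R b) - ((r *\<^sub>R b) \<bullet> u t) *\<^sub>R u t) = (\<lambda>t. r *\<^sub>R (b - (b \<bullet> u t) *\<^sub>R u t))"
      by (simp add: fun_eq_iff scaleR_diff_right)
    then show "M (r *\<^sub>R b) = r *\<^sub>R M b" by (simp only: M_def prim_scaleR)
  qed
  have ker: "b = 0" if "M b = 0" for b
  proof (rule ccontr)
    assume b: "b \<noteq> 0"
    define k where "k t = (norm b)\<^sup>2 - (b \<bullet> u t)\<^sup>2" for t
    have ck: "continuous_on UNIV k" unfolding k_def by (intro continuous_intros u)
    have cs: "\<bar>b \<bullet> u t\<bar> \<le> norm b" for t using Cauchy_Schwarz_ineq2[of b "u t"] unit by simp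
    have k0: "0 \<le> k t" for t using power_mono[OF cs abs_ge_zero, of t 2] by (simp add: k_def)
    have "prim k 1 = b \<bullet> M b"
    proof -
      have "k = (\<lambda>t. b \<bullet> (b - (b \<bullet> u t) *\<^sub>R u t))"
        by (simp add: fun_eq_iff k_def inner_diff_right power2_norm_eq_inner power2_eq_square[of "b \<bullet> _"])
      then show ?thesis using prim_bounded_linear[OF bounded_linear_inner_right l, of b b 1] by (simp add: M_def)
    qed
    then have "integral {0..1} k = 0"
      using that prim_eq_integral[OF loc_integrable_continuous[OF ck], of 0 1] by simp
    then have kz: "k t = 0" if "t \<in> {0..1}" for t
      using integral_eq_0_iff[OF continuous_on_subset[OF ck]] k0 that by auto
    have val: "b \<bullet> u t = norm b \<or> b \<bullet> u t = - norm b" if "t \<in> {0..1}" for t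
    proof -
      have "norm b = b \<bullet> u t \<or> norm b = - (b \<bullet> u t)" using kz[OF that] by (simp add: k_def power2_eq_iff)
      then show ?thesis by linarith
    qed
    have cb: "continuous_on {0..1} (\<lambda>t. b \<bullet> u t)" by (intro continuous_intros continuous_on_subset[OF u]) auto
    have conn: "connected ((\<lambda>t. b \<bullet> u t) ` {0..1})" by (intro connected_continuous_image cb) auto
    have same: "b \<bullet> u t = b \<bullet> u 0" if t: "t \<in> {0..1}" for t
    proof (rule ccontr)
      assume ne: "b \<bullet> u t \<noteq> b \<bullet> u 0"
      have "0 \<in> (\<lambda>t. b \<bullet> u t) ` {0..1}"
      proof (cases "b \<bullet> u t \<le> b \<bullet> u 0")
        case True
        then have "b \<bullet> u t \<le> 0" "0 \<le> b \<bullet> u 0" using val[OF t] val[of 0] ne by auto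
        then show ?thesis using connectedD_interval[OF conn, of "b \<bullet> u t" "b \<bullet> u 0" 0] t by auto
      next
        case False
        then have "b \<bullet> u 0 \<le> 0" "0 \<le> b \<bullet> u t" using val[OF t] val[of 0] ne by auto
        then show ?thesis using connectedD_interval[OF conn, of "b \<bullet> u 0" "b \<bullet> u t" 0] t by auto
      qed
      then obtain x where "x \<in> {0..1}" "b \<bullet> u x = 0" by auto
      then show False using val[of x] b by auto
    qed
    have lb: "loc_integrable (\<lambda>t. b \<bullet> u t)" by (intro loc_integrable_continuous continuous_intros u)
    have "b \<bullet> u 0 = integral {0..1::real} (\<lambda>t. b \<bullet> u 0)" by simp
    also have "\<dots> = integral {0..1} (\<lambda>t. b \<bullet> u t)" by (intro Henstock_Kurzweil_Integration.integral_cong) (simp only: same)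
    also have "\<dots> = prim (\<lambda>t. b \<bullet> u t) 1" using prim_eq_integral[OF lb, of 0 1] by simp
    also have "\<dots> = b \<bullet> prim u 1" by (rule prim_bounded_linear[OF bounded_linear_inner_right loc_integrable_continuous[OF u]])
    also have "\<dots> = 0" by (simp add: mean)
    finally show False using val[of 0] b by auto
  qed
  have "inj M" using \<open>linear M\<close> ker by (simp add: linear_injective_0)
  then obtain A where A: "linear A" "\<forall>x. A (M x) = x" "\<forall>x. M (A x) = x"
    using linear_injective_isomorphism[OF \<open>linear M\<close>] by blast
  have "prim (\<lambda>t. A y - (A y \<bullet> u t) *\<^sub>R u t) 1 = y" for y using A(3) unfolding M_def by (rule spec)
  then show ?thesis using that linear_conv_bounded_linear A(1) by blast
qed

lemma bcontfun_of_periodic: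
  fixes g :: "real \<Rightarrow> 'b::euclidean_space"
  assumes "continuous_on UNIV g" "periodic1 g"
  shows "apply_bcontfun (Bcontfun g) = g"
proof -
  have "compact (g ` {0..1})" by (intro compact_continuous_image continuous_on_subset[OF assms(1)]) auto
  then have "bounded (g ` {0..1})" by (rule compact_imp_bounded)
  moreover have "range g \<subseteq> g ` {0..1}"
  proof (rule image_subsetI)
    fix t
    have "g t = g (frac t)" by (rule periodic1_frac[OF assms(2), symmetric])
    then show "g t \<in> g ` {0..1}" using frac_ge_0[of t] frac_lt_1[of t] by (auto simp: less_imp_le)
  qed
  ultimately have "g \<in> bcontfun" using assms(1) bounded_subset by (auto simp: bcontfun_def)
  then show ?thesis by (rule Bcontfun_inverse)
qed

text \<open>
  A velocity field with tangential component \<open>l\<close>: the obvious choice \<open>l u\<close> is corrected by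
  the normal part of a constant vector that makes the mean vanish, so that the primitive
  is a closed curve.
\<close>

definition closing :: "(real \<Rightarrow> 'b::euclidean_space) \<Rightarrow> ('b \<Rightarrow> 'b) \<Rightarrow> (real \<Rightarrow> real) \<Rightarrow> real \<Rightarrow> 'b" where
  "closing u A l t = l t *\<^sub>R u t - (A (prim (\<lambda>x. l x *\<^sub>R u x) 1) - (A (prim (\<lambda>x. l x *\<^sub>R u x) 1) \<bullet> u t) *\<^sub>R u t)"

text \<open>
  The right inverse of \<open>h \<mapsto> u \<bullet> h'\<close>, called \<open>R\<close> in the introduction.
\<close>

definition lift :: "(real \<Rightarrow> 'b::euclidean_space) \<Rightarrow> ('b \<Rightarrow> 'b) \<Rightarrow> (real \<Rightarrow> real) \<Rightarrow> (real \<Rightarrow>\<^sub>C 'b)" where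
  "lift u A l = Bcontfun (prim (closing u A l))"

lemma inner_closing:
  assumes "norm (u t) = 1" shows "u t \<bullet> closing u A l t = l t"
proof -
  have "u t \<bullet> u t = 1" using assms by (simp add: norm_eq_1)
  then show ?thesis by (simp add: closing_def inner_diff_right inner_commute)
qed

lemma L2_norm_sq_prim_le:
  assumes v: "continuous_on UNIV v" "periodic1 v" "prim v 1 = 0" "\<And>t. norm (v t) \<le> a"
  shows "L2_norm_sq (prim v) \<le> a\<^sup>2"
proof -
  have lv: "loc_integrable v" by (rule loc_integrable_continuous[OF v(1)])
  have p: "periodic1 (prim v)" by (rule periodic1_prim[OF lv v(2,3)])
  have a: "0 \<le> a" using v(4)[of 0] by (rule order_trans[OF norm_ge_zero])
  have "norm (prim v t) \<le> a" for t
  proof -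
    have "norm (prim v (frac t)) \<le> a * frac t" by (rule norm_prim_continuous_le[OF v(1,4) frac_ge_0])
    also have "\<dots> \<le> a * 1" using a frac_lt_1[of t] by (intro mult_left_mono) auto
    finally show ?thesis by (simp add: periodic1_frac[OF p])
  qed
  then show ?thesis by (intro L2_norm_sq_le_sup continuous_on_prim lv p)
qed

text \<open>
  All estimates reduce to the algebra property and the sup bound of \<open>H\<^sup>s\<close>: \<open>closing u A l\<close>
  is obtained from \<open>l\<close>, \<open>u\<close> and constants by products and sums.
\<close>

lemma lift_properties:
  fixes u :: "real \<Rightarrow> 'b::euclidean_space"
  assumes s: "1/2 < s" and u: "u \<in> sobolev_fun s" and unit: "\<And>t. norm (u t) = 1"
    and A: "bounded_linear A" "\<And>y. prim (\<lambda>t. A y - (A y \<bullet> u t) *\<^sub>R u t) 1 = y"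
  obtains K where "0 \<le> K" "\<And>l. l \<in> sobolev_fun s \<Longrightarrow> lift u A l \<in> sobolev s"
    "\<And>l. l \<in> sobolev_fun s \<Longrightarrow> velocity (lift u A l) = closing u A l"
    "\<And>l. l \<in> sobolev_fun s \<Longrightarrow> apply_bcontfun (lift u A l) = prim (closing u A l)"
    "\<And>l. l \<in> sobolev_fun s \<Longrightarrow> sobolev_norm s (lift u A l) \<le> K * Hs_norm s l"
proof -
  interpret A: bounded_linear A by fact
  obtain K1 where K1: "0 \<le> K1" "\<And>l w. l \<in> sobolev_fun s \<Longrightarrow> w \<in> sobolev_fun s \<Longrightarrow> (\<lambda>x. (l x :: real) *\<^sub>R (w x :: 'b)) \<in> sobolev_fun s"
    "\<And>l w. l \<in> sobolev_fun s \<Longrightarrow> w \<in> sobolev_fun s \<Longrightarrow> Hs_norm s (\<lambda>x. (l x :: real) *\<^sub>R (w x :: 'b)) \<le> K1 * Hs_norm s l * Hs_norm s w"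
    by (rule Hs_norm_bilinear[OF bounded_bilinear_scaleR s]) (rule that; fast)
  obtain K2 where K2: "0 \<le> K2" "\<And>v w. v \<in> sobolev_fun s \<Longrightarrow> w \<in> sobolev_fun s \<Longrightarrow> (\<lambda>x. (v x :: 'b) \<bullet> w x) \<in> sobolev_fun s"
    "\<And>v w. v \<in> sobolev_fun s \<Longrightarrow> w \<in> sobolev_fun s \<Longrightarrow> Hs_norm s (\<lambda>x. (v x :: 'b) \<bullet> w x) \<le> K2 * Hs_norm s v * Hs_norm s w"
    by (rule Hs_norm_bilinear[OF bounded_bilinear_inner s]) (rule that; fast)
  obtain K3 where K3: "0 < K3" "\<And>(v :: real \<Rightarrow> 'b) t. v \<in> sobolev_fun s \<Longrightarrow> norm (v t) \<le> K3 * Hs_norm s v"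
    by (rule Hs_norm_sup[OF s, where 'b = 'b]) (rule that; blast)
  obtain KA where KA: "0 \<le> KA" "\<And>x. norm (A x) \<le> norm x * KA" using A.nonneg_bounded by blast
  define U where "U = Hs_norm s u"
  have U: "0 \<le> U" by (simp add: U_def)
  define M where "M = K1 * U + K3 * K1 * U * KA * (1 + K1 * K2 * U * U)"
  have M: "0 \<le> M" using U K1(1) K2(1) K3(1) KA(1) by (auto simp: M_def)
  have main: "lift u A l \<in> sobolev s \<and> velocity (lift u A l) = closing u A l \<and> apply_bcontfun (lift u A l) = prim (closing u A l)
      \<and> sobolev_norm s (lift u A l) \<le> sqrt (K3\<^sup>2 + 1) * M * Hs_norm s l" if l: "l \<in> sobolev_fun s" for l
  proof -
    define y where "y = prim (\<lambda>x. l x *\<^sub>R u x) 1"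
    let ?b = "A y"
    have lu: "(\<lambda>x. l x *\<^sub>R u x) \<in> sobolev_fun s" by (rule K1(2)[OF l u])
    have bu: "(\<lambda>x. ?b \<bullet> u x) \<in> sobolev_fun s" by (rule K2(2)[OF sobolev_fun_const u])
    have buu: "(\<lambda>x. (?b \<bullet> u x) *\<^sub>R u x) \<in> sobolev_fun s" by (rule K1(2)[OF bu u])
    have pb: "(\<lambda>x. ?b - (?b \<bullet> u x) *\<^sub>R u x) \<in> sobolev_fun s" by (rule sobolev_fun_diff[OF sobolev_fun_const buu])
    have cl: "closing u A l = (\<lambda>t. l t *\<^sub>R u t - (?b - (?b \<bullet> u t) *\<^sub>R u t))" by (simp add: fun_eq_iff closing_def y_def)
    have mem: "closing u A l \<in> sobolev_fun s" unfolding cl by (rule sobolev_fun_diff[OF lu pb])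
    note md = sobolev_funD[OF mem]
    have z: "prim (closing u A l) 1 = 0"
      unfolding cl prim_minus[OF loc_integrable_continuous[OF sobolev_funD(1)[OF lu]] loc_integrable_continuous[OF sobolev_funD(1)[OF pb]]] A(2)
      by (simp add: y_def)
    have lc: "loc_integrable (closing u A l)" by (rule loc_integrable_continuous[OF md(1)])
    have ap: "apply_bcontfun (lift u A l) = prim (closing u A l)"
      unfolding lift_def by (intro bcontfun_of_periodic continuous_on_prim periodic1_prim lc md(2) z)
    have p: "periodic1 (apply_bcontfun (lift u A l))" unfolding ap by (intro periodic1_prim lc md(2) z)
    have d: "(apply_bcontfun (lift u A l) has_vector_derivative closing u A l t) (at t)" for t
      unfolding ap by (rule prim_has_vector_derivative[OF md(1)])
    note sI = sobolevI[OF p mem d]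
    have n1: "Hs_norm s (\<lambda>x. l x *\<^sub>R u x) \<le> K1 * U * Hs_norm s l" using K1(3)[OF l u] by (simp add: U_def mult_ac)
    have "norm y \<le> K3 * Hs_norm s (\<lambda>x. l x *\<^sub>R u x) * 1"
      unfolding y_def by (rule norm_prim_continuous_le[OF sobolev_funD(1)[OF lu] K3(2)[OF lu]]) simp
    also have "\<dots> \<le> K3 * (K1 * U * Hs_norm s l)" using n1 K3(1) by simp
    finally have ny: "norm y \<le> K3 * (K1 * U * Hs_norm s l)" .
    have "norm ?b \<le> norm y * KA" by (rule KA(2))
    also have "\<dots> \<le> (K3 * (K1 * U * Hs_norm s l)) * KA" by (intro mult_right_mono ny KA(1))
    finally have nb: "norm ?b \<le> K3 * K1 * U * KA * Hs_norm s l" by (simp add: mult_ac)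
    have "Hs_norm s (\<lambda>x. (?b \<bullet> u x) *\<^sub>R u x) \<le> K1 * Hs_norm s (\<lambda>x. ?b \<bullet> u x) * U" using K1(3)[OF bu u] by (simp add: U_def)
    also have "\<dots> \<le> K1 * (K2 * norm ?b * U) * U"
      using K2(3)[OF sobolev_fun_const u, of ?b] K1(1) U by (intro mult_right_mono mult_left_mono) (auto simp: Hs_norm_const U_def)
    finally have n3: "Hs_norm s (\<lambda>x. (?b \<bullet> u x) *\<^sub>R u x) \<le> (K1 * K2 * U * U) * norm ?b" by (simp add: mult_ac)
    have "Hs_norm s (closing u A l) \<le> Hs_norm s (\<lambda>x. l x *\<^sub>R u x) + Hs_norm s (\<lambda>x. ?b - (?b \<bullet> u x) *\<^sub>R u x)"
      unfolding cl by (rule Hs_norm_diff[OF lu pb])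
    also have "\<dots> \<le> K1 * U * Hs_norm s l + (norm ?b + (K1 * K2 * U * U) * norm ?b)"
      using Hs_norm_diff[OF sobolev_fun_const buu, of ?b] n1 n3 by (simp add: Hs_norm_const)
    also have "\<dots> = K1 * U * Hs_norm s l + norm ?b * (1 + K1 * K2 * U * U)" by (simp add: algebra_simps)
    also have "\<dots> \<le> K1 * U * Hs_norm s l + (K3 * K1 * U * KA * Hs_norm s l) * (1 + K1 * K2 * U * U)"
      using K1(1) K2(1) U by (intro add_left_mono mult_right_mono nb) auto
    also have "\<dots> = M * Hs_norm s l" by (simp add: M_def algebra_simps)
    finally have nc: "Hs_norm s (closing u A l) \<le> M * Hs_norm s l" .
    have "L2_norm_sq (prim (closing u A l)) \<le> (K3 * Hs_norm s (closing u A l))\<^sup>2"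
      by (rule L2_norm_sq_prim_le[OF md(1,2) z K3(2)[OF mem]])
    then have "sobolev_norm s (lift u A l) \<le> sqrt ((K3 * Hs_norm s (closing u A l))\<^sup>2 + (Hs_norm s (closing u A l))\<^sup>2)"
      unfolding sobolev_velocity(3)[OF s sI(1)] sI(2) ap by (intro real_sqrt_le_mono add_right_mono)
    also have "\<dots> = sqrt (K3\<^sup>2 + 1) * Hs_norm s (closing u A l)"
    proof -
      have "(K3 * Hs_norm s (closing u A l))\<^sup>2 + (Hs_norm s (closing u A l))\<^sup>2 = (K3\<^sup>2 + 1) * (Hs_norm s (closing u A l))\<^sup>2"
        by (simp add: power_mult_distrib distrib_right)
      then show ?thesis by (simp add: real_sqrt_mult)
    qed
    also have "\<dots> \<le> sqrt (K3\<^sup>2 + 1) * (M * Hs_norm s l)" by (intro mult_left_mono nc) simp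
    finally show ?thesis using sI ap by (simp add: mult.assoc)
  qed
  show ?thesis
    by (rule that[of "sqrt (K3\<^sup>2 + 1) * M"]) (use main M in auto)
qed

lemma prim_linear_comb:
  "continuous_on UNIV f \<Longrightarrow> continuous_on UNIV g \<Longrightarrow> prim (\<lambda>x. c *\<^sub>R f x + g x) t = c *\<^sub>R prim f t + prim g t"
  using prim_add[OF loc_integrable_scaleR[OF loc_integrable_continuous] loc_integrable_continuous] by (simp add: prim_scaleR)

lemma lift_linear:
  assumes A: "bounded_linear A" and u: "continuous_on UNIV u"
    and l: "l \<in> sobolev_fun s" "apply_bcontfun (lift u A l) = prim (closing u A l)" "continuous_on UNIV (closing u A l)"
    and m: "m \<in> sobolev_fun s" "apply_bcontfun (lift u A m) = prim (closing u A m)" "continuous_on UNIV (closing u A m)"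
    and lm: "apply_bcontfun (lift u A (\<lambda>x. c * l x + m x)) = prim (closing u A (\<lambda>x. c * l x + m x))"
  shows "lift u A (\<lambda>x. c * l x + m x) = c *\<^sub>R lift u A l + lift u A m"
proof (rule bcontfun_eqI)
  fix t
  interpret A: bounded_linear A by fact
  have "(\<lambda>x. (c * l x + m x) *\<^sub>R u x) = (\<lambda>x. c *\<^sub>R (l x *\<^sub>R u x) + m x *\<^sub>R u x)"
    by (simp add: fun_eq_iff scaleR_add_left)
  then have "prim (\<lambda>x. (c * l x + m x) *\<^sub>R u x) 1 = c *\<^sub>R prim (\<lambda>x. l x *\<^sub>R u x) 1 + prim (\<lambda>x. m x *\<^sub>R u x) 1"
    using prim_linear_comb[of "\<lambda>x. l x *\<^sub>R u x" "\<lambda>x. m x *\<^sub>R u x" c 1] sobolev_funD(1)[OF l(1)] sobolev_funD(1)[OF m(1)] u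
    by (simp add: continuous_on_scaleR)
  then have "closing u A (\<lambda>x. c * l x + m x) = (\<lambda>x. c *\<^sub>R closing u A l x + closing u A m x)"
    by (simp add: fun_eq_iff closing_def A.add A.scaleR inner_add_left algebra_simps)
  then show "apply_bcontfun (lift u A (\<lambda>x. c * l x + m x)) t = apply_bcontfun (c *\<^sub>R lift u A l + lift u A m) t"
    using prim_linear_comb[OF l(3) m(3), of c t] by (simp add: lm l(2) m(2))
qed

section \<open>Openness of regularity and injectivity\<close>

lemma periodic_norm_lower_bound:
  fixes w :: "real \<Rightarrow> 'b::euclidean_space"
  assumes w: "continuous_on UNIV w" "periodic1 w" and pos: "\<And>t. 0 < norm (w t)"
  obtains m where "0 < m" "\<And>t. m \<le> norm (w t)"
proof -
  have "continuous_on {0..1} (\<lambda>t. norm (w t))" by (intro continuous_intros continuous_on_subset[OF w(1)]) auto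
  then obtain a where a: "\<forall>t\<in>{0..1}. norm (w a) \<le> norm (w t)"
    using continuous_attains_inf[of "{0..1::real}" "\<lambda>t. norm (w t)"] by auto
  have "norm (w a) \<le> norm (w t)" for t
    using bspec[OF a, of "frac t"] frac_ge_0[of t] frac_lt_1[of t] periodic1_frac[OF w(2), of t] by (simp add: less_imp_le)
  with pos[of a] show ?thesis by (rule that)
qed

lemma sobolev_regular_iff: "\<gamma> \<in> sobolev_regular s \<longleftrightarrow> \<gamma> \<in> sobolev s \<and> (\<forall>t. 0 < norm (velocity \<gamma> t))"
  by (simp add: sobolev_regular_def velocity_def)

lemma arclength_curves_iff: "\<gamma> \<in> arclength_curves s \<longleftrightarrow> \<gamma> \<in> sobolev s \<and> (\<forall>t. norm (velocity \<gamma> t) = 1)"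
  by (simp add: arclength_curves_def velocity_def)

text \<open>
  On the compact circle, the speed of a regular curve is bounded below by some \<open>m > 0\<close>,
  and the velocity depends continuously on the curve in the sup norm.
\<close>

lemma openin_sobolev_regular:
  assumes s: "1/2 < s"
  shows "openin (norm_topology (sobolev s) (sobolev_norm s)) (sobolev_regular s :: (real \<Rightarrow>\<^sub>C 'b::euclidean_space) set)"
  unfolding banach_carrier.openin_norm_topology[OF banach_carrier_sobolev[OF s]]
proof (intro conjI ballI)
  show "(sobolev_regular s :: (real \<Rightarrow>\<^sub>C 'b) set) \<subseteq> sobolev s" by (auto simp: sobolev_regular_iff)
  fix \<gamma> :: "real \<Rightarrow>\<^sub>C 'b" assume "\<gamma> \<in> sobolev_regular s"
  then have \<gamma>: "\<gamma> \<in> sobolev s" and pos: "\<And>t. 0 < norm (velocity \<gamma> t)" by (auto simp: sobolev_regular_iff)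
  obtain m where m: "0 < m" "\<And>t. m \<le> norm (velocity \<gamma> t)"
    using periodic_norm_lower_bound[OF sobolev_funD(1,2)[OF sobolev_velocity(1)[OF s \<gamma>]] pos] by blast
  obtain K where K: "0 < K" "\<And>(\<gamma> :: real \<Rightarrow>\<^sub>C 'b) t. \<gamma> \<in> sobolev s \<Longrightarrow> norm (velocity \<gamma> t) \<le> K * sobolev_norm s \<gamma>"
    by (rule sobolev_sup[OF s, where 'b = 'b]) (rule that; blast)
  show "\<exists>r>0. \<forall>\<eta>\<in>sobolev s. sobolev_norm s (\<eta> - \<gamma>) < r \<longrightarrow> \<eta> \<in> sobolev_regular s"
  proof (intro exI[of _ "m / K"] conjI ballI impI)
    show "0 < m / K" using m(1) K(1) by simp
    fix \<eta> :: "real \<Rightarrow>\<^sub>C 'b" assume \<eta>: "\<eta> \<in> sobolev s" and near: "sobolev_norm s (\<eta> - \<gamma>) < m / K"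
    have "0 < norm (velocity \<eta> t)" for t
    proof -
      have "norm (velocity \<eta> t - velocity \<gamma> t) \<le> K * sobolev_norm s (\<eta> - \<gamma>)"
        using K(2)[OF sobolev_diff(1)[OF s \<eta> \<gamma>], of t] by (simp add: sobolev_diff(2)[OF s \<eta> \<gamma>])
      also have "\<dots> < m" using near K(1) by (simp add: pos_less_divide_eq mult.commute)
      also have "m \<le> norm (velocity \<gamma> t)" by (rule m(2))
      finally have "velocity \<eta> t \<noteq> 0" by auto
      then show ?thesis by simp
    qed
    with \<eta> show "\<eta> \<in> sobolev_regular s" by (simp add: sobolev_regular_iff)
  qed
qed

lemma periodic_injective_separated:
  assumes p: "periodic1 g" and inj: "inj_on g {0..<1}" and xy: "0 < y - x" "y - x < 1"
  shows "g x \<noteq> g y"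
proof
  assume "g x = g y"
  then have "g (frac x) = g (frac y)" by (simp add: periodic1_frac[OF p])
  then have "frac x = frac y"
    using inj frac_ge_0[of x] frac_lt_1[of x] frac_ge_0[of y] frac_lt_1[of y] by (auto simp: inj_on_def)
  then have eq: "y - x = real_of_int (\<lfloor>y\<rfloor> - \<lfloor>x\<rfloor>)" by (simp add: frac_def)
  then have "0 < \<lfloor>y\<rfloor> - \<lfloor>x\<rfloor>" "\<lfloor>y\<rfloor> - \<lfloor>x\<rfloor> < 1" using xy by linarith+
  then show False by simp
qed

text \<open>
  For parameters at distance less than \<open>\<delta>\<close>, nearby curves are injective because their
  velocities stay close to a fixed nonzero vector, so that the chord does not vanish. For
  parameters at distance at least \<open>\<delta>\<close> on the circle, the chord of \<open>\<gamma>\<close> is bounded below by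
  compactness, and it changes little under a uniformly small perturbation.
\<close>

lemma openin_sobolev_injective_regular:
  assumes s: "1/2 < s"
  shows "openin (norm_topology (sobolev s) (sobolev_norm s)) (sobolev_injective_regular s :: (real \<Rightarrow>\<^sub>C 'b::euclidean_space) set)"
  unfolding banach_carrier.openin_norm_topology[OF banach_carrier_sobolev[OF s]]
proof (intro conjI ballI)
  show "(sobolev_injective_regular s :: (real \<Rightarrow>\<^sub>C 'b) set) \<subseteq> sobolev s"
    by (auto simp: sobolev_injective_regular_def sobolev_regular_iff)
  fix \<gamma> :: "real \<Rightarrow>\<^sub>C 'b" assume "\<gamma> \<in> sobolev_injective_regular s"
  then have \<gamma>: "\<gamma> \<in> sobolev s" and pos: "\<And>t. 0 < norm (velocity \<gamma> t)" and inj: "inj_on (apply_bcontfun \<gamma>) {0..<1}"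
    by (auto simp: sobolev_injective_regular_def sobolev_regular_iff)
  let ?g = "apply_bcontfun \<gamma>"
  note pg = sobolev_periodic[OF \<gamma>] and v\<gamma> = sobolev_velocity[OF s \<gamma>]
  obtain m where m: "0 < m" "\<And>t. m \<le> norm (velocity \<gamma> t)"
    using periodic_norm_lower_bound[OF sobolev_funD(1,2)[OF v\<gamma>(1)] pos] by blast
  obtain K where K: "0 < K" "\<And>(\<gamma> :: real \<Rightarrow>\<^sub>C 'b) t. \<gamma> \<in> sobolev s \<Longrightarrow> norm (velocity \<gamma> t) \<le> K * sobolev_norm s \<gamma>"
    "\<And>(\<gamma> :: real \<Rightarrow>\<^sub>C 'b) t. \<gamma> \<in> sobolev s \<Longrightarrow> norm (apply_bcontfun \<gamma> t) \<le> K * sobolev_norm s \<gamma>"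
    by (rule sobolev_sup[OF s, where 'b = 'b]) (rule that; blast)
  \<comment> \<open>The interval \<open>[0,2]\<close> contains an arc \<open>[x,y]\<close> of each length below \<open>1\<close> from each starting
    point \<open>x\<close> in \<open>[0,1]\<close>.\<close>
  have "uniformly_continuous_on {0..2} (velocity \<gamma>)"
    by (intro compact_uniformly_continuous continuous_on_subset[OF sobolev_funD(1)[OF v\<gamma>(1)]]) auto
  then obtain \<delta>0 where \<delta>0: "0 < \<delta>0" "\<And>x y. x \<in> {0..2} \<Longrightarrow> y \<in> {0..2} \<Longrightarrow> dist x y < \<delta>0 \<Longrightarrow> dist (velocity \<gamma> x) (velocity \<gamma> y) < m/4"
    unfolding uniformly_continuous_on_def using m(1) by (metis zero_less_divide_iff zero_less_numeral)
  define \<delta> where "\<delta> = min \<delta>0 (1/2)"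
  have \<delta>: "0 < \<delta>" "\<delta> \<le> 1/2" "\<delta> \<le> \<delta>0" using \<delta>0(1) by (auto simp: \<delta>_def)
  \<comment> \<open>The pairs of parameters at distance at least \<open>\<delta>\<close> on the circle.\<close>
  define C where "C = ({0..1} \<times> {0..2}) \<inter> ({p. fst p + \<delta> \<le> snd p} \<inter> {p :: real \<times> real. snd p \<le> fst p + (1 - \<delta>)})"
  have "compact C"
    unfolding C_def by (intro compact_Int_closed compact_Times closed_Int closed_Collect_le continuous_intros) auto
  have "\<exists>\<mu>>0. \<forall>x y. (x, y) \<in> C \<longrightarrow> \<mu> \<le> norm (?g x - ?g y)"
  proof (cases "C = {}")
    case True then show ?thesis by (intro exI[of _ 1]) auto
  next
    case False
    have "continuous_on C (\<lambda>p. norm (?g (fst p) - ?g (snd p)))"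
      by (intro continuous_intros continuous_on_compose2[OF continuous_on_bcontfun]) auto
    then obtain q where q: "q \<in> C" "\<forall>p\<in>C. norm (?g (fst q) - ?g (snd q)) \<le> norm (?g (fst p) - ?g (snd p))"
      using continuous_attains_inf[OF \<open>compact C\<close> False] by blast
    have "?g (fst q) \<noteq> ?g (snd q)"
      using q(1) \<delta> by (intro periodic_injective_separated[OF pg inj]) (auto simp: C_def)
    then show ?thesis using q(2) by (intro exI[of _ "norm (?g (fst q) - ?g (snd q))"]) auto
  qed
  then obtain \<mu> where \<mu>: "0 < \<mu>" "\<And>x y. (x, y) \<in> C \<Longrightarrow> \<mu> \<le> norm (?g x - ?g y)" by blast
  define r where "r = min (m / (4 * K)) (\<mu> / (4 * K))"
  have r: "0 < r" "K * r \<le> m/4" "K * r \<le> \<mu>/4"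
    using m(1) \<mu>(1) K(1) by (auto simp: r_def min_def field_simps)
  show "\<exists>r>0. \<forall>\<eta>\<in>sobolev s. sobolev_norm s (\<eta> - \<gamma>) < r \<longrightarrow> \<eta> \<in> sobolev_injective_regular s"
  proof (intro exI[of _ r] conjI ballI impI)
    fix \<eta> :: "real \<Rightarrow>\<^sub>C 'b" assume \<eta>: "\<eta> \<in> sobolev s" and near: "sobolev_norm s (\<eta> - \<gamma>) < r"
    let ?h = "apply_bcontfun \<eta>"
    note df = sobolev_diff[OF s \<eta> \<gamma>] and v\<eta> = sobolev_velocity[OF s \<eta>]
    have "K * sobolev_norm s (\<eta> - \<gamma>) \<le> K * r" using near K(1) by simp
    then have cv: "norm (velocity \<eta> t - velocity \<gamma> t) \<le> m/4" and cg: "norm (?h t - ?g t) \<le> \<mu>/4" for t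
      using K(2)[OF df(1), of t] K(3)[OF df(1), of t] r by (auto simp: df(2))
    have reg: "0 < norm (velocity \<eta> t)" for t
      using cv[of t] m(2)[of t] m(1) norm_triangle_ineq2[of "velocity \<gamma> t" "velocity \<eta> t"]
        norm_minus_commute[of "velocity \<gamma> t" "velocity \<eta> t"] by linarith
    have close: "?h x \<noteq> ?h y" if xy: "0 \<le> x" "x < y" "y \<le> 2" "y - x < \<delta>" for x y
    proof
      assume eq: "?h x = ?h y"
      \<comment> \<open>If the chord vanished, \<open>(y - x) \<gamma>' x\<close> would be the integral of \<open>\<gamma>' x - \<eta>'\<close> over
        \<open>[x,y]\<close>, and the values of this function have norm at most \<open>m/2\<close>, whereas
        \<open>\<bar>\<gamma>' x\<bar> \<ge> m\<close>.\<close>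
      have "((\<lambda>z. z *\<^sub>R velocity \<gamma> x) has_vector_derivative velocity \<gamma> x) (at z)" for z
        by (auto intro!: derivative_eq_intros)
      then have D: "((\<lambda>z. ?h z - z *\<^sub>R velocity \<gamma> x) has_vector_derivative velocity \<eta> z - velocity \<gamma> x) (at z within {x..y})" for z
        by (rule has_vector_derivative_at_within[OF has_vector_derivative_diff[OF v\<eta>(2)]])
      have I: "((\<lambda>z. velocity \<eta> z - velocity \<gamma> x) has_integral (?h y - y *\<^sub>R velocity \<gamma> x) - (?h x - x *\<^sub>R velocity \<gamma> x)) {x..y}"
        by (rule fundamental_theorem_of_calculus[OF less_imp_le[OF xy(2)] D])
      have Z: "norm (velocity \<eta> z - velocity \<gamma> x) \<le> m/2" if z: "z \<in> {x..y}" for z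
      proof -
        have "z \<in> {0..2}" "x \<in> {0..2}" "dist z x < \<delta>0" using z xy \<delta>(3) by (auto simp: dist_real_def)
        then have "norm (velocity \<gamma> z - velocity \<gamma> x) < m/4" using \<delta>0(2) by (simp add: dist_norm)
        then show ?thesis
          using cv[of z] norm_triangle_ineq[of "velocity \<eta> z - velocity \<gamma> z" "velocity \<gamma> z - velocity \<gamma> x"] by simp
      qed
      have "norm ((?h y - y *\<^sub>R velocity \<gamma> x) - (?h x - x *\<^sub>R velocity \<gamma> x)) \<le> m/2 * (y - x)"
        using has_integral_bound_real[OF _ finite.emptyI I, of "m/2"] Z m(1) xy by simp
      moreover have "(?h y - y *\<^sub>R velocity \<gamma> x) - (?h x - x *\<^sub>R velocity \<gamma> x) = - ((y - x) *\<^sub>R velocity \<gamma> x)"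
        by (simp add: eq scaleR_diff_left)
      ultimately have "(y - x) * norm (velocity \<gamma> x) \<le> m/2 * (y - x)" using xy by simp
      then have "norm (velocity \<gamma> x) \<le> m/2" using xy by (simp add: mult.commute)
      then show False using m(1) m(2)[of x] by simp
    qed
    have far: "?h x \<noteq> ?h y" if "(x, y) \<in> C" for x y
    proof
      assume eq: "?h x = ?h y"
      have "?g x - ?g y = (?h y - ?g y) - (?h x - ?g x)" by (simp add: eq)
      then have "norm (?g x - ?g y) \<le> \<mu>/4 + \<mu>/4"
        using cg[of x] cg[of y] norm_triangle_ineq4[of "?h y - ?g y" "?h x - ?g x"] by simp
      then show False using \<mu>(1) \<mu>(2)[OF that] by simp
    qed
    have lt: "?h x \<noteq> ?h y" if xy: "0 \<le> x" "x < y" "y < 1" for x y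
    proof -
      consider "y - x < \<delta>" | "\<delta> \<le> y - x" "y - x \<le> 1 - \<delta>" | "1 - \<delta> < y - x" by linarith
      then show ?thesis
      proof cases
        case 1 then show ?thesis using xy by (intro close) auto
      next
        case 2 then show ?thesis using xy by (intro far) (auto simp: C_def)
      next
        case 3
        \<comment> \<open>The short arc between the two points passes through the parameter \<open>1\<close>.\<close>
        have "?h y \<noteq> ?h (x + 1)" using 3 xy by (intro close) auto
        then show ?thesis using sobolev_periodic[OF \<eta>] by (simp add: periodic1_def)
      qed
    qed
    have "inj_on ?h {0..<1}"
    proof (rule inj_onI)
      fix x y :: real assume "x \<in> {0..<1}" "y \<in> {0..<1}" "?h x = ?h y"
      then show "x = y" using lt[of x y] lt[of y x] by (cases x y rule: linorder_cases) auto
    qed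
    then show "\<eta> \<in> sobolev_injective_regular s"
      using \<eta> reg by (simp add: sobolev_injective_regular_def sobolev_regular_iff)
  qed (rule r(1))
qed

section \<open>The submanifold of arclength parametrized curves\<close>

text \<open>
  For an open set \<open>\<Omega>\<close>, the chart is \<open>h \<mapsto> h + Q h h\<close> with \<open>Q h k = R (h' \<bullet> k') / 2\<close>, and
  the projection is \<open>P h = R (u \<bullet> h')\<close>. Since \<open>R\<close> is a right inverse of \<open>h \<mapsto> u \<bullet> h'\<close>, the
  operator \<open>P\<close> is idempotent and \<open>P (h + Q h h) = R p\<close> with \<open>p = u \<bullet> h' + \<bar>h'\<bar>\<^sup>2 / 2\<close>;
  finally, \<open>\<bar>u + h'\<bar>\<^sup>2 = 1 + 2 p\<close>, and \<open>R\<close> is injective.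
\<close>

lemma smooth_submanifold_arclength:
  fixes \<Omega> :: "(real \<Rightarrow>\<^sub>C 'b::euclidean_space) set"
  assumes s: "1/2 < s" and \<Omega>: "openin (norm_topology (sobolev s) (sobolev_norm s)) \<Omega>"
  shows "smooth_submanifold (sobolev s) (sobolev_norm s) \<Omega> (arclength_curves s \<inter> \<Omega>)"
proof -
  interpret E: banach_carrier "sobolev s :: (real \<Rightarrow>\<^sub>C 'b) set" "sobolev_norm s"
    by (rule banach_carrier_sobolev[OF s])
  have "\<exists>U V \<phi> F G. x0 \<in> U \<and> U \<subseteq> \<Omega> \<and> openin (norm_topology (sobolev s) (sobolev_norm s)) U \<and>
      openin (norm_topology (sobolev s) (sobolev_norm s)) V \<and> smooth_diffeomorphism (sobolev s) (sobolev_norm s) U V \<phi> \<and>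
      closed_splitting (sobolev s) (sobolev_norm s) F G \<and> \<phi> ` (arclength_curves s \<inter> \<Omega> \<inter> U) = V \<inter> F"
    if x0S: "x0 \<in> arclength_curves s \<inter> \<Omega>" for x0
  proof -
    have x0: "x0 \<in> sobolev s" and unit: "\<And>t. norm (velocity x0 t) = 1" using x0S by (auto simp: arclength_curves_iff)
    define u where "u = velocity x0"
    have u: "u \<in> sobolev_fun s" and unit: "\<And>t. norm (u t) = 1" using sobolev_velocity(1)[OF s x0] unit by (auto simp: u_def)
    note cu = sobolev_funD(1)[OF u]
    have "apply_bcontfun x0 (0 + 1) = apply_bcontfun x0 0" using sobolev_periodic[OF x0] by (simp only: periodic1_def)
    then have mean: "prim u 1 = 0"
      using prim_of_derivative[OF sobolev_velocity(2)[OF s x0], of 1] cu by (simp add: u_def)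
    obtain A where A: "bounded_linear A" "\<And>y. prim (\<lambda>t. A y - (A y \<bullet> u t) *\<^sub>R u t) 1 = y"
      proof - show ?thesis by (rule mean_normal_part_surjective[OF cu unit mean]) (fact that) qed
    obtain KL where KL: "0 \<le> KL" "\<And>l. l \<in> sobolev_fun s \<Longrightarrow> lift u A l \<in> sobolev s"
      "\<And>l. l \<in> sobolev_fun s \<Longrightarrow> velocity (lift u A l) = closing u A l"
      "\<And>l. l \<in> sobolev_fun s \<Longrightarrow> apply_bcontfun (lift u A l) = prim (closing u A l)"
      "\<And>l. l \<in> sobolev_fun s \<Longrightarrow> sobolev_norm s (lift u A l) \<le> KL * Hs_norm s l"
      proof - show ?thesis by (rule lift_properties[OF s u unit A]) (fact that) qed
    obtain KI where KI: "0 \<le> KI" "\<And>v w. v \<in> sobolev_fun s \<Longrightarrow> w \<in> sobolev_fun s \<Longrightarrow> (\<lambda>x. (v x :: 'b) \<bullet> w x) \<in> sobolev_fun s"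
      "\<And>v w. v \<in> sobolev_fun s \<Longrightarrow> w \<in> sobolev_fun s \<Longrightarrow> Hs_norm s (\<lambda>x. (v x :: 'b) \<bullet> w x) \<le> KI * Hs_norm s v * Hs_norm s w"
      proof - show ?thesis by (rule Hs_norm_bilinear[OF bounded_bilinear_inner s]) (fact that) qed
    have lin: "lift u A (\<lambda>x. c * l x + m x) = c *\<^sub>R lift u A l + lift u A m"
      if l: "l \<in> sobolev_fun s" and m: "m \<in> sobolev_fun s" for l m c
    proof -
      have lm: "(\<lambda>x. c * l x + m x) \<in> sobolev_fun s"
        using sobolev_fun_add[OF sobolev_fun_scaleR[OF l, of c] m] by simp
      have c: "continuous_on UNIV (closing u A l)" if "l \<in> sobolev_fun s" for l
        using sobolev_funD(1)[OF sobolev_velocity(1)[OF s KL(2)[OF that]]] by (simp add: KL(3)[OF that])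
      show ?thesis
        by (rule lift_linear[OF A(1) cu l KL(4)[OF l] c[OF l] m KL(4)[OF m] c[OF m] KL(4)[OF lm]])
    qed
    have lscale: "lift u A (\<lambda>x. c * l x) = c *\<^sub>R lift u A l" if l: "l \<in> sobolev_fun s" for l c
      using lin[OF l l, of "c - 1"] by (simp add: algebra_simps)
    have ladd: "lift u A (\<lambda>x. l x + m x) = lift u A l + lift u A m"
      if "l \<in> sobolev_fun s" "m \<in> sobolev_fun s" for l m
      using lin[OF that, of 1] by simp
    define P where "P h = lift u A (\<lambda>t. u t \<bullet> velocity h t)" for h :: "real \<Rightarrow>\<^sub>C 'b"
    define Q where "Q h k = lift u A (\<lambda>t. (1/2) * (velocity h t \<bullet> velocity k t))" for h k :: "real \<Rightarrow>\<^sub>C 'b"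
    have iu: "(\<lambda>t. u t \<bullet> velocity h t) \<in> sobolev_fun s" if "h \<in> sobolev s" for h :: "real \<Rightarrow>\<^sub>C 'b"
      by (rule KI(2)[OF u sobolev_velocity(1)[OF s that]])
    have ii: "(\<lambda>t. velocity h t \<bullet> velocity k t) \<in> sobolev_fun s" if "h \<in> sobolev s" "k \<in> sobolev s" for h k :: "real \<Rightarrow>\<^sub>C 'b"
      by (rule KI(2)[OF sobolev_velocity(1)[OF s that(1)] sobolev_velocity(1)[OF s that(2)]])
    have iq: "(\<lambda>t. (1/2) * (velocity h t \<bullet> velocity k t)) \<in> sobolev_fun s" if "h \<in> sobolev s" "k \<in> sobolev s" for h k :: "real \<Rightarrow>\<^sub>C 'b"
      using sobolev_fun_scaleR[OF ii[OF that], of "1/2"] by simp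
    have Qs: "Q h k = (1/2) *\<^sub>R lift u A (\<lambda>t. velocity h t \<bullet> velocity k t)" if "h \<in> sobolev s" "k \<in> sobolev s" for h k :: "real \<Rightarrow>\<^sub>C 'b"
      unfolding Q_def by (rule lscale[OF ii[OF that]])
    have P_in: "P h \<in> sobolev s" if "h \<in> sobolev s" for h :: "real \<Rightarrow>\<^sub>C 'b" unfolding P_def by (rule KL(2)[OF iu[OF that]])
    have Q_in: "Q h k \<in> sobolev s" if "h \<in> sobolev s" "k \<in> sobolev s" for h k :: "real \<Rightarrow>\<^sub>C 'b" unfolding Q_def by (rule KL(2)[OF iq[OF that]])
    have P_vd: "u t \<bullet> velocity (P h) t = u t \<bullet> velocity h t" if "h \<in> sobolev s" for h :: "real \<Rightarrow>\<^sub>C 'b" and t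
      unfolding P_def KL(3)[OF iu[OF that]] by (rule inner_closing[of u t, OF unit])
    have Q_vd: "u t \<bullet> velocity (Q h k) t = (1/2) * (velocity h t \<bullet> velocity k t)" if "h \<in> sobolev s" "k \<in> sobolev s" for h k :: "real \<Rightarrow>\<^sub>C 'b" and t
      unfolding Q_def KL(3)[OF iq[OF that]] by (rule inner_closing[of u t, OF unit])
    have P_add: "P (h + k) = P h + P k" if "h \<in> sobolev s" "k \<in> sobolev s" for h k :: "real \<Rightarrow>\<^sub>C 'b"
      unfolding P_def sobolev_add(2)[OF s that] inner_add_right by (rule ladd[OF iu[OF that(1)] iu[OF that(2)]])
    have P_scale: "P (c *\<^sub>R h) = c *\<^sub>R P h" if "h \<in> sobolev s" for h :: "real \<Rightarrow>\<^sub>C 'b" and c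
      unfolding P_def sobolev_scaleR(2)[OF s that] inner_scaleR_right by (rule lscale[OF iu[OF that]])
    have P_bound: "sobolev_norm s (P h) \<le> (KL * (KI * Hs_norm s u)) * sobolev_norm s h" if h: "h \<in> sobolev s" for h :: "real \<Rightarrow>\<^sub>C 'b"
    proof -
      have "sobolev_norm s (P h) \<le> KL * Hs_norm s (\<lambda>t. u t \<bullet> velocity h t)" unfolding P_def by (rule KL(5)[OF iu[OF h]])
      also have "\<dots> \<le> KL * (KI * Hs_norm s u * Hs_norm s (velocity h))" by (intro mult_left_mono KI(3) u sobolev_velocity(1)[OF s h] KL(1))
      also have "\<dots> \<le> KL * (KI * Hs_norm s u * sobolev_norm s h)"
        by (intro mult_left_mono sobolev_norm_bounds(1)[OF s h] KL(1) mult_nonneg_nonneg KI(1)) simp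
      finally show ?thesis by (simp add: mult.assoc)
    qed
    have P_idem: "P (P h) = P h" if h: "h \<in> sobolev s" for h :: "real \<Rightarrow>\<^sub>C 'b"
      unfolding P_def[of "P h"] P_vd[OF h] by (simp only: P_def)
    have Q_comm: "Q h k = Q k h" for h k :: "real \<Rightarrow>\<^sub>C 'b" unfolding Q_def by (simp only: inner_commute)
    have Q_add: "Q (h + k) l = Q h l + Q k l" if "h \<in> sobolev s" "k \<in> sobolev s" "l \<in> sobolev s" for h k l :: "real \<Rightarrow>\<^sub>C 'b"
      unfolding Qs[OF sobolev_add(1)[OF s that(1,2)] that(3)] Qs[OF that(1,3)] Qs[OF that(2,3)] sobolev_add(2)[OF s that(1,2)] inner_add_left
      by (simp only: ladd[OF ii[OF that(1,3)] ii[OF that(2,3)]] scaleR_add_right)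
    have Q_scale: "Q (c *\<^sub>R h) l = c *\<^sub>R Q h l" if "h \<in> sobolev s" "l \<in> sobolev s" for h l :: "real \<Rightarrow>\<^sub>C 'b" and c
      unfolding Qs[OF sobolev_scaleR(1)[OF s that(1)] that(2)] Qs[OF that] sobolev_scaleR(2)[OF s that(1)] inner_scaleR_left lscale[OF ii[OF that]]
      by simp
    have Q_bound: "sobolev_norm s (Q h k) \<le> (KL * KI) * sobolev_norm s h * sobolev_norm s k"
      if h: "h \<in> sobolev s" and k: "k \<in> sobolev s" for h k :: "real \<Rightarrow>\<^sub>C 'b"
    proof -
      have "sobolev_norm s (Q h k) = 1/2 * sobolev_norm s (lift u A (\<lambda>t. velocity h t \<bullet> velocity k t))"
        unfolding Qs[OF h k] sobolev_norm_scaleR[OF s KL(2)[OF ii[OF h k]]] by simp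
      also have "\<dots> \<le> sobolev_norm s (lift u A (\<lambda>t. velocity h t \<bullet> velocity k t))"
        using sobolev_norm_nonneg[of s "lift u A (\<lambda>t. velocity h t \<bullet> velocity k t)"] by linarith
      also have "\<dots> \<le> KL * Hs_norm s (\<lambda>t. velocity h t \<bullet> velocity k t)" by (rule KL(5)[OF ii[OF h k]])
      also have "\<dots> \<le> KL * (KI * Hs_norm s (velocity h) * Hs_norm s (velocity k))"
        by (intro mult_left_mono KI(3) sobolev_velocity(1)[OF s h] sobolev_velocity(1)[OF s k] KL(1))
      also have "\<dots> \<le> KL * (KI * sobolev_norm s h * sobolev_norm s k)"
        by (intro mult_left_mono mult_mono sobolev_norm_bounds(1)[OF s h] sobolev_norm_bounds(1)[OF s k] KL(1) KI(1)
            mult_nonneg_nonneg sobolev_norm_nonneg Hs_norm_nonneg order_refl)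
      finally show ?thesis by (simp add: mult.assoc)
    qed
    have char: "x \<in> arclength_curves s \<inter> \<Omega> \<longleftrightarrow> P (x - x0 + Q (x - x0) (x - x0)) = 0" if x\<Omega>: "x \<in> \<Omega>" for x
    proof -
      have x: "x \<in> sobolev s" using x\<Omega> \<Omega> by (auto simp: E.openin_norm_topology)
      define h where "h = x - x0"
      have h: "h \<in> sobolev s" unfolding h_def by (rule sobolev_diff(1)[OF s x x0])
      have vdx: "velocity x t = u t + velocity h t" for t unfolding h_def u_def sobolev_diff(2)[OF s x x0] by simp
      define p where "p t = u t \<bullet> velocity h t + (1/2) * (velocity h t \<bullet> velocity h t)" for t
      have p: "p \<in> sobolev_fun s" unfolding p_def by (rule sobolev_fun_add[OF iu[OF h] iq[OF h h]])
      have "P (h + Q h h) = lift u A p"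
        unfolding P_def sobolev_add(2)[OF s h Q_in[OF h h]] inner_add_right Q_vd[OF h h] p_def ..
      moreover have "lift u A p = 0 \<longleftrightarrow> (\<forall>t. p t = 0)"
      proof
        assume 0: "lift u A p = 0"
        have vd0: "velocity (0 :: real \<Rightarrow>\<^sub>C 'b) = (\<lambda>_. 0)"
          by (rule velocity_eqI) (simp add: zero_bcontfun.rep_eq)
        have "closing u A p = (\<lambda>_. 0)" using KL(3)[OF p] unfolding 0 vd0 by simp
        then show "\<forall>t. p t = 0" using inner_closing[of u _ A p, OF unit] by simp
      next
        assume "\<forall>t. p t = 0"
        then have "p = (\<lambda>x. 0 * p x)" by (simp add: fun_eq_iff)
        then show "lift u A p = 0" using lscale[OF p, of 0] by simp
      qed
      moreover have "norm (velocity x t) = 1 \<longleftrightarrow> p t = 0" for t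
      proof -
        have "u t \<bullet> u t = 1" using unit[of t] by (simp add: norm_eq_1)
        then have "velocity x t \<bullet> velocity x t = 1 + 2 * p t"
          by (simp add: vdx p_def inner_add_left inner_add_right inner_commute)
        then show ?thesis by (simp add: norm_eq_1)
      qed
      ultimately show ?thesis using x x\<Omega> by (simp add: arclength_curves_iff h_def)
    qed
    have KLI: "0 \<le> KL * KI" using KL(1) KI(1) by simp
    show ?thesis
      by (rule E.quadratic_constraint_chart[of P "KL * (KI * Hs_norm s u)" Q "KL * KI" \<Omega> x0 "arclength_curves s \<inter> \<Omega>",
            OF P_in P_add P_scale P_bound P_idem Q_in Q_comm Q_add Q_scale Q_bound KLI \<Omega> x0S Int_lower2 char])
  qed
  then show ?thesis unfolding smooth_submanifold_def using \<Omega> by blast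
qed

theorem theorem3p1:
  fixes s :: real
  assumes "CARD('n::finite) \<ge> 2"
    and "1/2 < s" and "s \<le> 1"
  shows "smooth_submanifold
           (sobolev s :: (real \<Rightarrow>\<^sub>C (real ^ 'n)) set) (sobolev_norm s)
           (sobolev_regular s) (arclength_curves s)
       \<and> smooth_submanifold
           (sobolev s :: (real \<Rightarrow>\<^sub>C (real ^ 'n)) set) (sobolev_norm s)
           (sobolev_injective_regular s) (arclength_knots s)"
proof
  have sub: "arclength_curves s \<inter> sobolev_regular s = (arclength_curves s :: (real \<Rightarrow>\<^sub>C (real ^ 'n)) set)"
    by (auto simp: arclength_curves_iff sobolev_regular_iff)
  from sub show "smooth_submanifold (sobolev s :: (real \<Rightarrow>\<^sub>C (real ^ 'n)) set) (sobolev_norm s)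
      (sobolev_regular s) (arclength_curves s)"
    using smooth_submanifold_arclength[OF assms(2) openin_sobolev_regular[OF assms(2)], where 'b = "real ^ 'n"] by simp
  have "arclength_curves s \<inter> sobolev_injective_regular s = (arclength_knots s :: (real \<Rightarrow>\<^sub>C (real ^ 'n)) set)"
    using sub by (auto simp: sobolev_injective_regular_def arclength_knots_def)
  then show "smooth_submanifold (sobolev s :: (real \<Rightarrow>\<^sub>C (real ^ 'n)) set) (sobolev_norm s)
      (sobolev_injective_regular s) (arclength_knots s)"
    using smooth_submanifold_arclength[OF assms(2) openin_sobolev_injective_regular[OF assms(2)], where 'b = "real ^ 'n"] by simp
qed

end
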